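(* Let $m>1$ be an integer and let $n_{\rm d}, n_{\rm e}, n_{\rm c}$ be non-negative integers. There exists an $m$-dimensional real analytic manifold $X_{m,n_{\rm d,e,c}} \subset \mathbb{R}^{m+1}$ such that the following hold, where $\pi_{m+1,1}:\mathbb{R}^{m+1}\to\mathbb{R}$ is the projection to the first coordinate. (1) The function $\pi_{m+1,1}|_{X_{m,n_{\rm d,e,c}}}$ has a Reeb digraph compactification (Reeb-D-C). (2) Furthermore, the Reeb-D-C of $\pi_{m+1,1}|_{X_{m,n_{\rm d,e,c}}}$ can be taken in such a way that its graph diagram for NF is normal, has exactly one vertex ($0$-cell), and has exactly the following edges ($1$-cells), all incident to this vertex: (a) exactly $n_{\rm d}$ edges departing from the vertex whose closures in the whole ($1$-dimensional) space are homeomorphic to $\{t\in\mathbb{R} \mid t\ge 0\}$; (b) exactly $n_{\rm e}$ edges entering the vertex whose closures in the whole ($1$-dimensional) space are homeomorphic to $\{t\in\mathbb{R} \mid t\ge 0\}$; (c) exactly $n_{\rm c}$ edges whose closures in the whole ($1$-dimensional) space are homeomorphic to the circle $S^1$.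
   Context: **Real analytic manifolds.** An $m$-dimensional real analytic manifold $M\subset\mathbb{R}^{m+k}$ means a union of connected components of the zero set of a real analytic map $e:\mathbb{R}^{m+k}\to\mathbb{R}^k$ having no singular point on $M$ (the differential of $e$ has rank $k$ at every point of $M$). **Reeb spaces.** Let $Y=\mathbb{R}$ or $Y=S^1=\{(x_1,x_2)\in\mathbb{R}^2\mid x_1^2+x_2^2=1\}$ and let $c:X\to Y$ be continuous. Write $x_1\sim_c x_2$ if $x_1,x_2$ lie in the same connected component of some preimage $c^{-1}(y)$. The Reeb space is $R_c:=X/{\sim_c}$, with quotient map $q_c:X\to R_c$ and the unique continuous map $\bar c:R_c\to Y$ with $c=\bar c\circ q_c$. For differentiable $c$, $S(c)\subset X$ is the set of its critical (singular) points. $\mathbb{R}$ is oriented by its order and $S^1$ is oriented counterclockwise. **Pre-digraphs.** A pre-digraph is a triplet $(G,S_G,c_G:G\to Y)$, $Y=\mathbb{R}$ or $S^1$, with $G$ a connected Hausdorff space, $c_G$ continuous, $S_G\subset G$ closed, and $G-S_G$ a disjoint union $\bigsqcup_{j\in J_G}e_{G,j}$ of copies $e_{G,j}$ of $\mathbb{R}$, such that taking the $e_{G,j}$ as $1$-cells and the points of $S_G$ as $0$-cells makes $G$ a (at most) $1$-dimensional cell complex (the closure of each $e_{G,j}$ is the union of $e_{G,j}$ and some points of $S_G$; no finiteness or weak-topology condition is required), and such that each $c_G|_{e_{G,j}}$ is injective. **Non-finite points.** ${\rm NF}(G,S_G)$ is the set of all points $p\in G$ that have no connected neighborhood which is homeomorphic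 to a finite connected graph and contains no point of $S_G$ other than possibly $p$ itself. **Graph diagram for NF.** Consider the set of connected components of $G-{\rm NF}(G,S_G)$. Two components $C_1,C_2$ are related if at least one of the following holds. - For some $s\in{\rm NF}(G,S_G)$ there are non-empty families $\{e_{G,j_1}\}$ of $1$-cells contained in $C_1$ and $\{e_{G,j_2}\}$ of $1$-cells contained in $C_2$ such that the restrictions of $c_G$ to the closures in $G$ of the unions of these families have their maximum value at $s$. Then $s$ is an ascending point for these components. - The same with "minimum" in place of "maximum". Then $s$ is a descending point for these components. (When $Y=S^1$, maximum and minimum are understood with respect to the counterclockwise order on an arc of $S^1$ containing the relevant values.) Take the equivalence relation generated by this relation. Ascending and descending points for an equivalence class are defined naturally from its members. The graph diagram for NF of $(G,S_G,c_G)$ is the $0$- or $1$-dimensional cell complex whose $0$-cells (vertices) $v_{[C]}$ are the equivalence classes $[C]$ and whose $1$-cells (edges) are the elements of ${\rm NF}(G,S_G)$. The $1$-cell given by $s$ departs from $v_{[C]}$ if and only if $s$ is an ascending point for $[C]$, and enters $v_{[C]}$ if and only if $s$ is a descending point for $[C]$. (An edge may have a vertex at only one of its ends.) It is normal if each equivalence class $[C]$ consists of exactly one connected component of $G-{\rm NF}(G,S_G)$. **Reeb digraphs.** The Reeb digraph of $c:X\to Y$ is $(R_c,q_c(S(c)),\bar c)$, provided this is a pre-digraph. **Compactifications.** Let $\mathcal{C}$ be a category such as the smooth, real algebraic, real analytic or topological one, and let $\mathcal{C}'$ be a category obtained from $\mathcal{C}$ by a forgetful functor. For a map $c:X\to Y$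 in $\mathcal{C}$, let $\phi_X:X\to X_0$ and $\phi_Y:Y\to Y_0$ be embeddings in $\mathcal{C}$ with $\phi_X(X)$ dense in a compact connected space $X_0$ and $\phi_Y(Y)$ dense in a connected space $Y_0$. A map $c_0:X_0\to Y_0$ in $\mathcal{C}'$ with $c_0\circ\phi_X=\phi_Y\circ c$ is a compactification of $c$ in $\mathcal{C}'$. **Reeb-D-C.** Suppose that the Reeb digraph of $c:X\to Y$ is defined and that $c_0:X_0\to Y_0$, with $Y_0=\mathbb{R}$ or $S^1$, is a compactification of $c$ in the topological category, with embeddings $\phi_X,\phi_Y$. If $(R_{c_0},\,q_{c_0}(\phi_X(S(c))\cup(X_0-\phi_X(X))),\,\bar{c_0})$ is a pre-digraph, it is called a Reeb digraph compactification (Reeb-D-C) of $c$. *)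

theory Defs
  imports "HOL-Analysis.Analysis"
begin

section \<open>Real analytic manifolds in Euclidean space\<close>

text \<open>Multi-indices are functions from the standard basis to the naturals.  Unconditional
  summability (\<^const>\<open>has_sum\<close>) is absolute convergence, the codomain being finite-dimensional.\<close>

definition real_analytic_on :: "('a::euclidean_space \<Rightarrow> 'b::euclidean_space) \<Rightarrow> 'a set \<Rightarrow> bool" where
  "real_analytic_on f U \<longleftrightarrow>
    (\<forall>x\<in>U. \<exists>r>0. \<exists>a :: ('a \<Rightarrow> nat) \<Rightarrow> 'b. \<forall>y\<in>ball x r.
       ((\<lambda>\<alpha>. (\<Prod>b\<in>Basis. ((y - x) \<bullet> b) ^ \<alpha> b) *\<^sub>R a \<alpha>) has_sum f y) (Basis \<rightarrow>\<^sub>E UNIV))"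

text \<open>The manifold \<open>M\<close>, cut out by \<open>e\<close>, has dimension \<open>DIM('a) - DIM('b)\<close>.\<close>

definition real_analytic_manifold :: "('a::euclidean_space \<Rightarrow> 'b::euclidean_space) \<Rightarrow> 'a set \<Rightarrow> bool" where
  "real_analytic_manifold e M \<longleftrightarrow>
    real_analytic_on e UNIV \<and>
    (\<exists>\<K> \<subseteq> components {x. e x = 0}. M = \<Union>\<K>) \<and>
    (\<forall>x\<in>M. surj (frechet_derivative e (at x)))"

definition tangent_space :: "('a::euclidean_space \<Rightarrow> 'b::euclidean_space) \<Rightarrow> 'a \<Rightarrow> 'a set" where
  "tangent_space e x = {v. frechet_derivative e (at x) v = 0}"

text \<open>Critical points of the restriction to \<open>M\<close> of a function \<open>c\<close> that is differentiable on the
  ambient space: the differential of the restriction is the differential of \<open>c\<close> on the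
  tangent space.\<close>

definition critical_points ::
    "('a::euclidean_space \<Rightarrow> 'b::euclidean_space) \<Rightarrow> 'a set \<Rightarrow> ('a \<Rightarrow> real) \<Rightarrow> 'a set" where
  "critical_points e M c = {x\<in>M. frechet_derivative c (at x) ` tangent_space e x \<noteq> UNIV}"


section \<open>Oriented targets: the line and the circle\<close>

text \<open>An oriented arc is given by a parametrisation \<open>p\<close> on an interval \<open>I\<close>, injective on \<open>I\<close> and
  compatible with the orientation.\<close>

record 'y target =
  target_top :: "'y topology"
  oriented_arcs :: "(real set \<times> (real \<Rightarrow> 'y)) set"

definition real_line :: "real target" where
  "real_line = \<lparr>target_top = euclideanreal, oriented_arcs = {(UNIV, \<lambda>t. t)}\<rparr>"

text \<open>On the circle the maximal arcs are the complements of a single point; the cut point itself is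
  excluded, so it is never a maximum or a minimum with respect to that arc.\<close>

definition circle :: "complex target" where
  "circle = \<lparr>target_top = top_of_set (sphere 0 1),
             oriented_arcs = {({a<..<a + 2 * pi}, cis) | a. True}\<rparr>"

definition maximum_of :: "'y target \<Rightarrow> 'y set \<Rightarrow> 'y \<Rightarrow> bool" where
  "maximum_of Y V y \<longleftrightarrow> y \<in> V \<and>
    (\<exists>(I, p)\<in>oriented_arcs Y. V \<subseteq> p ` I \<and> (\<exists>u\<in>I. p u = y \<and> (\<forall>t\<in>I. p t \<in> V \<longrightarrow> t \<le> u)))"

definition minimum_of :: "'y target \<Rightarrow> 'y set \<Rightarrow> 'y \<Rightarrow> bool" where
  "minimum_of Y V y \<longleftrightarrow> y \<in> V \<and>
    (\<exists>(I, p)\<in>oriented_arcs Y. V \<subseteq> p ` I \<and> (\<exists>u\<in>I. p u = y \<and> (\<forall>t\<in>I. p t \<in> V \<longrightarrow> u \<le> t)))"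


section \<open>Reeb spaces\<close>

definition reeb_map :: "'a topology \<Rightarrow> ('a \<Rightarrow> 'y) \<Rightarrow> 'a \<Rightarrow> 'a set" where
  "reeb_map X c x = connected_component_of_set (subtopology X {z. c z = c x}) x"

definition reeb_space :: "'a topology \<Rightarrow> ('a \<Rightarrow> 'y) \<Rightarrow> 'a set topology" where
  "reeb_space X c = topology (\<lambda>U. U \<subseteq> reeb_map X c ` topspace X \<and>
                                   openin X {x \<in> topspace X. reeb_map X c x \<in> U})"

text \<open>The map induced on the Reeb space; \<open>c\<close> is constant on each class.\<close>

definition reeb_fun :: "('a \<Rightarrow> 'y) \<Rightarrow> 'a set \<Rightarrow> 'y" where
  "reeb_fun c K = the_elem (c ` K)"

lemma openin_reeb_space:
  "openin (reeb_space X c) U \<longleftrightarrow>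
     U \<subseteq> reeb_map X c ` topspace X \<and> openin X {x \<in> topspace X. reeb_map X c x \<in> U}"
proof -
  have "istopology (\<lambda>U. U \<subseteq> reeb_map X c ` topspace X \<and>
                         openin X {x \<in> topspace X. reeb_map X c x \<in> U})"
    unfolding istopology_def
  proof (intro conjI allI impI)
    fix S T
    assume "S \<subseteq> reeb_map X c ` topspace X \<and> openin X {x \<in> topspace X. reeb_map X c x \<in> S}"
      and "T \<subseteq> reeb_map X c ` topspace X \<and> openin X {x \<in> topspace X. reeb_map X c x \<in> T}"
    moreover have "{x \<in> topspace X. reeb_map X c x \<in> S \<inter> T} =
        {x \<in> topspace X. reeb_map X c x \<in> S} \<inter> {x \<in> topspace X. reeb_map X c x \<in> T}"
      by auto
    ultimately show "S \<inter> T \<subseteq> reeb_map X c ` topspace X"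
      "openin X {x \<in> topspace X. reeb_map X c x \<in> S \<inter> T}"
      by (blast, simp add: openin_Int)
  next
    fix \<K>
    assume \<K>: "\<forall>K\<in>\<K>. K \<subseteq> reeb_map X c ` topspace X \<and>
                       openin X {x \<in> topspace X. reeb_map X c x \<in> K}"
    then show "\<Union>\<K> \<subseteq> reeb_map X c ` topspace X"
      by blast
    have "{x \<in> topspace X. reeb_map X c x \<in> \<Union>\<K>} =
        (\<Union>K\<in>\<K>. {x \<in> topspace X. reeb_map X c x \<in> K})"
      by auto
    moreover have "openin X (\<Union>K\<in>\<K>. {x \<in> topspace X. reeb_map X c x \<in> K})"
      by (rule openin_Union) (use \<K> in blast)
    ultimately show "openin X {x \<in> topspace X. reeb_map X c x \<in> \<Union>\<K>}"
      by simp
  qed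
  then show ?thesis
    unfolding reeb_space_def by (simp only: topology_inverse')
qed

lemma topspace_reeb_space: "topspace (reeb_space X c) = reeb_map X c ` topspace X"
proof
  show "topspace (reeb_space X c) \<subseteq> reeb_map X c ` topspace X"
    by (metis openin_reeb_space openin_topspace)
  have "{x \<in> topspace X. reeb_map X c x \<in> reeb_map X c ` topspace X} = topspace X"
    by auto
  then have "openin (reeb_space X c) (reeb_map X c ` topspace X)"
    by (simp add: openin_reeb_space)
  then show "reeb_map X c ` topspace X \<subseteq> topspace (reeb_space X c)"
    by (rule openin_subset)
qed

lemma quotient_map_reeb_map: "quotient_map X (reeb_space X c) (reeb_map X c)"
  by (auto simp: quotient_map_def topspace_reeb_space openin_reeb_space)

lemma reeb_fun_reeb_map:
  assumes "x \<in> topspace X"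
  shows "reeb_fun c (reeb_map X c x) = c x"
proof -
  have "x \<in> reeb_map X c x"
    using assms by (simp add: reeb_map_def connected_component_of_refl)
  moreover have "reeb_map X c x \<subseteq> {z. c z = c x}"
    unfolding reeb_map_def
    using connected_component_of_subset_topspace[of "subtopology X {z. c z = c x}" x]
    unfolding topspace_subtopology by blast
  ultimately have "c ` reeb_map X c x = {c x}"
    by blast
  then show ?thesis
    by (simp add: reeb_fun_def)
qed


section \<open>Pre-digraphs and non-finite points\<close>

text \<open>If \<open>G - S\<close> is a topological disjoint union of lines, its 1-cells are necessarily the
  connected components of \<open>G - S\<close>.\<close>

definition one_cells :: "'g topology \<Rightarrow> 'g set \<Rightarrow> 'g set set" where
  "one_cells G S = connected_components_of (subtopology G (topspace G - S))"

definition pre_digraph :: "'y target \<Rightarrow> 'g topology \<Rightarrow> 'g set \<Rightarrow> ('g \<Rightarrow> 'y) \<Rightarrow> bool" where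
  "pre_digraph Y G S c \<longleftrightarrow>
    connected_space G \<and> Hausdorff_space G \<and> continuous_map G (target_top Y) c \<and> closedin G S \<and>
    (\<forall>E\<in>one_cells G S.
       openin (subtopology G (topspace G - S)) E \<and>
       subtopology G E homeomorphic_space euclideanreal \<and>
       G closure_of E \<subseteq> E \<union> S \<and>
       inj_on c E)"

text \<open>A finite graph as a finite CW complex of dimension at most 1, with 0-cells \<open>V\<close> and one
  characteristic map in \<open>\<Gamma>\<close> for each 1-cell (loops and multiple edges are allowed).\<close>

definition finite_graph :: "'g topology \<Rightarrow> bool" where
  "finite_graph N \<longleftrightarrow> Hausdorff_space N \<and>
    (\<exists>V (\<Gamma> :: (real \<Rightarrow> 'g) set). finite V \<and> finite \<Gamma> \<and>
       (\<forall>\<gamma>\<in>\<Gamma>. continuous_map (top_of_set {0..1}) N \<gamma> \<and> \<gamma> 0 \<in> V \<and> \<gamma> 1 \<in> V \<and>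
               inj_on \<gamma> {0<..<1} \<and> disjnt (\<gamma> ` {0<..<1}) V) \<and>
       disjoint_family_on (\<lambda>\<gamma>. \<gamma> ` {0<..<1}) \<Gamma> \<and>
       topspace N = V \<union> (\<Union>\<gamma>\<in>\<Gamma>. \<gamma> ` {0<..<1}))"

definition NF :: "'g topology \<Rightarrow> 'g set \<Rightarrow> 'g set" where
  "NF G S = {p \<in> topspace G.
     \<not> (\<exists>N U. openin G U \<and> p \<in> U \<and> U \<subseteq> N \<and> connectedin G N \<and>
              finite_graph (subtopology G N) \<and> N \<inter> S \<subseteq> {p})}"


section \<open>The graph diagram for non-finite points\<close>

definition nf_components :: "'g topology \<Rightarrow> 'g set \<Rightarrow> 'g set set" where
  "nf_components G S = connected_components_of (subtopology G (topspace G - NF G S))"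

definition ascending_point ::
    "'y target \<Rightarrow> 'g topology \<Rightarrow> 'g set \<Rightarrow> ('g \<Rightarrow> 'y) \<Rightarrow> 'g \<Rightarrow> 'g set \<Rightarrow> bool" where
  "ascending_point Y G S c s C \<longleftrightarrow>
    (\<exists>F \<subseteq> one_cells G S. F \<noteq> {} \<and> \<Union>F \<subseteq> C \<and> s \<in> G closure_of \<Union>F \<and>
       maximum_of Y (c ` (G closure_of \<Union>F)) (c s))"

definition descending_point ::
    "'y target \<Rightarrow> 'g topology \<Rightarrow> 'g set \<Rightarrow> ('g \<Rightarrow> 'y) \<Rightarrow> 'g \<Rightarrow> 'g set \<Rightarrow> bool" where
  "descending_point Y G S c s C \<longleftrightarrow>
    (\<exists>F \<subseteq> one_cells G S. F \<noteq> {} \<and> \<Union>F \<subseteq> C \<and> s \<in> G closure_of \<Union>F \<and>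
       minimum_of Y (c ` (G closure_of \<Union>F)) (c s))"

definition nf_related ::
    "'y target \<Rightarrow> 'g topology \<Rightarrow> 'g set \<Rightarrow> ('g \<Rightarrow> 'y) \<Rightarrow> ('g set \<times> 'g set) set" where
  "nf_related Y G S c = {(C1, C2) \<in> nf_components G S \<times> nf_components G S. \<exists>s\<in>NF G S.
     (ascending_point Y G S c s C1 \<and> ascending_point Y G S c s C2) \<or>
     (descending_point Y G S c s C1 \<and> descending_point Y G S c s C2)}"

text \<open>The relation \<^const>\<open>nf_related\<close> is symmetric, so its reflexive transitive closure is the
  equivalence relation generated by it.\<close>

definition diagram_vertices ::
    "'y target \<Rightarrow> 'g topology \<Rightarrow> 'g set \<Rightarrow> ('g \<Rightarrow> 'y) \<Rightarrow> 'g set set set" where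
  "diagram_vertices Y G S c = nf_components G S // Restr ((nf_related Y G S c)\<^sup>*) (nf_components G S)"

definition departs ::
    "'y target \<Rightarrow> 'g topology \<Rightarrow> 'g set \<Rightarrow> ('g \<Rightarrow> 'y) \<Rightarrow> 'g \<Rightarrow> 'g set set \<Rightarrow> bool" where
  "departs Y G S c s v \<longleftrightarrow> (\<exists>C\<in>v. ascending_point Y G S c s C)"

definition enters ::
    "'y target \<Rightarrow> 'g topology \<Rightarrow> 'g set \<Rightarrow> ('g \<Rightarrow> 'y) \<Rightarrow> 'g \<Rightarrow> 'g set set \<Rightarrow> bool" where
  "enters Y G S c s v \<longleftrightarrow> (\<exists>C\<in>v. descending_point Y G S c s C)"

definition normal_diagram :: "'y target \<Rightarrow> 'g topology \<Rightarrow> 'g set \<Rightarrow> ('g \<Rightarrow> 'y) \<Rightarrow> bool" where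
  "normal_diagram Y G S c \<longleftrightarrow> (\<forall>v\<in>diagram_vertices Y G S c. \<exists>C. v = {C})"

text \<open>The underlying space of the diagram, with the weak topology.  The open edge of \<open>s\<close> consists of
  the points \<open>Inr (s, t)\<close> with \<open>0 < t < 1\<close>; it is attached at \<open>t \<rightarrow> 0\<close> to the vertex it departs from
  and at \<open>t \<rightarrow> 1\<close> to the vertex it enters, whenever such a vertex exists.\<close>

definition diagram_edge :: "'g \<Rightarrow> ('g set set + 'g \<times> real) set" where
  "diagram_edge s = Inr ` ({s} \<times> {0<..<1})"

definition diagram_points ::
    "'y target \<Rightarrow> 'g topology \<Rightarrow> 'g set \<Rightarrow> ('g \<Rightarrow> 'y) \<Rightarrow> ('g set set + 'g \<times> real) set" where
  "diagram_points Y G S c = Inl ` diagram_vertices Y G S c \<union> (\<Union>s\<in>NF G S. diagram_edge s)"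

definition diagram_open ::
    "'y target \<Rightarrow> 'g topology \<Rightarrow> 'g set \<Rightarrow> ('g \<Rightarrow> 'y) \<Rightarrow> ('g set set + 'g \<times> real) set \<Rightarrow> bool" where
  "diagram_open Y G S c W \<longleftrightarrow>
    W \<subseteq> diagram_points Y G S c \<and>
    (\<forall>s\<in>NF G S.
       open {t \<in> {0<..<1}. Inr (s, t) \<in> W} \<and>
       (\<forall>v. Inl v \<in> W \<and> departs Y G S c s v \<longrightarrow> (\<forall>\<^sub>F t in at_right 0. Inr (s, t) \<in> W)) \<and>
       (\<forall>v. Inl v \<in> W \<and> enters Y G S c s v \<longrightarrow> (\<forall>\<^sub>F t in at_left 1. Inr (s, t) \<in> W)))"

definition diagram_space ::
    "'y target \<Rightarrow> 'g topology \<Rightarrow> 'g set \<Rightarrow> ('g \<Rightarrow> 'y) \<Rightarrow> ('g set set + 'g \<times> real) topology" where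
  "diagram_space Y G S c = topology (diagram_open Y G S c)"

lemma openin_diagram_space: "openin (diagram_space Y G S c) = diagram_open Y G S c"
proof -
  have "istopology (diagram_open Y G S c)"
    unfolding istopology_def
  proof (intro conjI allI impI)
    fix A B
    assume A: "diagram_open Y G S c A" and B: "diagram_open Y G S c B"
    have "{t \<in> {0<..<1}. Inr (s, t) \<in> A \<inter> B} =
        {t \<in> {0<..<1}. Inr (s, t) \<in> A} \<inter> {t \<in> {0<..<1}. Inr (s, t) \<in> B}" for s
      by auto
    with A B show "diagram_open Y G S c (A \<inter> B)"
      unfolding diagram_open_def by (simp add: open_Int eventually_conj_iff le_infI1) blast
  next
    fix \<K>
    assume \<K>: "\<forall>K\<in>\<K>. diagram_open Y G S c K"
    show "diagram_open Y G S c (\<Union>\<K>)"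
      unfolding diagram_open_def
    proof (intro conjI ballI allI impI)
      show "\<Union>\<K> \<subseteq> diagram_points Y G S c"
        using \<K> unfolding diagram_open_def by blast
      fix s assume s: "s \<in> NF G S"
      have "{t \<in> {0<..<1}. Inr (s, t) \<in> \<Union>\<K>} = (\<Union>K\<in>\<K>. {t \<in> {0<..<1}. Inr (s, t) \<in> K})"
        by auto
      moreover have "open (\<Union>K\<in>\<K>. {t \<in> {0<..<1}. Inr (s, t) \<in> K})"
        by (rule open_UN) (use \<K> s in \<open>unfold diagram_open_def, blast\<close>)
      ultimately show "open {t \<in> {0<..<1}. Inr (s, t) \<in> \<Union>\<K>}"
        by simp
      {
        fix v assume v: "Inl v \<in> \<Union>\<K> \<and> departs Y G S c s v"
        then obtain K where K: "K \<in> \<K>" "Inl v \<in> K" by blast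
        then have "\<forall>\<^sub>F t in at_right 0. Inr (s, t) \<in> K"
          using \<K> s v unfolding diagram_open_def by blast
        then show "\<forall>\<^sub>F t in at_right 0. Inr (s, t) \<in> \<Union>\<K>"
          by (rule eventually_mono) (use K in blast)
      next
        fix v assume v: "Inl v \<in> \<Union>\<K> \<and> enters Y G S c s v"
        then obtain K where K: "K \<in> \<K>" "Inl v \<in> K" by blast
        then have "\<forall>\<^sub>F t in at_left 1. Inr (s, t) \<in> K"
          using \<K> s v unfolding diagram_open_def by blast
        then show "\<forall>\<^sub>F t in at_left 1. Inr (s, t) \<in> \<Union>\<K>"
          by (rule eventually_mono) (use K in blast)
      }
    qed
  qed
  then show ?thesis
    unfolding diagram_space_def by (rule topology_inverse')
qed

definition closed_edge ::
    "'y target \<Rightarrow> 'g topology \<Rightarrow> 'g set \<Rightarrow> ('g \<Rightarrow> 'y) \<Rightarrow> 'g \<Rightarrow> ('g set set + 'g \<times> real) topology" where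
  "closed_edge Y G S c s =
    subtopology (diagram_space Y G S c) (diagram_space Y G S c closure_of diagram_edge s)"

text \<open>The diagram has a single vertex, with \<open>n\<^sub>d\<close> departing half-open edges, \<open>n\<^sub>e\<close> entering
  half-open edges, \<open>n\<^sub>c\<close> loops, and no other edges.\<close>

definition one_vertex_diagram ::
    "nat \<Rightarrow> nat \<Rightarrow> nat \<Rightarrow> 'y target \<Rightarrow> 'g topology \<Rightarrow> 'g set \<Rightarrow> ('g \<Rightarrow> 'y) \<Rightarrow> bool" where
  "one_vertex_diagram n\<^sub>d n\<^sub>e n\<^sub>c Y G S c \<longleftrightarrow>
    (\<exists>v. diagram_vertices Y G S c = {v} \<and>
      (let D = {s \<in> NF G S. departs Y G S c s v \<and>
                  closed_edge Y G S c s homeomorphic_space top_of_set {0::real..}};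
           E = {s \<in> NF G S. enters Y G S c s v \<and>
                  closed_edge Y G S c s homeomorphic_space top_of_set {0::real..}};
           L = {s \<in> NF G S. (departs Y G S c s v \<or> enters Y G S c s v) \<and>
                  closed_edge Y G S c s homeomorphic_space top_of_set (sphere (0::complex) 1)}
       in NF G S = D \<union> E \<union> L \<and> finite (NF G S) \<and> card D = n\<^sub>d \<and> card E = n\<^sub>e \<and> card L = n\<^sub>c))"


section \<open>Compactifications\<close>

definition compactification ::
    "'a topology \<Rightarrow> 'y topology \<Rightarrow> ('a \<Rightarrow> 'y) \<Rightarrow> 'b topology \<Rightarrow> 'z topology \<Rightarrow>
     ('a \<Rightarrow> 'b) \<Rightarrow> ('y \<Rightarrow> 'z) \<Rightarrow> ('b \<Rightarrow> 'z) \<Rightarrow> bool" where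
  "compactification X Y c X0 Y0 \<phi>X \<phi>Y c0 \<longleftrightarrow>
    compact_space X0 \<and> connected_space X0 \<and> connected_space Y0 \<and>
    embedding_map X X0 \<phi>X \<and> X0 closure_of (\<phi>X ` topspace X) = topspace X0 \<and>
    embedding_map Y Y0 \<phi>Y \<and> Y0 closure_of (\<phi>Y ` topspace Y) = topspace Y0 \<and>
    continuous_map X0 Y0 c0 \<and> (\<forall>x\<in>topspace X. c0 (\<phi>X x) = \<phi>Y (c x))"

text \<open>The 0-cells of a Reeb digraph compactification of \<open>c\<close>, where \<open>S\<close> is the critical set of \<open>c\<close>.\<close>

definition reeb_dc_vertices ::
    "'a topology \<Rightarrow> 'a set \<Rightarrow> 'b topology \<Rightarrow> ('a \<Rightarrow> 'b) \<Rightarrow> ('b \<Rightarrow> 'z) \<Rightarrow> 'b set set" where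
  "reeb_dc_vertices X S X0 \<phi>X c0 =
    reeb_map X0 c0 ` (\<phi>X ` S \<union> (topspace X0 - \<phi>X ` topspace X))"

definition reeb_dc ::
    "'a topology \<Rightarrow> 'a set \<Rightarrow> 'y target \<Rightarrow> ('a \<Rightarrow> 'y) \<Rightarrow> 'b topology \<Rightarrow> 'z target \<Rightarrow>
     ('a \<Rightarrow> 'b) \<Rightarrow> ('y \<Rightarrow> 'z) \<Rightarrow> ('b \<Rightarrow> 'z) \<Rightarrow> bool" where
  "reeb_dc X S Y c X0 Y0 \<phi>X \<phi>Y c0 \<longleftrightarrow>
    pre_digraph Y (reeb_space X c) (reeb_map X c ` S) (reeb_fun c) \<and>
    compactification X (target_top Y) c X0 (target_top Y0) \<phi>X \<phi>Y c0 \<and>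
    pre_digraph Y0 (reeb_space X0 c0) (reeb_dc_vertices X S X0 \<phi>X c0) (reeb_fun c0)"

definition reeb_dc_with_diagram ::
    "nat \<Rightarrow> nat \<Rightarrow> nat \<Rightarrow> 'a topology \<Rightarrow> 'a set \<Rightarrow> 'y target \<Rightarrow> ('a \<Rightarrow> 'y) \<Rightarrow> 'b topology \<Rightarrow> 'z target \<Rightarrow>
     ('a \<Rightarrow> 'b) \<Rightarrow> ('y \<Rightarrow> 'z) \<Rightarrow> ('b \<Rightarrow> 'z) \<Rightarrow> bool" where
  "reeb_dc_with_diagram n\<^sub>d n\<^sub>e n\<^sub>c X S Y c X0 Y0 \<phi>X \<phi>Y c0 \<longleftrightarrow>
    reeb_dc X S Y c X0 Y0 \<phi>X \<phi>Y c0 \<and>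
    normal_diagram Y0 (reeb_space X0 c0) (reeb_dc_vertices X S X0 \<phi>X c0) (reeb_fun c0) \<and>
    one_vertex_diagram n\<^sub>d n\<^sub>e n\<^sub>c
      Y0 (reeb_space X0 c0) (reeb_dc_vertices X S X0 \<phi>X c0) (reeb_fun c0)"

end

theory Submission
  imports Defs
begin

text \<open>
If there are edges, the hypersurface is the graph, over the complement of finitely many points, of
\<open>warp \<circ> Psi\<close>. Here \<open>warp\<close> is a strictly increasing homeomorphism of the line whose critical points are
the multiples of \<open>2\<pi>\<close>, and \<open>Psi = mu / (1 - mu\<^sup>2)\<close>, where \<open>mu\<close> is the height function of a round sphere
composed with the branched cover \<open>z \<mapsto> z\<^sup>k\<close> in one complex coordinate. The set where \<open>mu \<noteq> 0\<close> consists
of \<open>2k\<close> lobes, and in each of them the level sets of \<open>mu\<close> are connected, so the Reeb space is a star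
with \<open>2k\<close> arms, alternately ascending and descending. The critical classes accumulate exactly at the
outer ends of the arms, where \<open>mu = 1\<close> or \<open>mu = -1\<close> and the function tends to \<open>\<infinity>\<close> or \<open>-\<infinity>\<close>.

The compactification adds a point at infinity, which joins the central level \<open>mu = 0\<close>, and one point
for each end over the point at infinity of the target, which becomes a circle. As several arms may
share an end, the number of ends is arbitrary: an end of ascending arms only is a departing edge, one
of descending arms only an entering edge, and one of both a loop. If only one of the two kinds of arms
is wanted, \<open>Psi\<close> is replaced by its square or the negative of its square. Without edges, a hyperplane
does.
\<close>

section \<open>Star-shaped graphs\<close>

text \<open>The obstacle is analyticity on the whole space. A strictly increasing function with
  infinitely many critical points, such as \<open>t - sin t\<close>, composed with
  \<open>Psi\<close> is not analytic where \<open>mu\<close> is 1 or -1, and no clearing of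
  denominators repairs that. So the roles are reversed: \<open>warp\<close> is defined implicitly by
  \<open>wig x t = 0\<close>, in which the trigonometric functions see only the height
  \<open>x\<close>, while \<open>t\<close> enters as a cubic polynomial. With
  \<open>t = PP / QQ\<close>, multiplication by \<open>QQ ^ 3\<close> gives an equation that is
  analytic everywhere; at a pole it reads \<open>PP ^ 3 = 0\<close>, which fails, so the zero set
  has no stray points there. The critical points of \<open>warp\<close> are no extrema: they put
  infinitely many 0-cells on each arm without making the arm branch or turn back. Nor does the
  branched cover disturb the picture: where \<open>\<bar>mu w\<bar> < 1\<close>, the critical points
  of \<open>mu\<close> lie on \<open>mu = 0\<close>, where \<open>Psi = 0\<close>, and this level is
  critical for \<open>warp\<close> anyway.\<close>

lemma connected_component_of_clopen:
  assumes "connectedin X C" "openin X C" "closedin X C" "x \<in> C"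
  shows "connected_component_of_set X x = C"
proof (rule connected_component_of_unique)
  show "C' \<subseteq> C" if "x \<in> C' \<and> connectedin X C'" for C'
    using connectedin_clopen_cases[OF _ assms(3,2), of C'] that assms(4) by (auto simp: disjnt_iff)
qed (use assms in auto)

lemma connected_components_of_open_partition:
  assumes cover: "topspace X = \<Union>\<C>"
    and op: "\<And>C. C \<in> \<C> \<Longrightarrow> openin X C"
    and con: "\<And>C. C \<in> \<C> \<Longrightarrow> connectedin X C"
    and ne: "{} \<notin> \<C>"
    and disj: "\<And>C D x. C \<in> \<C> \<Longrightarrow> D \<in> \<C> \<Longrightarrow> x \<in> C \<Longrightarrow> x \<in> D \<Longrightarrow> C = D"
  shows "connected_components_of X = \<C>"
proof -
  have "connected_component_of_set X x = C" if C: "C \<in> \<C>" "x \<in> C" for x C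
  proof (rule connected_component_of_clopen)
    have "topspace X - C = \<Union>(\<C> - {C})"
      using cover disj C by blast
    then show "closedin X C"
      using C cover by (auto simp: closedin_def intro: op)
  qed (use C op con in auto)
  then show ?thesis
    unfolding connected_components_of_def cover using ne by (auto simp: image_iff) (metis equals0I)
qed

text \<open>Half-open arms occur in the Reeb space of the hypersurface itself, closed arms in that
  of its compactification; the flag lets one locale serve both.\<close>

definition arm_dom :: "bool \<Rightarrow> real set" where
  "arm_dom full = (if full then {0..1} else {0..<1})"

text \<open>The map \<open>K j\<close> parametrises the \<open>j\<close>-th arm from the centre outwards and \<open>\<rho>\<close> is the common
  parameter.  If the star is \<open>full\<close>, the outer ends of the arms are present, and two of them coincide
  if and only if they have the same value under \<open>en\<close>.\<close>

locale star =
  fixes G :: "'g topology" and n :: nat and full :: bool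
    and K :: "nat \<Rightarrow> real \<Rightarrow> 'g" and \<rho> :: "'g \<Rightarrow> real" and en :: "nat \<Rightarrow> nat"
  assumes n_pos: "0 < n"
    and top: "topspace G = (\<Union>j<n. K j ` arm_dom full)"
    and cont_K: "j < n \<Longrightarrow> continuous_map (top_of_set (arm_dom full)) G (K j)"
    and cont_\<rho>: "continuous_map G euclideanreal \<rho>"
    and \<rho>_K: "j < n \<Longrightarrow> r \<in> arm_dom full \<Longrightarrow> \<rho> (K j r) = r"
    and K_0: "i < n \<Longrightarrow> j < n \<Longrightarrow> K i 0 = K j 0"
    and K_1: "full \<Longrightarrow> i < n \<Longrightarrow> j < n \<Longrightarrow> en i = en j \<Longrightarrow> K i 1 = K j 1"
    and arm_open: "j < n \<Longrightarrow> openin G (K j ` {0<..<1})"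
    and arm_disj: "i < n \<Longrightarrow> j < n \<Longrightarrow> 0 < r \<Longrightarrow> r < 1 \<Longrightarrow> K i r = K j r \<Longrightarrow> i = j"
    and end_open: "full \<Longrightarrow> j < n \<Longrightarrow> openin G {K i r | i r. i < n \<and> en i = en j \<and> 1/2 < r \<and> r \<le> 1}"
    and end_inj: "full \<Longrightarrow> i < n \<Longrightarrow> j < n \<Longrightarrow> K i 1 = K j 1 \<Longrightarrow> en i = en j"
begin

lemma arm_domI: "0 \<le> r \<Longrightarrow> r < 1 \<Longrightarrow> r \<in> arm_dom full"
  by (simp add: arm_dom_def)

lemma arm_dom_bounds: "r \<in> arm_dom full \<Longrightarrow> 0 \<le> r \<and> r \<le> 1"
  by (auto simp: arm_dom_def split: if_splits)

lemma K_in: "j < n \<Longrightarrow> r \<in> arm_dom full \<Longrightarrow> K j r \<in> topspace G"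
  using top by auto

lemma pointE:
  assumes "p \<in> topspace G"
  obtains j where "j < n" "\<rho> p \<in> arm_dom full" "p = K j (\<rho> p)"
  using assms top \<rho>_K by fastforce

lemma K_eq:
  assumes "i < n" "j < n" "r \<in> arm_dom full" "s \<in> arm_dom full" "0 < r" "r < 1" "K i r = K j s"
  shows "i = j" "r = s"
  using assms \<rho>_K arm_disj by metis+

lemma open_less: "openin G {p \<in> topspace G. \<rho> p \<in> U}" if "open U"
  using that cont_\<rho> by (simp add: continuous_map_def)

lemma segment_eq:
  assumes "j < n" "0 \<le> a" "b \<le> 1"
  shows "K j ` {a<..<b} = K j ` {0<..<1} \<inter> {p \<in> topspace G. \<rho> p \<in> {a<..<b}}"
  using assms by (auto simp: K_in \<rho>_K arm_domI)

lemma segment_open: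
  assumes "j < n" "0 \<le> a" "b \<le> 1"
  shows "openin G (K j ` {a<..<b})"
  unfolding segment_eq[OF assms] by (intro openin_Int arm_open open_less assms) auto

lemma cont_K_sub: "j < n \<Longrightarrow> A \<subseteq> arm_dom full \<Longrightarrow> continuous_map (top_of_set A) G (K j)"
  using cont_K continuous_map_from_subtopology_mono by blast

lemma connectedin_K: "j < n \<Longrightarrow> A \<subseteq> arm_dom full \<Longrightarrow> connected A \<Longrightarrow> connectedin G (K j ` A)"
  using connectedin_continuous_map_image[OF cont_K, of j A]
  by (simp add: connectedin_subtopology connectedin_iff_connected)

lemma connectedin_sub_star:
  assumes "A \<subseteq> arm_dom full" "connected A" "0 \<in> A"
  shows "connectedin G (\<Union>j<n. K j ` A)"
proof (rule connectedin_Union)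
  have "K 0 0 \<in> \<Inter> ((\<lambda>j. K j ` A) ` {..<n})"
    using K_0[OF n_pos] assms(3) by blast
  then show "\<Inter> ((\<lambda>j. K j ` A) ` {..<n}) \<noteq> {}"
    by blast
qed (use assms connectedin_K in auto)

lemma connected_G: "connected_space G"
proof -
  have "connected (arm_dom full)" "0 \<in> arm_dom full"
    by (auto simp: arm_dom_def)
  then show ?thesis
    using connectedin_sub_star[of "arm_dom full"] unfolding top[symmetric] connectedin_topspace by simp
qed

text \<open>Points of different radius are separated by \<open>\<rho>\<close>. At equal radius the
  open arms separate in the interior, the neighbourhoods of the ends do so at radius 1, and at
  radius 0 there is only one point.\<close>

lemma Hausdorff_G: "Hausdorff_space G"
  unfolding Hausdorff_space_def
proof (intro allI impI, elim conjE)
  fix p q assume pq: "p \<in> topspace G" "q \<in> topspace G" "p \<noteq> q"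
  show "\<exists>U V. openin G U \<and> openin G V \<and> p \<in> U \<and> q \<in> V \<and> disjnt U V"
  proof (cases "\<rho> p = \<rho> q")
    case False
    from hausdorff[OF this] obtain U V where UV: "open U" "open V" "\<rho> p \<in> U" "\<rho> q \<in> V" "U \<inter> V = {}"
      by blast
    have "disjnt {p \<in> topspace G. \<rho> p \<in> U} {p \<in> topspace G. \<rho> p \<in> V}"
      using UV(5) by (auto simp: disjnt_iff)
    then show ?thesis
      using UV pq open_less by blast
  next
    case True
    obtain i where i: "i < n" "\<rho> p \<in> arm_dom full" "p = K i (\<rho> p)"
      using pointE pq by blast
    obtain j where j: "j < n" "q = K j (\<rho> p)"
      using pointE pq True by metis
    consider "\<rho> p = 0" | "0 < \<rho> p" "\<rho> p < 1" | "\<rho> p = 1"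
      using arm_dom_bounds[OF i(2)] by fastforce
    then show ?thesis
    proof cases
      case 1
      then show ?thesis using i(3) j(2) pq(3) K_0[OF i(1) j(1)] by simp
    next
      case 2
      have "i \<noteq> j" using i j pq by auto
      have "K i r \<noteq> K j s" if "0 < r" "r < 1" "0 < s" "s < 1" for r s
        using K_eq(1)[OF i(1) j(1), of r s] that \<open>i \<noteq> j\<close> arm_domI[of r] arm_domI[of s] by auto
      then have "disjnt (K i ` {0<..<1}) (K j ` {0<..<1})"
        by (auto simp: disjnt_iff)
      moreover have "p \<in> K i ` {0<..<1}" "q \<in> K j ` {0<..<1}"
        using 2 i j by auto
      ultimately show ?thesis
        using arm_open i j by blast
    next
      case 3
      then have full
        using i(2) by (auto simp: arm_dom_def split: if_splits)
      have "en i \<noteq> en j"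
        using K_1[OF \<open>full\<close> i(1) j(1)] i(3) j(2) pq(3) 3 by auto
      define E where "E j = {K i r | i r. i < n \<and> en i = en j \<and> 1/2 < r \<and> r \<le> 1}" for j
      have "disjnt (E i) (E j)"
      proof (unfold disjnt_iff, safe)
        fix x assume "x \<in> E i" "x \<in> E j"
        then obtain a r b s where *: "a < n" "b < n" "en a = en i" "en b = en j" "1/2 < r" "r \<le> 1"
          "1/2 < s" "s \<le> 1" "x = K a r" "x = K b s"
          unfolding E_def by blast
        have "r \<in> arm_dom full" "s \<in> arm_dom full"
          using * \<open>full\<close> by (auto simp: arm_dom_def)
        then have "r = s" using * \<rho>_K by metis
        have "a = b \<or> r = 1"
          using K_eq(1)[of a b r s] * \<open>r \<in> _\<close> \<open>s \<in> _\<close> by fastforce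
        then show False
          using \<open>en i \<noteq> en j\<close> * end_inj[OF \<open>full\<close>, of a b] \<open>r = s\<close> by auto
      qed
      moreover have "p \<in> E i" "q \<in> E j"
        using i j 3 unfolding E_def by force+
      ultimately show ?thesis
        using end_open[OF \<open>full\<close>] i(1) j(1) unfolding E_def by blast
    qed
  qed
qed

text \<open>The radius \<open>\<rho>\<close> is a continuous inverse of \<open>K j\<close> on the
  segment.\<close>

lemma homeomorphic_segment:
  assumes "j < n" "0 \<le> a" "a < b" "b \<le> 1"
  shows "subtopology G (K j ` {a<..<b}) homeomorphic_space euclideanreal"
proof -
  have sub: "{a<..<b} \<subseteq> arm_dom full"
    using assms by (auto intro: arm_domI)
  have "homeomorphic_maps (top_of_set {a<..<b}) (subtopology G (K j ` {a<..<b})) (K j) \<rho>"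
    unfolding homeomorphic_maps_def
  proof (intro conjI ballI)
    show "continuous_map (top_of_set {a<..<b}) (subtopology G (K j ` {a<..<b})) (K j)"
      using cont_K_sub[OF assms(1) sub] by (simp add: continuous_map_in_subtopology)
    show "continuous_map (subtopology G (K j ` {a<..<b})) (top_of_set {a<..<b}) \<rho>"
      using cont_\<rho> sub assms(1)
      by (auto simp: continuous_map_in_subtopology \<rho>_K subset_iff intro: continuous_map_from_subtopology)
  qed (use sub assms(1) in \<open>auto simp: \<rho>_K subset_iff\<close>)
  then have "top_of_set {a<..<b} homeomorphic_space subtopology G (K j ` {a<..<b})"
    unfolding homeomorphic_space_def by blast
  moreover obtain f g where "homeomorphism {a<..<b} (UNIV::real set) f g"
    using homeomorphic_open_interval_UNIV[OF assms(3)] unfolding homeomorphic_def by blast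
  then have "homeomorphic_maps (top_of_set {a<..<b}) euclideanreal f g"
    by (auto simp: homeomorphism_def homeomorphic_maps_def continuous_map_in_subtopology)
  then have "top_of_set {a<..<b} homeomorphic_space euclideanreal"
    unfolding homeomorphic_space_def by blast
  ultimately show ?thesis
    by (metis homeomorphic_space_sym homeomorphic_space_trans)
qed

end

text \<open>The marks are the radii of the critical classes. They tend to 1 without reaching it, so
  they accumulate at the outer ends only, and \<open>z 0 = 0\<close> makes the centre, where the
  arms meet, a 0-cell.\<close>

locale marked_star = star +
  fixes z :: "nat \<Rightarrow> real" and S :: "'a set"
  assumes mono_z: "strict_mono z" and z_0: "z 0 = 0" and z_less: "z i < 1" and z_lim: "z \<longlonglongrightarrow> 1"
    and S_eq: "S = {K j (z i) | i j. j < n} \<union> {K j 1 | j. full \<and> j < n}"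
begin

lemma z_nonneg: "0 \<le> z i"
  using mono_z z_0 by (metis le0 strict_mono_less_eq)

lemma z_dom: "z i \<in> arm_dom full"
  using z_nonneg z_less by (simp add: arm_dom_def less_imp_le)

lemma z_gap:
  assumes "0 < r" "r < 1" "r \<notin> range z"
  obtains i where "z i < r" "r < z (Suc i)"
proof -
  have ex: "\<exists>i. r < z i"
    using order_tendstoD(1)[OF z_lim assms(2)] by (auto simp: eventually_sequentially)
  \<comment> \<open>As \<open>z 0 = 0 < r\<close>, the index \<open>m\<close> is positive, so there
    is a mark before it, and that one lies below \<open>r\<close>.\<close>
  define m where "m = (LEAST i. r < z i)"
  have m: "r < z m"
    unfolding m_def using ex by (rule LeastI_ex)
  then have "m \<noteq> 0"
    using z_0 assms(1) by (cases m) auto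
  then obtain i where "m = Suc i" by (cases m) auto
  then have "\<not> r < z i"
    using not_less_Least[of i "\<lambda>i. r < z i"] by (simp add: m_def)
  then have "z i < r"
    using assms(3) by (metis linorder_neqE_linordered_idom rangeI)
  then show thesis
    using that m \<open>m = Suc i\<close> by blast
qed

definition cell :: "nat \<Rightarrow> nat \<Rightarrow> 'a set" where
  "cell j i = K j ` {z i<..<z (Suc i)}"

lemma cell_bounds: "0 \<le> z i" "z i < z (Suc i)" "z (Suc i) \<le> 1"
  using z_nonneg z_less[of "Suc i"] mono_z by (auto simp: strict_mono_def)

lemma z_between: "z i < z k \<Longrightarrow> z k < z (Suc i) \<Longrightarrow> False"
  using mono_z by (simp add: strict_mono_less)

lemma compl_S: "topspace G - S = (\<Union>j<n. \<Union>i. cell j i)"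
proof (intro equalityI subsetI)
  fix p assume p: "p \<in> topspace G - S"
  then obtain j where j: "j < n" "\<rho> p \<in> arm_dom full" "p = K j (\<rho> p)"
    using pointE by blast
  have in_S: "p \<in> S" if "\<rho> p = z i" for i
    using j that unfolding S_eq by (metis (mono_tags, lifting) UnI1 mem_Collect_eq)
  then have "\<rho> p \<notin> range z"
    using p by blast
  moreover have "0 < \<rho> p"
    using arm_dom_bounds[OF j(2)] \<open>\<rho> p \<notin> range z\<close> z_0 by (metis less_eq_real_def rangeI)
  moreover have "\<rho> p \<noteq> 1"
  proof
    assume "\<rho> p = 1"
    then have "p \<in> S"
      using j unfolding S_eq by (auto simp: arm_dom_def split: if_splits)
    then show False using p by blast
  qed
  ultimately obtain i where "z i < \<rho> p" "\<rho> p < z (Suc i)"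
    using z_gap arm_dom_bounds[OF j(2)] by (metis less_eq_real_def)
  then have "p \<in> cell j i"
    using j(3) unfolding cell_def by (metis greaterThanLessThan_iff imageI)
  then show "p \<in> (\<Union>j<n. \<Union>i. cell j i)"
    using j(1) by blast
next
  fix p assume "p \<in> (\<Union>j<n. \<Union>i. cell j i)"
  then obtain j i r where r: "j < n" "z i < r" "r < z (Suc i)" "p = K j r"
    unfolding cell_def by auto
  then have dom: "r \<in> arm_dom full" and "r < 1" "0 < r"
    using cell_bounds[of i] by (auto intro: arm_domI)
  have "p \<notin> S"
  proof
    assume "p \<in> S"
    then consider i' k where "k < n" "p = K k (z i')" | k where full "k < n" "p = K k 1"
      unfolding S_eq by blast
    then show False
    proof cases
      case 1
      then have "r = z i'"
        using \<rho>_K[OF r(1) dom] \<rho>_K[OF _ z_dom] r(4) by metis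
      then show False
        using r(2,3) z_between by blast
    next
      case 2
      then have "1 \<in> arm_dom full" by (simp add: arm_dom_def)
      then have "r = 1"
        using 2 \<rho>_K[OF r(1) dom] \<rho>_K r(4) by metis
      then show False
        using \<open>r < 1\<close> by simp
    qed
  qed
  then show "p \<in> topspace G - S"
    using r dom K_in by auto
qed

lemma S_subset: "S \<subseteq> topspace G"
  unfolding S_eq using K_in z_dom by (auto simp: arm_dom_def split: if_splits)

lemma cell_open: "j < n \<Longrightarrow> openin G (cell j i)"
  unfolding cell_def using cell_bounds by (intro segment_open) auto

lemma closed_S: "closedin G S"
proof -
  have "openin G (topspace G - S)"
    unfolding compl_S using cell_open by blast
  then show ?thesis
    using S_subset by (simp add: closedin_def)
qed

lemma cell_dom: "{z i<..<z (Suc i)} \<subseteq> arm_dom full" "{z i<..<z (Suc i)} \<subseteq> {0<..<1}"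
  using cell_bounds[of i] z_less[of "Suc i"] by (auto intro: arm_domI)

lemma one_cells_eq: "one_cells G S = {cell j i | i j. j < n}"
  unfolding one_cells_def
proof (rule connected_components_of_open_partition)
  show "topspace (subtopology G (topspace G - S)) = \<Union> {cell j i | i j. j < n}"
    using compl_S by auto
  show "openin (subtopology G (topspace G - S)) C" "connectedin (subtopology G (topspace G - S)) C"
    if CE: "C \<in> {cell j i | i j. j < n}" for C
  proof -
    obtain i j where C: "j < n" "C = cell j i"
      using CE by blast
    then have sub: "C \<subseteq> topspace G - S"
      using compl_S by blast
    then show "openin (subtopology G (topspace G - S)) C"
      using cell_open[of j i] C unfolding openin_subtopology by blast
    have "connectedin G C"
      unfolding C(2) cell_def using C(1) cell_dom by (intro connectedin_K) auto
    then show "connectedin (subtopology G (topspace G - S)) C"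
      using sub by (simp add: connectedin_subtopology)
  qed
  have "cell j i \<noteq> {}" for i j
    unfolding cell_def using cell_bounds(2)[of i] by (simp add: dense)
  then show "{} \<notin> {cell j i | i j. j < n}"
    by auto
  show "C = D" if CD: "C \<in> {cell j i | i j. j < n}" "D \<in> {cell j i | i j. j < n}" and x: "x \<in> C" "x \<in> D" for C D x
  proof -
    obtain i j i' j' where C: "j < n" "C = cell j i" "j' < n" "D = cell j' i'"
      using CD by blast
    obtain r r' where r: "r \<in> {z i<..<z (Suc i)}" "r' \<in> {z i'<..<z (Suc i')}" "x = K j r" "x = K j' r'"
      using x C unfolding cell_def by blast
    then have "j = j'" "r = r'"
      using K_eq[of j j' r r'] C cell_dom[of i] cell_dom[of i'] by (auto simp: subset_iff)
    moreover from this have "z i < z (Suc i')" "z i' < z (Suc i)"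
      using r by auto
    then have "i = i'"
      using mono_z by (simp add: strict_mono_less)
    ultimately show ?thesis
      using C by simp
  qed
qed

lemma pre_digraph_star:
  assumes "continuous_map G (target_top Y) c" "\<And>j. j < n \<Longrightarrow> inj_on (\<lambda>r. c (K j r)) {0<..<1}"
  shows "pre_digraph Y G S c"
  unfolding pre_digraph_def
proof (intro conjI ballI)
  fix E assume E: "E \<in> one_cells G S"
  then obtain i j where C: "j < n" "E = cell j i"
    unfolding one_cells_eq by blast
  then have sub: "E \<subseteq> topspace G - S"
    using compl_S by blast
  then show "openin (subtopology G (topspace G - S)) E"
    using cell_open[of j i] C unfolding openin_subtopology by blast
  show "subtopology G E homeomorphic_space euclideanreal"
    unfolding C(2) cell_def using cell_bounds C(1) by (intro homeomorphic_segment) auto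
  \<comment> \<open>A component of the complement of \<open>S\<close> is closed in it, so its
    closure in \<open>G\<close> can gain only points of \<open>S\<close>.\<close>
  have "closedin (subtopology G (topspace G - S)) E"
    using E unfolding one_cells_def by (rule closedin_connected_components_of)
  then obtain T where "closedin G T" "E = T \<inter> (topspace G - S)"
    unfolding closedin_subtopology by blast
  then have "G closure_of E \<inter> (topspace G - S) \<subseteq> E"
    using closure_of_minimal[of E T G] by blast
  then show "G closure_of E \<subseteq> E \<union> S"
    using closure_of_subset_topspace[of G E] by blast
  show "inj_on c E"
    unfolding C(2) cell_def
    using inj_on_subset[OF assms(2)[OF C(1)] cell_dom(2)[of i]] by (auto simp: inj_on_def)
qed (use assms connected_G Hausdorff_G closed_S in auto)

end

section \<open>Non-finite points of a full star\<close>

locale full_star = marked_star G n True K \<rho> en z S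
  for G :: "'g topology" and n K \<rho> en z S
begin

lemma dom_full: "r \<in> arm_dom True \<longleftrightarrow> 0 \<le> r \<and> r \<le> 1"
  by (auto simp: arm_dom_def)

lemma K_near_end:
  assumes "j < n" "openin G U" "K j 1 \<in> U"
  obtains a where "a < 1" "0 \<le> a" "\<And>r. a < r \<Longrightarrow> r \<le> 1 \<Longrightarrow> K j r \<in> U"
proof -
  have "openin (top_of_set {0..1}) {r \<in> {0..1}. K j r \<in> U}"
    using cont_K[OF assms(1)] assms(2) unfolding continuous_map_def by (simp add: arm_dom_def)
  moreover have "1 \<in> {r \<in> {0..1}. K j r \<in> U}"
    using assms(3) by simp
  ultimately obtain e where "e > 0" and e: "\<And>r. r \<in> {0..1} \<Longrightarrow> dist r 1 < e \<Longrightarrow> K j r \<in> U"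
    unfolding openin_euclidean_subtopology_iff by blast
  show thesis
  proof (rule that[of "max 0 (1 - e)"])
    show "K j r \<in> U" if "max 0 (1 - e) < r" "r \<le> 1" for r
      using that by (intro e) (auto simp: dist_real_def)
  qed (use \<open>e > 0\<close> in auto)
qed

lemma z_pos: "i > 0 \<Longrightarrow> z i > 0"
  using mono_z z_0 by (metis strict_mono_less)

text \<open>The marks accumulate at the end, so each of its neighbourhoods contains points of
  \<open>S\<close> other than the end.\<close>

lemma end_in_NF:
  assumes "j < n"
  shows "K j 1 \<in> NF G S"
proof -
  have False if N: "openin G U" "K j 1 \<in> U" "U \<subseteq> N" "N \<inter> S \<subseteq> {K j 1}" for N U
  proof -
    obtain a where a: "a < 1" "\<And>r. a < r \<Longrightarrow> r \<le> 1 \<Longrightarrow> K j r \<in> U"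
      using K_near_end[OF assms N(1,2)] by metis
    obtain i where "a < z i"
      using order_tendstoD(1)[OF z_lim a(1)] by (auto simp: eventually_sequentially)
    then have "K j (z i) \<in> U"
      using a(2) z_less[of i] by simp
    moreover have "K j (z i) \<in> S"
      unfolding S_eq using assms by blast
    ultimately have "K j (z i) = K j 1"
      using N by blast
    then have "z i = 1"
      using \<rho>_K[OF assms z_dom[of i]] \<rho>_K[OF assms, of 1] dom_full[of 1] by auto
    then show False
      using z_less[of i] by simp
  qed
  then show ?thesis
    using K_in[OF assms, of 1] by (auto simp: NF_def dom_full)
qed

text \<open>The neighbourhoods that show a point to be finite all have this form. For
  \<open>a = 0\<close> the arcs are glued at the centre and the vertices \<open>K j a\<close>
  coincide; for a single index the set is one closed arc.\<close>

lemma finite_graph_arcs: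
  assumes fin: "finite I" and I: "I \<subseteq> {..<n}" and ab: "0 \<le> a" "a < b" "b < 1"
  shows "finite_graph (subtopology G (\<Union>j\<in>I. K j ` {a..b}))"
  unfolding finite_graph_def
proof (intro conjI exI)
  let ?N = "\<Union>j\<in>I. K j ` {a..b}"
  \<comment> \<open>Affine reparametrisation, since \<open>finite_graph\<close> asks for edges over
    the unit interval.\<close>
  define g where "g t = a + (b - a) * t" for t
  have g: "0 \<le> t \<Longrightarrow> t \<le> 1 \<Longrightarrow> a \<le> g t \<and> g t \<le> b"
    "0 < t \<Longrightarrow> t < 1 \<Longrightarrow> a < g t \<and> g t < b" for t
  proof -
    show "a \<le> g t \<and> g t \<le> b" if t: "0 \<le> t" "t \<le> 1"
    proof -
      have "(b - a) * t \<le> (b - a) * 1" "0 \<le> (b - a) * t"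
        using t ab by (intro mult_left_mono mult_nonneg_nonneg; simp)+
      then show ?thesis by (simp add: g_def)
    qed
    show "a < g t \<and> g t < b" if t: "0 < t" "t < 1"
    proof -
      have "(b - a) * t < (b - a) * 1" "0 < (b - a) * t"
        using t ab by (intro mult_strict_left_mono mult_pos_pos; simp)+
      then show ?thesis by (simp add: g_def)
    qed
  qed
  have gdom: "g t \<in> arm_dom True" if "0 \<le> t" "t \<le> 1" for t
    using g(1)[OF that] ab by (simp add: dom_full)
  have \<rho>g: "\<rho> (K j (g t)) = g t" if "j \<in> I" "0 \<le> t" "t \<le> 1" for j t
    using that I gdom \<rho>_K by blast
  have adom: "r \<in> arm_dom True" if "a \<le> r" "r \<le> b" for r
    using that ab by (simp add: dom_full)
  show "Hausdorff_space (subtopology G ?N)"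
    by (intro Hausdorff_space_subtopology Hausdorff_G)
  show "finite ((\<lambda>j. K j a) ` I \<union> (\<lambda>j. K j b) ` I)" "finite ((\<lambda>j t. K j (g t)) ` I)"
    using fin by auto
  show "\<forall>\<gamma>\<in>(\<lambda>j t. K j (g t)) ` I.
       continuous_map (top_of_set {0..1}) (subtopology G ?N) \<gamma> \<and>
       \<gamma> 0 \<in> (\<lambda>j. K j a) ` I \<union> (\<lambda>j. K j b) ` I \<and>
       \<gamma> 1 \<in> (\<lambda>j. K j a) ` I \<union> (\<lambda>j. K j b) ` I \<and>
       inj_on \<gamma> {0<..<1} \<and> disjnt (\<gamma> ` {0<..<1}) ((\<lambda>j. K j a) ` I \<union> (\<lambda>j. K j b) ` I)"
  proof (intro ballI, elim imageE, simp only:, intro conjI)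
    fix j assume j: "j \<in> I"
    then have jn: "j < n" using I by auto
    have "continuous_map (top_of_set {0..1}) (top_of_set (arm_dom True)) g"
      using gdom by (auto simp: continuous_map_in_subtopology g_def intro!: continuous_intros)
    then have "continuous_map (top_of_set {0..1}) G (\<lambda>t. K j (g t))"
      using continuous_map_compose[OF _ cont_K[OF jn], of _ g] by (simp add: o_def)
    then show "continuous_map (top_of_set {0..1}) (subtopology G ?N) (\<lambda>t. K j (g t))"
      using g(1) j by (auto simp: continuous_map_in_subtopology)
    show "K j (g 0) \<in> (\<lambda>j. K j a) ` I \<union> (\<lambda>j. K j b) ` I" "K j (g 1) \<in> (\<lambda>j. K j a) ` I \<union> (\<lambda>j. K j b) ` I"
      using j by (auto simp: g_def)
    show "inj_on (\<lambda>t. K j (g t)) {0<..<1}"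
    proof (rule inj_onI)
      fix s t :: real assume st: "s \<in> {0<..<1}" "t \<in> {0<..<1}" "K j (g s) = K j (g t)"
      from st(3) have "\<rho> (K j (g s)) = \<rho> (K j (g t))"
        by (rule arg_cong)
      moreover have "\<rho> (K j (g s)) = g s" "\<rho> (K j (g t)) = g t"
        using st(1,2) by (intro \<rho>g j; simp)+
      ultimately have "(b - a) * s = (b - a) * t"
        unfolding g_def by linarith
      then show "s = t"
        using ab by simp
    qed
    have "K j (g t) \<noteq> K i a" "K j (g t) \<noteq> K i b" if t: "0 < t" "t < 1" and i: "i \<in> I" for i t
    proof -
      have "\<rho> (K i a) = a" "\<rho> (K i b) = b"
        using \<rho>_K adom[of a] adom[of b] i I ab by auto
      moreover have "\<rho> (K j (g t)) = g t" "a < g t" "g t < b"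
        using \<rho>g[OF j] g(2)[OF t] t by auto
      ultimately show "K j (g t) \<noteq> K i a" "K j (g t) \<noteq> K i b"
        by auto
    qed
    then show "disjnt ((\<lambda>t. K j (g t)) ` {0<..<1}) ((\<lambda>j. K j a) ` I \<union> (\<lambda>j. K j b) ` I)"
      by (auto simp: disjnt_iff)
  qed
  show "disjoint_family_on (\<lambda>\<gamma>. \<gamma> ` {0<..<1}) ((\<lambda>j t. K j (g t)) ` I)"
    unfolding disjoint_family_on_def
  proof (intro ballI impI, elim imageE, simp only:)
    fix i j assume ij: "i \<in> I" "j \<in> I" "(\<lambda>t. K i (g t)) \<noteq> (\<lambda>t. K j (g t))"
    have False if "0 < s" "s < 1" "0 < t" "t < 1" "K i (g s) = K j (g t)" for s t
    proof -
      have "i = j"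
        using K_eq(1)[of i j "g s" "g t"] that ij(1,2) I gdom[of s] gdom[of t] g(2)[of s] ab by auto
      then show False using ij(3) by simp
    qed
    then show "(\<lambda>t. K i (g t)) ` {0<..<1} \<inter> (\<lambda>t. K j (g t)) ` {0<..<1} = {}"
      by fastforce
  qed
  have "?N \<subseteq> topspace G"
    using K_in adom I by auto
  then have "topspace (subtopology G ?N) = ?N"
    by auto
  also have "\<dots> = (\<lambda>j. K j a) ` I \<union> (\<lambda>j. K j b) ` I \<union> (\<Union>\<gamma>\<in>(\<lambda>j t. K j (g t)) ` I. \<gamma> ` {0<..<1})"
  proof (intro equalityI subsetI)
    fix p assume "p \<in> ?N"
    then obtain j r where r: "j \<in> I" "a \<le> r" "r \<le> b" "p = K j r"
      by auto
    define t where "t = (r - a) / (b - a)"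
    have "g t = r"
      using ab by (simp add: g_def t_def)
    have "r = a \<or> r = b \<or> 0 < t \<and> t < 1"
      using r ab by (auto simp: t_def)
    then show "p \<in> (\<lambda>j. K j a) ` I \<union> (\<lambda>j. K j b) ` I \<union> (\<Union>\<gamma>\<in>(\<lambda>j t. K j (g t)) ` I. \<gamma> ` {0<..<1})"
    proof (elim disjE conjE)
      assume "0 < t" "t < 1"
      then have "p \<in> (\<lambda>t. K j (g t)) ` {0<..<1}"
        using r \<open>g t = r\<close> by auto
      then show ?thesis
        using r(1) by blast
    qed (use r in auto)
  next
    fix p assume "p \<in> (\<lambda>j. K j a) ` I \<union> (\<lambda>j. K j b) ` I \<union> (\<Union>\<gamma>\<in>(\<lambda>j t. K j (g t)) ` I. \<gamma> ` {0<..<1})"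
    then show "p \<in> ?N"
      using ab g(1) by fastforce
  qed
  finally show "topspace (subtopology G ?N) =
      (\<lambda>j. K j a) ` I \<union> (\<lambda>j. K j b) ` I \<union> (\<Union>\<gamma>\<in>(\<lambda>j t. K j (g t)) ` I. \<gamma> ` {0<..<1})" .
qed

lemma not_NF:
  assumes j: "j < n" and r: "0 \<le> r" "r < 1"
  shows "K j r \<notin> NF G S"
proof (cases "r = 0")
  case True
  \<comment> \<open>Half the first positive mark: within this radius there is no mark but the
    centre.\<close>
  define b where "b = z 1 / 2"
  have b: "0 < b" "b < z 1" "b < 1"
    using z_pos[of 1] z_less[of 1] by (auto simp: b_def)
  define N where "N = (\<Union>j\<in>{..<n}. K j ` {0..b})"
  have "openin G {p \<in> topspace G. \<rho> p \<in> {..<b}}"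
    by (intro open_less) auto
  moreover have "K j r \<in> {p \<in> topspace G. \<rho> p \<in> {..<b}}"
    using K_in[OF j, of 0] \<rho>_K[OF j, of 0] True b by (simp add: dom_full)
  moreover have "{p \<in> topspace G. \<rho> p \<in> {..<b}} \<subseteq> N"
  proof
    fix p assume p: "p \<in> {p \<in> topspace G. \<rho> p \<in> {..<b}}"
    then obtain j where j: "j < n" "\<rho> p \<in> arm_dom True" "p = K j (\<rho> p)"
      using pointE by blast
    moreover have "\<rho> p \<in> {0..b}"
      using p j(2) by (simp add: dom_full)
    ultimately show "p \<in> N"
      unfolding N_def by (metis UN_I imageI lessThan_iff)
  qed
  moreover have "connectedin G N"
    unfolding N_def using b by (intro connectedin_sub_star) (auto simp: dom_full)
  moreover have "finite_graph (subtopology G N)"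
    unfolding N_def using b by (intro finite_graph_arcs) auto
  moreover have "N \<inter> S \<subseteq> {K j r}"
  proof
    fix p assume "p \<in> N \<inter> S"
    then obtain i s where i: "i < n" "0 \<le> s" "s \<le> b" "p = K i s" and "p \<in> S"
      unfolding N_def by auto
    then have \<rho>p: "\<rho> p = s"
      using \<rho>_K[OF i(1), of s] b by (simp add: dom_full)
    have "s = 1 \<or> s \<in> range z"
      using \<open>p \<in> S\<close> \<rho>p \<rho>_K z_dom dom_full[of 1] unfolding S_eq by auto
    then obtain k where "s = z k"
      using i b by auto
    then have "k = 0"
      using i(3) b mono_z by (metis less_one linorder_not_less order.strict_trans1 strict_mono_less_eq)
    then show "p \<in> {K j r}"
      using i(1,4) True \<open>s = z k\<close> z_0 K_0[OF i(1) j] by simp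
  qed
  ultimately show ?thesis
    unfolding NF_def by blast
next
  case False
  then have "0 < r" using r by simp
  \<comment> \<open>Only finitely many marks lie below \<open>c\<close>, and \<open>d\<close> is a
    distance to those among them that differ from \<open>r\<close>. The radius \<open>e\<close> also
    keeps the arc away from the centre and below \<open>c\<close>.\<close>
  define c where "c = (1 + r) / 2"
  have "c < 1" "r < c" using r by (auto simp: c_def)
  obtain m where m: "\<And>i. i \<ge> m \<Longrightarrow> c < z i"
    using order_tendstoD(1)[OF z_lim \<open>c < 1\<close>] by (auto simp: eventually_sequentially)
  obtain d where "d > 0" and d: "\<forall>x\<in>z ` {..<m}. x \<noteq> r \<longrightarrow> d \<le> dist r x"
    using finite_set_avoid[of "z ` {..<m}" r] by auto
  define e where "e = min (d / 2) (min (r / 2) (c - r))"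
  have e: "0 < e" "e < d" "e < r" "e \<le> c - r"
    using \<open>d > 0\<close> \<open>0 < r\<close> \<open>r < c\<close> by (auto simp: e_def)
  define N where "N = (\<Union>j\<in>{j}. K j ` {r - e..r + e})"
  have sub: "{r - e..r + e} \<subseteq> arm_dom True"
    using e \<open>c < 1\<close> by (auto simp: dom_full)
  have "openin G (K j ` {r - e<..<r + e})"
    using e \<open>c < 1\<close> by (intro segment_open j) auto
  moreover have "K j r \<in> K j ` {r - e<..<r + e}"
    using e by auto
  moreover have "K j ` {r - e<..<r + e} \<subseteq> N"
    unfolding N_def by auto
  moreover have "connectedin G N"
    unfolding N_def using connectedin_K[OF j sub] by simp
  moreover have "finite_graph (subtopology G N)"
    unfolding N_def using j e \<open>c < 1\<close> by (intro finite_graph_arcs) auto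
  moreover have "N \<inter> S \<subseteq> {K j r}"
  proof
    fix p assume "p \<in> N \<inter> S"
    then obtain s where s: "r - e \<le> s" "s \<le> r + e" "p = K j s" and "p \<in> S"
      unfolding N_def by auto
    then have "s \<in> arm_dom True" using sub by auto
    then have \<rho>p: "\<rho> p = s"
      using s j \<rho>_K by blast
    have "s = 1 \<or> s \<in> range z"
      using \<open>p \<in> S\<close> \<rho>p \<rho>_K z_dom dom_full[of 1] unfolding S_eq by auto
    moreover have "s \<le> c"
      using s e by simp
    ultimately obtain k where k: "s = z k"
      using \<open>c < 1\<close> by auto
    then have "k < m"
      using m[of k] \<open>s \<le> c\<close> by (meson linorder_not_le)
    then have "s = r \<or> d \<le> dist r s"
      using d k by auto
    then have "s = r"
      using s e by (auto simp: dist_real_def)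
    then show "p \<in> {K j r}"
      using s by simp
  qed
  ultimately show ?thesis
    unfolding NF_def by blast
qed

lemma NF_eq: "NF G S = (\<lambda>j. K j 1) ` {..<n}"
proof (intro equalityI subsetI)
  fix p assume p: "p \<in> NF G S"
  then obtain j where j: "j < n" "\<rho> p \<in> arm_dom True" "p = K j (\<rho> p)"
    using pointE unfolding NF_def by blast
  then have "\<rho> p = 1"
    using not_NF[OF j(1), of "\<rho> p"] p by (fastforce simp: dom_full)
  then show "p \<in> (\<lambda>j. K j 1) ` {..<n}"
    using j by (metis imageI lessThan_iff)
qed (use end_in_NF in auto)

lemma compl_NF: "topspace G - NF G S = (\<Union>j<n. K j ` {0..<1})"
proof (intro equalityI subsetI)
  fix p assume p: "p \<in> topspace G - NF G S"
  then obtain j where j: "j < n" "\<rho> p \<in> arm_dom True" "p = K j (\<rho> p)"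
    using pointE by blast
  moreover from this have "\<rho> p \<noteq> 1"
    using p end_in_NF by (metis DiffD2)
  ultimately have "\<rho> p \<in> {0..<1}"
    by (simp add: dom_full)
  then show "p \<in> (\<Union>j<n. K j ` {0..<1})"
    using j by (metis UN_I imageI lessThan_iff)
next
  fix p assume "p \<in> (\<Union>j<n. K j ` {0..<1})"
  then obtain j r where "j < n" "0 \<le> r" "r < 1" "p = K j r" by auto
  then show "p \<in> topspace G - NF G S"
    using K_in[of j r] not_NF[of j r] by (auto simp: dom_full)
qed

text \<open>Without their ends the arms still meet in the centre, so a single component remains.
  This makes the diagram normal with one vertex.\<close>

lemma nf_components_eq: "nf_components G S = {topspace G - NF G S}"
  unfolding nf_components_def
proof (rule connected_components_of_open_partition)
  have "connectedin G (topspace G - NF G S)"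
    unfolding compl_NF by (rule connectedin_sub_star) (auto simp: dom_full)
  then show "connectedin (subtopology G (topspace G - NF G S)) C" if "C \<in> {topspace G - NF G S}" for C
    using that by (simp add: connectedin_subtopology)
  show "openin (subtopology G (topspace G - NF G S)) C" if "C \<in> {topspace G - NF G S}" for C
    using that openin_subtopology_refl[of G "topspace G - NF G S"] by auto
  show "{} \<notin> {topspace G - NF G S}"
    unfolding compl_NF using n_pos by fastforce
qed auto

end

section \<open>Edges of a diagram with one vertex\<close>

lemma openin_real_interval:
  "openin (top_of_set {0<..<1}) T \<Longrightarrow> open (T :: real set)"
  using openin_open_eq[of "{0<..<1::real}" T] by simp

lemma Inr_in_diagram_edge [simp]: "Inr (s, t) \<in> diagram_edge s' \<longleftrightarrow> s = s' \<and> 0 < t \<and> t < 1"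
  by (force simp: diagram_edge_def)

lemma Inl_notin_diagram_edge [simp]: "Inl w \<notin> diagram_edge s"
  by (auto simp: diagram_edge_def)

lemma near_ends:
  "\<forall>\<^sub>F t in at_right 0. 0 < t \<and> t < (1::real)" "\<forall>\<^sub>F t in at_left 1. 0 < t \<and> t < (1::real)"
proof -
  show "\<forall>\<^sub>F t in at_right 0. 0 < t \<and> t < (1::real)"
    unfolding eventually_at_right[OF zero_less_one] by (rule exI[of _ 1]) auto
  show "\<forall>\<^sub>F t in at_left 1. 0 < t \<and> t < (1::real)"
    unfolding eventually_at_left[OF zero_less_one] by (rule exI[of _ 0]) auto
qed

context
  fixes Y :: "'y target" and G :: "'g topology" and S :: "'g set" and c :: "'g \<Rightarrow> 'y" and v :: "'g set set"
  assumes one_vertex: "diagram_vertices Y G S c = {v}"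
begin

lemma topspace_diagram: "topspace (diagram_space Y G S c) = Inl ` {v} \<union> (\<Union>s\<in>NF G S. diagram_edge s)"
proof -
  have Inr_in: "Inr (s, t) \<in> diagram_points Y G S c \<longleftrightarrow> 0 < t \<and> t < 1" if "s \<in> NF G S" for s t
    using that unfolding diagram_points_def by auto
  have "diagram_open Y G S c (diagram_points Y G S c)"
    unfolding diagram_open_def
  proof (intro conjI ballI allI impI)
    show "diagram_points Y G S c \<subseteq> diagram_points Y G S c" ..
    fix s assume s: "s \<in> NF G S"
    have "{t \<in> {0<..<1}. Inr (s, t) \<in> diagram_points Y G S c} = {0<..<1}"
      unfolding Inr_in[OF s] by auto
    then show "open {t \<in> {0<..<1}. Inr (s, t) \<in> diagram_points Y G S c}"
      by simp
    show "\<forall>\<^sub>F t in at_right 0. Inr (s, t) \<in> diagram_points Y G S c"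
      "\<forall>\<^sub>F t in at_left 1. Inr (s, t) \<in> diagram_points Y G S c"
      unfolding Inr_in[OF s] by (fact near_ends)+
  qed
  then have "topspace (diagram_space Y G S c) = diagram_points Y G S c"
    using openin_subset[of "diagram_space Y G S c" "diagram_points Y G S c"]
      openin_topspace[of "diagram_space Y G S c"]
    unfolding openin_diagram_space by (auto simp: diagram_open_def)
  then show ?thesis
    by (simp add: diagram_points_def one_vertex)
qed

text \<open>In the weak topology continuity is tested on each open edge and by limits at its
  attached ends. Maps out of a closed edge arise below as restrictions of such maps, because a
  closed edge carries the subspace topology.\<close>

lemma continuous_map_diagram:
  assumes "f (Inl v) \<in> topspace X"
    and arc: "\<And>s. s \<in> NF G S \<Longrightarrow> continuous_map (top_of_set {0<..<1}) X (\<lambda>t. f (Inr (s, t)))"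
    and dep: "\<And>s. s \<in> NF G S \<Longrightarrow> departs Y G S c s v \<Longrightarrow> limitin X (\<lambda>t. f (Inr (s, t))) (f (Inl v)) (at_right 0)"
    and ent: "\<And>s. s \<in> NF G S \<Longrightarrow> enters Y G S c s v \<Longrightarrow> limitin X (\<lambda>t. f (Inr (s, t))) (f (Inl v)) (at_left 1)"
  shows "continuous_map (diagram_space Y G S c) X f"
  unfolding continuous_map_def
proof (intro conjI allI impI)
  show "f \<in> topspace (diagram_space Y G S c) \<rightarrow> topspace X"
  proof
    fix x assume "x \<in> topspace (diagram_space Y G S c)"
    then consider "x = Inl v" | s t where "s \<in> NF G S" "0 < t" "t < 1" "x = Inr (s, t)"
      unfolding topspace_diagram diagram_edge_def by auto
    then show "f x \<in> topspace X"
    proof cases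
      case 2
      then show ?thesis
        using continuous_map_funspace[OF arc[OF 2(1)]] by auto
    qed (use assms(1) in simp)
  qed
  fix U assume U: "openin X U"
  let ?W = "{x \<in> topspace (diagram_space Y G S c). f x \<in> U}"
  have Inr_W: "Inr (s, t) \<in> ?W \<longleftrightarrow> 0 < t \<and> t < 1 \<and> f (Inr (s, t)) \<in> U" if "s \<in> NF G S" for s t
    using that unfolding topspace_diagram by auto
  have Inl_W: "Inl w \<in> ?W \<Longrightarrow> w = v \<and> f (Inl v) \<in> U" for w
    unfolding topspace_diagram by auto
  have "diagram_open Y G S c ?W"
    unfolding diagram_open_def
  proof (intro conjI ballI allI impI)
    show "?W \<subseteq> diagram_points Y G S c"
      unfolding topspace_diagram by (auto simp: diagram_points_def one_vertex)
    fix s assume s: "s \<in> NF G S"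
    have "openin (top_of_set {0<..<1}) {t \<in> {0<..<1}. f (Inr (s, t)) \<in> U}"
      using arc[OF s] U unfolding continuous_map_def by simp
    moreover have "{t \<in> {0<..<1}. Inr (s, t) \<in> ?W} = {t \<in> {0<..<1}. f (Inr (s, t)) \<in> U}"
      using Inr_W[OF s] by auto
    ultimately show "open {t \<in> {0<..<1}. Inr (s, t) \<in> ?W}"
      using openin_real_interval by simp
    {
      fix w assume w: "Inl w \<in> ?W \<and> departs Y G S c s w"
      then have "\<forall>\<^sub>F t in at_right 0. f (Inr (s, t)) \<in> U"
        using dep[OF s] Inl_W U unfolding limitin_def by blast
      then show "\<forall>\<^sub>F t in at_right 0. Inr (s, t) \<in> ?W"
        using near_ends(1) by eventually_elim (use Inr_W[OF s] in blast)
    next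
      fix w assume w: "Inl w \<in> ?W \<and> enters Y G S c s w"
      then have "\<forall>\<^sub>F t in at_left 1. f (Inr (s, t)) \<in> U"
        using ent[OF s] Inl_W U unfolding limitin_def by blast
      then show "\<forall>\<^sub>F t in at_left 1. Inr (s, t) \<in> ?W"
        using near_ends(2) by eventually_elim (use Inr_W[OF s] in blast)
    }
  qed
  then show "openin (diagram_space Y G S c) ?W"
    by (simp add: openin_diagram_space)
qed

text \<open>The characteristic map of an edge. An end that is not attached to the vertex is left out
  by the choice of the domain \<open>J\<close> below.\<close>

definition edge_path :: "'g \<Rightarrow> real \<Rightarrow> 'g set set + 'g \<times> real" where
  "edge_path s t = (if 0 < t \<and> t < 1 then Inr (s, t) else Inl v)"

lemma continuous_map_edge_path:
  assumes s: "s \<in> NF G S" and J: "J \<subseteq> {0..1}"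
    and 0: "0 \<in> J \<Longrightarrow> departs Y G S c s v" and 1: "1 \<in> J \<Longrightarrow> enters Y G S c s v"
  shows "continuous_map (top_of_set J) (diagram_space Y G S c) (edge_path s)"
  unfolding continuous_map_def
proof (intro conjI allI impI)
  show "edge_path s \<in> topspace (top_of_set J) \<rightarrow> topspace (diagram_space Y G S c)"
    using s unfolding topspace_diagram edge_path_def by auto
  fix W assume "openin (diagram_space Y G S c) W"
  then have W: "open {t \<in> {0<..<1}. Inr (s, t) \<in> W}"
    "Inl v \<in> W \<Longrightarrow> departs Y G S c s v \<Longrightarrow> \<forall>\<^sub>F t in at_right 0. Inr (s, t) \<in> W"
    "Inl v \<in> W \<Longrightarrow> enters Y G S c s v \<Longrightarrow> \<forall>\<^sub>F t in at_left 1. Inr (s, t) \<in> W"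
    using s by (auto simp: openin_diagram_space diagram_open_def)
  let ?T = "{t \<in> {0<..<1}. Inr (s, t) \<in> W}"
  have "\<exists>B. open B \<and> t \<in> B \<and> B \<inter> J \<subseteq> {t \<in> J. edge_path s t \<in> W}" if t: "t \<in> J" "edge_path s t \<in> W" for t
  proof -
    consider "0 < t" "t < 1" | "t = 0" | "t = 1"
      using t J by fastforce
    then show ?thesis
    proof cases
      case 1
      then show ?thesis
        using W(1) t(2) by (intro exI[of _ ?T]) (auto simp: edge_path_def)
    next
      case 2
      then obtain b where "b > 0" "\<And>t. 0 < t \<Longrightarrow> t < b \<Longrightarrow> Inr (s, t) \<in> W"
        using W(2) 0 t by (auto simp: edge_path_def eventually_at_right[of 0 1])
      then show ?thesis
        using 2 J t by (intro exI[of _ "{- 1<..<min b 1}"]) (auto simp: edge_path_def)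
    next
      case 3
      then obtain b where "b < 1" "\<And>t. b < t \<Longrightarrow> t < 1 \<Longrightarrow> Inr (s, t) \<in> W"
        using W(3) 1 t by (auto simp: edge_path_def eventually_at_left[of 0 1])
      then show ?thesis
        using 3 J t by (intro exI[of _ "{max b 0<..<2}"]) (auto simp: edge_path_def)
    qed
  qed
  note local = this
  show "openin (top_of_set J) {t \<in> topspace (top_of_set J). edge_path s t \<in> W}"
  proof (subst openin_subopen, intro ballI)
    fix t assume t: "t \<in> {t \<in> topspace (top_of_set J). edge_path s t \<in> W}"
    then obtain B where B: "open B" "t \<in> B" "B \<inter> J \<subseteq> {t \<in> J. edge_path s t \<in> W}"
      using local[of t] by auto
    have "openin (top_of_set J) (J \<inter> B)" "t \<in> J \<inter> B"
      using B t by auto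
    then show "\<exists>T. openin (top_of_set J) T \<and> t \<in> T \<and> T \<subseteq> {t \<in> topspace (top_of_set J). edge_path s t \<in> W}"
      using B(3) by (intro exI[of _ "J \<inter> B"]) auto
  qed
qed

text \<open>Every other open edge is an open set disjoint from this one, and a neighbourhood of the
  vertex contains an initial or a final piece of each edge attached to it.\<close>

lemma closure_edge:
  assumes s: "s \<in> NF G S" and de: "departs Y G S c s v \<or> enters Y G S c s v"
  shows "diagram_space Y G S c closure_of diagram_edge s = insert (Inl v) (diagram_edge s)"
proof (intro equalityI subsetI)
  fix x assume x: "x \<in> diagram_space Y G S c closure_of diagram_edge s"
  show "x \<in> insert (Inl v) (diagram_edge s)"
  proof (rule ccontr)
    assume "x \<notin> insert (Inl v) (diagram_edge s)"
    moreover have "x \<in> topspace (diagram_space Y G S c)"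
      using x by (simp add: in_closure_of)
    ultimately obtain s' where s': "s' \<in> NF G S" "x \<in> diagram_edge s'" "s' \<noteq> s"
      unfolding topspace_diagram by auto
    have "diagram_open Y G S c (diagram_edge s')"
      unfolding diagram_open_def
    proof (intro conjI ballI allI impI)
      show "diagram_edge s' \<subseteq> diagram_points Y G S c"
        using s'(1) unfolding diagram_points_def by blast
      have "{t \<in> {0<..<1}. Inr (r, t) \<in> diagram_edge s'} = (if r = s' then {0<..<1} else {})" for r
        by auto
      then show "open {t \<in> {0<..<1}. Inr (r, t) \<in> diagram_edge s'}" for r
        by simp
    qed auto
    then obtain y where "y \<in> diagram_edge s" "y \<in> diagram_edge s'"
      using x s'(2) unfolding in_closure_of openin_diagram_space by blast
    then show False
      using s'(3) by (auto simp: diagram_edge_def)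
  qed
next
  fix x assume x: "x \<in> insert (Inl v) (diagram_edge s)"
  have sub: "diagram_edge s \<subseteq> topspace (diagram_space Y G S c)"
    using s unfolding topspace_diagram by auto
  have "Inl v \<in> diagram_space Y G S c closure_of diagram_edge s"
    unfolding in_closure_of
  proof (intro conjI allI impI)
    show "Inl v \<in> topspace (diagram_space Y G S c)"
      unfolding topspace_diagram by auto
    fix T assume T: "Inl v \<in> T \<and> openin (diagram_space Y G S c) T"
    then have dT: "diagram_open Y G S c T"
      by (simp add: openin_diagram_space)
    have "\<exists>t. 0 < t \<and> t < 1 \<and> Inr (s, t) \<in> T"
      using de
    proof
      assume "departs Y G S c s v"
      then have "\<forall>\<^sub>F t in at_right 0. Inr (s, t) \<in> T"
        using dT T s unfolding diagram_open_def by blast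
      then obtain b where "b > 0" "\<And>t. 0 < t \<Longrightarrow> t < b \<Longrightarrow> Inr (s, t) \<in> T"
        by (auto simp: eventually_at_right[of 0 1])
      then show ?thesis
        by (intro exI[of _ "min b 1 / 2"]) auto
    next
      assume "enters Y G S c s v"
      then have "\<forall>\<^sub>F t in at_left 1. Inr (s, t) \<in> T"
        using dT T s unfolding diagram_open_def by blast
      then obtain b where "b < 1" "\<And>t. b < t \<Longrightarrow> t < 1 \<Longrightarrow> Inr (s, t) \<in> T"
        by (auto simp: eventually_at_left[of 0 1])
      then show ?thesis
        by (intro exI[of _ "(max b 0 + 1) / 2"]) auto
    qed
    then show "\<exists>y. y \<in> diagram_edge s \<and> y \<in> T"
      unfolding diagram_edge_def by force
  qed
  then show "x \<in> diagram_space Y G S c closure_of diagram_edge s"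
    using x closure_of_subset[OF sub] by blast
qed

lemma edge_path_image:
  assumes "{0<..<1} \<subseteq> J" "J \<subseteq> {0..1}" "0 \<in> J \<or> 1 \<in> J"
  shows "edge_path s ` J = insert (Inl v) (diagram_edge s)"
proof -
  have "edge_path s ` {0<..<1} = diagram_edge s"
    by (auto simp: edge_path_def diagram_edge_def image_iff)
  moreover have "{0..1::real} = {0<..<1} \<union> {0, 1}"
    by auto
  then have "J = {0<..<1} \<union> (J \<inter> {0, 1})"
    using assms(1,2) by blast
  moreover have "edge_path s ` (J \<inter> {0, 1}) = {Inl v}"
    using assms(3) by (auto simp: edge_path_def image_iff)
  ultimately show ?thesis
    using image_Un[of "edge_path s" "{0<..<1}" "J \<inter> {0, 1}"] by simp
qed

lemma continuous_map_closed_edge_path: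
  assumes s: "s \<in> NF G S" and J: "{0<..<1} \<subseteq> J" "J \<subseteq> {0..1}" "0 \<in> J \<or> 1 \<in> J"
    and "0 \<in> J \<Longrightarrow> departs Y G S c s v" "1 \<in> J \<Longrightarrow> enters Y G S c s v"
  shows "continuous_map (top_of_set J) (closed_edge Y G S c s) (edge_path s)"
    and "topspace (closed_edge Y G S c s) = edge_path s ` J"
proof -
  have cl: "diagram_space Y G S c closure_of diagram_edge s = edge_path s ` J"
    using closure_edge[OF s] edge_path_image[OF J] assms by auto
  then show "continuous_map (top_of_set J) (closed_edge Y G S c s) (edge_path s)"
    unfolding closed_edge_def using continuous_map_edge_path[OF s J(2)] assms
    by (auto simp: continuous_map_in_subtopology)
  show "topspace (closed_edge Y G S c s) = edge_path s ` J"
    unfolding closed_edge_def using cl closure_of_subset_topspace[of "diagram_space Y G S c" "diagram_edge s"] by auto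
qed

lemma half_open_intervals:
  "top_of_set {0..<1::real} homeomorphic_space top_of_set {0::real..}"
  "top_of_set {0<..1::real} homeomorphic_space top_of_set {0::real..}"
proof -
  have "homeomorphic_maps (top_of_set {0..<1::real}) (top_of_set {0::real..}) (\<lambda>t. t / (1 - t)) (\<lambda>u. u / (1 + u))"
    by (auto simp: homeomorphic_maps_def continuous_map_in_subtopology divide_simps intro!: continuous_intros)
  then show "top_of_set {0..<1::real} homeomorphic_space top_of_set {0::real..}"
    unfolding homeomorphic_space_def by blast
  have "homeomorphic_maps (top_of_set {0<..1::real}) (top_of_set {0::real..}) (\<lambda>t. (1 - t) / t) (\<lambda>u. 1 / (1 + u))"
    by (auto simp: homeomorphic_maps_def continuous_map_in_subtopology divide_simps intro!: continuous_intros)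
  then show "top_of_set {0<..1::real} homeomorphic_space top_of_set {0::real..}"
    unfolding homeomorphic_space_def by blast
qed

lemma closed_edge_half:
  assumes s: "s \<in> NF G S" and de: "departs Y G S c s v \<noteq> enters Y G S c s v"
  shows "closed_edge Y G S c s homeomorphic_space top_of_set {0::real..}"
proof -
  define J where "J = (if departs Y G S c s v then {0..<1} else {0<..1::real})"
  define e where "e = (if departs Y G S c s v then 0 else 1::real)"
  \<comment> \<open>The inverse of \<open>edge_path s\<close>, extended to the whole diagram by
    sending the vertex and all other edges to the attached endpoint \<open>e\<close>.\<close>
  define g where "g x = (case x of Inl _ \<Rightarrow> e | Inr (s', t) \<Rightarrow> if s' = s then t else e)" for x :: "'g set set + 'g \<times> real"
  have J: "{0<..<1} \<subseteq> J" "J \<subseteq> {0..1}" "0 \<in> J \<or> 1 \<in> J"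
    "0 \<in> J \<Longrightarrow> departs Y G S c s v" "1 \<in> J \<Longrightarrow> enters Y G S c s v"
    using de by (auto simp: J_def split: if_splits)
  note path = continuous_map_closed_edge_path[OF s J]
  have "continuous_map (diagram_space Y G S c) euclideanreal g"
  proof (rule continuous_map_diagram)
    fix s'
    show "continuous_map (top_of_set {0<..<1}) euclideanreal (\<lambda>t. g (Inr (s', t)))"
      by (cases "s' = s") (simp_all add: g_def)
    show "limitin euclideanreal (\<lambda>t. g (Inr (s', t))) (g (Inl v)) (at_right 0)" if "departs Y G S c s' v"
      using that by (cases "s' = s") (auto simp: g_def e_def intro!: tendsto_eq_intros)
    show "limitin euclideanreal (\<lambda>t. g (Inr (s', t))) (g (Inl v)) (at_left 1)" if "enters Y G S c s' v"
      using that de by (cases "s' = s") (auto simp: g_def e_def intro!: tendsto_eq_intros)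
  qed simp
  then have "continuous_map (closed_edge Y G S c s) euclideanreal g"
    unfolding closed_edge_def by (rule continuous_map_from_subtopology)
  moreover have gp: "g (edge_path s t) = t" if "t \<in> J" for t
  proof -
    have "(t = e \<and> \<not> (0 < t \<and> t < 1)) \<or> 0 < t \<and> t < 1"
      using that unfolding J_def e_def by (cases "departs Y G S c s v") auto
    then show ?thesis
      by (elim disjE) (simp_all add: g_def edge_path_def)
  qed
  ultimately have "homeomorphic_maps (top_of_set J) (closed_edge Y G S c s) (edge_path s) g"
    unfolding homeomorphic_maps_def path(2) continuous_map_in_subtopology
    using path by (simp add: image_subset_iff Pi_iff)
  then have "top_of_set J homeomorphic_space closed_edge Y G S c s"
    unfolding homeomorphic_space_def by blast
  moreover have "top_of_set J homeomorphic_space top_of_set {0::real..}"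
    using half_open_intervals by (simp add: J_def)
  ultimately show ?thesis
    by (metis homeomorphic_space_sym homeomorphic_space_trans)
qed

text \<open>The closed edge is compact as an image of \<open>{0..1}\<close>, and a continuous
  bijection from it onto the circle, a Hausdorff space, is a homeomorphism.\<close>

lemma closed_edge_loop:
  assumes s: "s \<in> NF G S" and de: "departs Y G S c s v" "enters Y G S c s v"
  shows "closed_edge Y G S c s homeomorphic_space top_of_set (sphere (0::complex) 1)"
proof -
  define g where "g x = (case x of Inl _ \<Rightarrow> 1 | Inr (s', t) \<Rightarrow> if s' = s then cis (2 * pi * t) else 1)"
    for x :: "'g set set + 'g \<times> real"
  have J: "{0<..<1} \<subseteq> {0..1::real}" "{0..1} \<subseteq> {0..1::real}" "0 \<in> {0..1::real} \<or> 1 \<in> {0..1::real}" by auto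
  note path = continuous_map_closed_edge_path[OF s J de]
  have "continuous_map (diagram_space Y G S c) (top_of_set (sphere 0 1)) g"
  proof (rule continuous_map_diagram)
    fix s'
    show "continuous_map (top_of_set {0<..<1}) (top_of_set (sphere 0 1)) (\<lambda>t. g (Inr (s', t)))"
      by (cases "s' = s") (auto simp: g_def continuous_map_in_subtopology intro!: continuous_intros)
    have "((\<lambda>t. cis (2 * pi * t)) \<longlongrightarrow> cis (2 * pi * a)) (at a within A)" for a A
      by (intro tendsto_intros)
    from this[of 0] this[of 1] show "limitin (top_of_set (sphere 0 1)) (\<lambda>t. g (Inr (s', t))) (g (Inl v)) (at_right 0)"
      "limitin (top_of_set (sphere 0 1)) (\<lambda>t. g (Inr (s', t))) (g (Inl v)) (at_left 1)"
      by (cases "s' = s"; auto simp: g_def limitin_subtopology)+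
  qed (simp add: g_def)
  then have g: "continuous_map (closed_edge Y G S c s) (top_of_set (sphere 0 1)) g"
    unfolding closed_edge_def by (rule continuous_map_from_subtopology)
  have gp: "g (edge_path s t) = cis (2 * pi * t)" if "t \<in> {0..1}" for t
    using that by (cases "t = 0"; cases "t = 1") (auto simp: g_def edge_path_def)
  have "compact_space (closed_edge Y G S c s)"
    using image_compactin[OF _ path(1), of "{0..1}"] path(2) compact_Icc[of 0 "1::real"]
    by (simp add: compact_space_def compactin_subtopology)
  moreover have "inj_on g (topspace (closed_edge Y G S c s))"
  proof -
    have "edge_path s t = edge_path s u" if tu: "t \<in> {0..1}" "u \<in> {0..1}" "cis (2 * pi * t) = cis (2 * pi * u)" for t u
    proof -
      obtain k :: int where "2 * pi * t = 2 * pi * u + 2 * pi * k"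
        using tu(3) sin_cos_eq_iff[of "2 * pi * t" "2 * pi * u"] by (auto simp: complex_eq_iff)
      then have "2 * pi * t = 2 * pi * (u + k)"
        by (simp add: algebra_simps)
      then have k: "t = u + k"
        by simp
      then have "-1 \<le> k" "k \<le> 1"
        using tu(1,2) by auto
      \<comment> \<open>A full turn, \<open>k = 1\<close> or \<open>k = -1\<close>, relates only the
        parameters 0 and 1, and both are sent to the vertex.\<close>
      then have "k = -1 \<or> k = 0 \<or> k = 1"
        by auto
      then show ?thesis
        using k tu by (auto simp: edge_path_def)
    qed
    then show ?thesis
      unfolding path(2) by (intro inj_onI) (metis gp imageE)
  qed
  moreover have "g ` topspace (closed_edge Y G S c s) = topspace (top_of_set (sphere 0 1))"
  proof -
    have "\<exists>t\<in>{0..1}. z = cis (2 * pi * t)" if z: "cmod z = 1" for z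
    proof -
      obtain a where "0 \<le> a" "a < 2 * pi" "z = cis a"
        using complex_unimodular_polar[OF z] by (metis cis.code)
      then show ?thesis
        by (intro bexI[of _ "a / (2 * pi)"]) (auto simp: field_simps)
    qed
    then have "(\<lambda>t. cis (2 * pi * t)) ` {0..1} = sphere 0 1"
      by (auto simp: image_iff)
    moreover have "g ` edge_path s ` {0..1} = (\<lambda>t. cis (2 * pi * t)) ` {0..1}"
      unfolding image_image using gp by (intro image_cong) auto
    ultimately show ?thesis
      unfolding path(2) by simp
  qed
  ultimately have "homeomorphic_map (closed_edge Y G S c s) (top_of_set (sphere 0 1)) g"
    using g Hausdorff_space_subtopology[OF Hausdorff_space_euclidean, of "sphere (0::complex) 1"]
    by (intro continuous_imp_homeomorphic_map) auto
  then show ?thesis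
    by (rule homeomorphic_map_imp_homeomorphic_space)
qed

end

text \<open>Compactness tells the two apart. This keeps half-open edges and loops separate in the
  counts of \<open>one_vertex_diagram\<close>.\<close>

lemma half_line_not_circle: "\<not> top_of_set {0::real..} homeomorphic_space top_of_set (sphere (0::complex) 1)"
proof
  assume "top_of_set {0::real..} homeomorphic_space top_of_set (sphere (0::complex) 1)"
  then have "compact_space (top_of_set {0::real..}) \<longleftrightarrow> compact_space (top_of_set (sphere (0::complex) 1))"
    by (rule homeomorphic_compact_space)
  then have "compact {0::real..}"
    by (simp add: compact_space_def compactin_subtopology)
  then have "bounded {0::real..}"
    by (rule compact_imp_bounded)
  then obtain b where "\<And>x. x \<ge> 0 \<Longrightarrow> \<bar>x\<bar> \<le> (b::real)"
    unfolding bounded_real by auto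
  from this[of "\<bar>b\<bar> + 1"] show False by auto
qed

text \<open>Replaces homeomorphism types by incidence: a half-open edge either departs from the
  vertex or enters it, a loop does both.\<close>

lemma one_vertex_diagramI:
  assumes v: "diagram_vertices Y G S c = {v}" and fin: "finite (NF G S)"
    and cover: "\<And>s. s \<in> NF G S \<Longrightarrow> departs Y G S c s v \<or> enters Y G S c s v"
    and d: "card {s \<in> NF G S. departs Y G S c s v \<and> \<not> enters Y G S c s v} = nd"
    and e: "card {s \<in> NF G S. \<not> departs Y G S c s v \<and> enters Y G S c s v} = ne"
    and l: "card {s \<in> NF G S. departs Y G S c s v \<and> enters Y G S c s v} = nc"
  shows "one_vertex_diagram nd ne nc Y G S c"
proof -
  let ?h = "\<lambda>s. closed_edge Y G S c s homeomorphic_space top_of_set {0::real..}"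
  let ?o = "\<lambda>s. closed_edge Y G S c s homeomorphic_space top_of_set (sphere (0::complex) 1)"
  have excl: "\<not> (?h s \<and> ?o s)" for s
    using half_line_not_circle homeomorphic_space_sym homeomorphic_space_trans by blast
  have half: "?h s \<longleftrightarrow> departs Y G S c s v \<noteq> enters Y G S c s v"
    and loop: "?o s \<longleftrightarrow> departs Y G S c s v \<and> enters Y G S c s v" if "s \<in> NF G S" for s
    using closed_edge_half[OF v that] closed_edge_loop[OF v that] cover[OF that] excl[of s] by argo+
  have D: "{s \<in> NF G S. departs Y G S c s v \<and> closed_edge Y G S c s homeomorphic_space top_of_set {0::real..}} =
      {s \<in> NF G S. departs Y G S c s v \<and> \<not> enters Y G S c s v}"
    using half by (intro Collect_cong) blast
  have E: "{s \<in> NF G S. enters Y G S c s v \<and> closed_edge Y G S c s homeomorphic_space top_of_set {0::real..}} =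
      {s \<in> NF G S. \<not> departs Y G S c s v \<and> enters Y G S c s v}"
    using half by (intro Collect_cong) blast
  have L: "{s \<in> NF G S. (departs Y G S c s v \<or> enters Y G S c s v) \<and>
      closed_edge Y G S c s homeomorphic_space top_of_set (sphere (0::complex) 1)} =
      {s \<in> NF G S. departs Y G S c s v \<and> enters Y G S c s v}"
    using loop by (intro Collect_cong) blast
  show ?thesis
    unfolding one_vertex_diagram_def Let_def
  proof (rule exI[of _ v], unfold D E L, intro conjI)
    show "NF G S = {s \<in> NF G S. departs Y G S c s v \<and> \<not> enters Y G S c s v} \<union>
        {s \<in> NF G S. \<not> departs Y G S c s v \<and> enters Y G S c s v} \<union>
        {s \<in> NF G S. departs Y G S c s v \<and> enters Y G S c s v}"
      using cover by blast
  qed (fact v fin d e l)+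
qed

lemma diagram_vertices_single:
  assumes "nf_components G S = {C}"
  shows "diagram_vertices Y G S c = {{C}}"
proof -
  have "Restr ((nf_related Y G S c)\<^sup>*) {C} = {(C, C)}"
    by auto
  then show ?thesis
    unfolding diagram_vertices_def assms by (auto simp: quotient_def)
qed

section \<open>Star-shaped graphs over the circle\<close>

lemma cis_eq_near:
  assumes "cis s = cis t" "\<bar>s - t\<bar> < 2 * pi"
  shows "s = t"
proof -
  obtain k :: int where k: "s = t + 2 * pi * k"
    using assms(1) sin_cos_eq_iff[of s t] by (auto simp: complex_eq_iff)
  then have "2 * pi * \<bar>real_of_int k\<bar> < 2 * pi * 1"
    using assms(2) by (simp add: abs_mult)
  then have "\<bar>real_of_int k\<bar> < 1"
    by (subst (asm) mult_less_cancel_left_pos) auto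
  then have "k = 0"
    by linarith
  then show ?thesis
    using k by simp
qed

lemma cis_minus_pi [simp]: "cis (- pi) = -1"
  by (simp add: complex_eq_iff)

lemma oriented_arcs_circle: "({a<..<a + 2 * pi}, cis) \<in> oriented_arcs circle"
  by (auto simp: circle_def)

lemma maximum_of_circle:
  assumes V: "V \<subseteq> cis ` {0..pi}" and "-1 \<in> V"
  shows "maximum_of circle V (-1)"
  unfolding maximum_of_def
proof (intro conjI bexI)
  \<comment> \<open>The cut point of this arc is \<open>cis (- pi / 2)\<close>, which lies off the
    upper half circle, so that \<open>pi\<close> is an inner parameter.\<close>
  let ?I = "{- pi / 2<..<- pi / 2 + 2 * pi}"
  show "(?I, cis) \<in> oriented_arcs circle"
    by (rule oriented_arcs_circle)
  have sub: "{0..pi} \<subseteq> ?I"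
    unfolding subset_iff greaterThanLessThan_iff atLeastAtMost_iff using pi_gt_zero by (intro allI impI conjI; linarith)
  have "t \<le> pi" if t: "t \<in> ?I" "cis t \<in> V" for t
  proof -
    obtain u where u: "u \<in> {0..pi}" "cis t = cis u"
      using t(2) V by blast
    then have "\<bar>t - u\<bar> < 2 * pi"
      using t(1) sub by (auto simp: abs_if)
    then show ?thesis
      using cis_eq_near[OF u(2)] u(1) by simp
  qed
  moreover have "pi \<in> ?I" "V \<subseteq> cis ` ?I"
    by (rule subsetD[OF sub], simp) (rule order_trans[OF V image_mono[OF sub]])
  ultimately show "case (?I, cis) of (I, p) \<Rightarrow> V \<subseteq> p ` I \<and> (\<exists>u\<in>I. p u = - 1 \<and> (\<forall>t\<in>I. p t \<in> V \<longrightarrow> t \<le> u))"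
    by (auto intro!: bexI[of _ pi])
qed fact

lemma minimum_of_circle:
  assumes V: "V \<subseteq> cis ` {- pi..0}" and "-1 \<in> V"
  shows "minimum_of circle V (-1)"
  unfolding minimum_of_def
proof (intro conjI bexI)
  \<comment> \<open>Here the cut point is \<open>\<i>\<close>, off the lower half circle, and -1 has
    the parameter \<open>- pi\<close>.\<close>
  let ?I = "{- (3 * pi / 2)<..<- (3 * pi / 2) + 2 * pi}"
  show "(?I, cis) \<in> oriented_arcs circle"
    by (rule oriented_arcs_circle)
  have sub: "{- pi..0} \<subseteq> ?I"
    unfolding subset_iff greaterThanLessThan_iff atLeastAtMost_iff using pi_gt_zero by (intro allI impI conjI; linarith)
  have "- pi \<le> t" if t: "t \<in> ?I" "cis t \<in> V" for t
  proof -
    obtain u where u: "u \<in> {- pi..0}" "cis t = cis u"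
      using t(2) V by blast
    then have "\<bar>t - u\<bar> < 2 * pi"
      using t(1) sub by (auto simp: abs_if)
    then show ?thesis
      using cis_eq_near[OF u(2)] u(1) by simp
  qed
  moreover have "- pi \<in> ?I" "V \<subseteq> cis ` ?I"
    by (rule subsetD[OF sub], simp) (rule order_trans[OF V image_mono[OF sub]])
  ultimately show "case (?I, cis) of (I, p) \<Rightarrow> V \<subseteq> p ` I \<and> (\<exists>u\<in>I. p u = - 1 \<and> (\<forall>t\<in>I. p t \<in> V \<longrightarrow> u \<le> t))"
    by (auto intro!: bexI[of _ "- pi"])
qed fact

text \<open>The outer ends of all arms lie over \<open>-1\<close>; the sign \<open>\<epsilon> j\<close> tells from which side the \<open>j\<close>-th arm
  approaches it.\<close>

locale circle_star = full_star G n K \<rho> en z S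
  for G :: "'g topology" and n K \<rho> en z S +
  fixes c :: "'g \<Rightarrow> complex" and \<epsilon> :: "nat \<Rightarrow> real" and \<theta> :: "real \<Rightarrow> real"
  assumes cont_c: "continuous_map G (top_of_set (sphere 0 1)) c"
    and c_K: "j < n \<Longrightarrow> 0 \<le> r \<Longrightarrow> r \<le> 1 \<Longrightarrow> c (K j r) = cis (\<epsilon> j * \<theta> r)"
    and \<epsilon>: "j < n \<Longrightarrow> \<epsilon> j = 1 \<or> \<epsilon> j = -1"
    and \<theta>_0: "\<theta> 0 = 0" and \<theta>_1: "\<theta> 1 = pi"
    and \<theta>_mono: "strict_mono_on {0..1} \<theta>"
    and \<theta>_lim: "0 < d \<Longrightarrow> \<exists>a. 0 \<le> a \<and> a < 1 \<and> pi - \<theta> a < d"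
begin

lemma \<theta>_bounds: "0 \<le> r \<Longrightarrow> r \<le> 1 \<Longrightarrow> 0 \<le> \<theta> r \<and> \<theta> r \<le> pi"
  using strict_mono_onD[OF \<theta>_mono, of 0 r] strict_mono_onD[OF \<theta>_mono, of r 1] \<theta>_0 \<theta>_1
  by (cases "r = 0"; cases "r = 1") auto

lemma inj_c_K: "j < n \<Longrightarrow> inj_on (\<lambda>r. c (K j r)) {0<..<1}"
proof (rule inj_onI)
  fix r s :: real assume j: "j < n" and rs: "r \<in> {0<..<1}" "s \<in> {0<..<1}" "c (K j r) = c (K j s)"
  then have "cis (\<epsilon> j * \<theta> r) = cis (\<epsilon> j * \<theta> s)"
    using c_K[OF j] by auto
  moreover have "\<bar>\<epsilon> j * \<theta> r - \<epsilon> j * \<theta> s\<bar> < 2 * pi"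
  proof -
    have "\<bar>\<theta> r - \<theta> s\<bar> \<le> pi"
      using \<theta>_bounds[of r] \<theta>_bounds[of s] rs by auto
    then have "\<bar>\<theta> r - \<theta> s\<bar> < 2 * pi"
      using pi_gt_zero by linarith
    then show ?thesis
      using \<epsilon>[OF j] by auto
  qed
  ultimately have "\<theta> r = \<theta> s"
    using cis_eq_near \<epsilon>[OF j] by fastforce
  then show "r = s"
    using strict_mono_on_imp_inj_on[OF \<theta>_mono] rs by (auto simp: inj_on_def)
qed

lemma pre_digraph_circle: "pre_digraph circle G S c"
  using cont_c inj_c_K by (intro pre_digraph_star) (simp_all add: circle_def)

lemma c_end: "j < n \<Longrightarrow> c (K j 1) = -1"
  using c_K[of j 1] \<epsilon>[of j] \<theta>_1 by auto

text \<open>The cells of a whole arm form a family witnessing that its end is ascending or descending.\<close>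

lemma arm_family:
  assumes i: "i < n"
  shows "range (cell i) \<subseteq> one_cells G S" "\<Union>(range (cell i)) \<subseteq> topspace G - NF G S"
    and "K i 1 \<in> G closure_of \<Union>(range (cell i))"
    and "G closure_of \<Union>(range (cell i)) \<subseteq> K i ` {0..1}"
proof -
  show "range (cell i) \<subseteq> one_cells G S"
    unfolding one_cells_eq using i by auto
  have arm: "\<Union>(range (cell i)) \<subseteq> K i ` {0<..<1}"
    unfolding cell_def using cell_dom(2) by blast
  then show "\<Union>(range (cell i)) \<subseteq> topspace G - NF G S"
    unfolding compl_NF using i by fastforce
  show "K i 1 \<in> G closure_of \<Union>(range (cell i))"
    unfolding in_closure_of
  proof (intro conjI allI impI)
    show "K i 1 \<in> topspace G"
      using K_in[OF i] by (simp add: dom_full)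
    fix T assume T: "K i 1 \<in> T \<and> openin G T"
    then obtain a where a: "a < 1" "\<And>r. a < r \<Longrightarrow> r \<le> 1 \<Longrightarrow> K i r \<in> T"
      using K_near_end[OF i] by metis
    obtain k where k: "a < z k"
      using order_tendstoD(1)[OF z_lim a(1)] by (auto simp: eventually_sequentially)
    define r where "r = (z k + z (Suc k)) / 2"
    have r: "z k < r" "r < z (Suc k)"
      using cell_bounds(2)[of k] by (auto simp: r_def)
    then have "K i r \<in> T"
      using a(2)[of r] k z_less[of "Suc k"] by simp
    moreover have "K i r \<in> cell i k"
      using r unfolding cell_def by auto
    ultimately show "\<exists>y. y \<in> \<Union>(range (cell i)) \<and> y \<in> T"
      by blast
  qed
  have "compactin G (K i ` {0..1})"
    using image_compactin[OF _ cont_K[OF i], of "{0..1}"]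
    by (simp add: arm_dom_def compactin_subtopology)
  then have "closedin G (K i ` {0..1})"
    using Hausdorff_G compactin_imp_closedin by blast
  then show "G closure_of \<Union>(range (cell i)) \<subseteq> K i ` {0..1}"
    using arm by (intro closure_of_minimal) force+
qed

lemma ascending_end:
  assumes "i < n" "\<epsilon> i = 1"
  shows "ascending_point circle G S c (K i 1) (topspace G - NF G S)"
  unfolding ascending_point_def
proof (intro exI[of _ "range (cell i)"] conjI)
  have "c ` (G closure_of \<Union>(range (cell i))) \<subseteq> c ` K i ` {0..1}"
    using arm_family(4)[OF assms(1)] by blast
  also have "\<dots> \<subseteq> cis ` {0..pi}"
    using c_K[OF assms(1)] assms(2) \<theta>_bounds by auto
  finally show "maximum_of circle (c ` (G closure_of \<Union>(range (cell i)))) (c (K i 1))"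
    using arm_family(3)[OF assms(1)] c_end[OF assms(1)] maximum_of_circle by (metis imageI)
qed (use arm_family[OF assms(1)] in auto)

lemma descending_end:
  assumes "i < n" "\<epsilon> i = -1"
  shows "descending_point circle G S c (K i 1) (topspace G - NF G S)"
  unfolding descending_point_def
proof (intro exI[of _ "range (cell i)"] conjI)
  have "c ` (G closure_of \<Union>(range (cell i))) \<subseteq> c ` K i ` {0..1}"
    using arm_family(4)[OF assms(1)] by blast
  also have "\<dots> \<subseteq> cis ` {- pi..0}"
  proof
    fix y assume "y \<in> c ` K i ` {0..1}"
    then obtain r where r: "0 \<le> r" "r \<le> 1" "y = cis (- \<theta> r)"
      using c_K[OF assms(1)] assms(2) by auto
    then show "y \<in> cis ` {- pi..0}"
      using \<theta>_bounds[of r] by (intro image_eqI[of _ _ "- \<theta> r"]) auto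
  qed
  finally show "minimum_of circle (c ` (G closure_of \<Union>(range (cell i)))) (c (K i 1))"
    using arm_family(3)[OF assms(1)] c_end[OF assms(1)] minimum_of_circle by (metis imageI)
qed (use arm_family[OF assms(1)] in auto)

text \<open>The family \<open>F\<close> is arbitrary, but if the end is in its closure, it has
  points on the tips of the arms leading to that end. These arms all have the sign \<open>e\<close>,
  so values arbitrarily close to -1 on one fixed side occur. This excludes the opposite kind of
  extremum.\<close>

lemma values_near_end:
  assumes j: "j < n" and sgn: "\<And>i. i < n \<Longrightarrow> en i = en j \<Longrightarrow> \<epsilon> i = e"
    and F: "F \<subseteq> one_cells G S" "K j 1 \<in> G closure_of \<Union>F" and "0 < d"
  obtains t where "0 < t" "t < d" "cis (e * (pi - t)) \<in> c ` (G closure_of \<Union>F)"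
proof -
  obtain a where a: "0 \<le> a" "a < 1" "pi - \<theta> a < d"
    using \<theta>_lim[OF \<open>0 < d\<close>] by blast
  \<comment> \<open>Points on the arms with this end whose radius exceeds \<open>a\<close>, hence
    whose angle is within \<open>d\<close> of \<open>pi\<close>.\<close>
  define U where "U = {K i r | i r. i < n \<and> en i = en j \<and> 1/2 < r \<and> r \<le> 1} \<inter> {p \<in> topspace G. \<rho> p \<in> {a<..}}"
  have "openin G U"
    unfolding U_def by (intro openin_Int end_open open_less j) auto
  moreover have "K j 1 \<in> {K i r | i r. i < n \<and> en i = en j \<and> 1/2 < r \<and> r \<le> 1}"
    using j by (intro CollectI exI[of _ j] exI[of _ 1]) simp
  then have "K j 1 \<in> U"
    unfolding U_def using K_in[OF j, of 1] \<rho>_K[OF j, of 1] a by (simp add: dom_full)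
  ultimately obtain p where p: "p \<in> \<Union>F" "p \<in> U"
    using F(2) unfolding in_closure_of by blast
  obtain i r where i: "i < n" "en i = en j" "1/2 < r" "r \<le> 1" "p = K i r"
    using p(2) unfolding U_def by blast
  have \<rho>: "\<rho> p = r"
    using \<rho>_K[OF i(1), of r] i by (simp add: dom_full)
  obtain k l where kl: "k < n" "p \<in> cell k l"
    using p(1) F(1) unfolding one_cells_eq by blast
  then obtain s where s: "p = K k s" "z l < s" "s < z (Suc l)"
    unfolding cell_def by auto
  then have "\<rho> p = s"
    using \<rho>_K[OF kl(1), of s] cell_dom(1)[of l] by auto
  then have "r < 1"
    using \<rho> s z_less[of "Suc l"] by simp
  have "\<theta> r < pi"
    using strict_mono_onD[OF \<theta>_mono, of r 1] \<open>r < 1\<close> i(3) \<theta>_1 by simp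
  moreover have "pi - \<theta> r < d"
    using strict_mono_onD[OF \<theta>_mono, of a r] p(2) \<rho> \<open>r < 1\<close> a unfolding U_def by auto
  moreover have "cis (e * (pi - (pi - \<theta> r))) = c p"
    using c_K[OF i(1), of r] sgn[OF i(1,2)] i by simp
  moreover have "p \<in> G closure_of \<Union>F"
    using p(1) closure_of_subset[of "\<Union>F" G] F(1) cell_open
    unfolding one_cells_eq by (meson UnionI closure_of_subset_Int in_closure_of in_mono openin_subset p(2) U_def \<open>openin G U\<close>)
  ultimately show thesis
    using that[of "pi - \<theta> r"] by (metis diff_gt_0_iff_gt imageI)
qed

text \<open>Descending arms leave -1 in the positive direction: if the maximum had the parameter
  \<open>u\<close>, values \<open>cis (u + t)\<close> with arbitrarily small positive
  \<open>t\<close> would occur as well, and for small \<open>t\<close> the parameter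
  \<open>u + t\<close> is still in the oriented arc.\<close>

lemma not_ascending_end:
  assumes j: "j < n" and sgn: "\<And>i. i < n \<Longrightarrow> en i = en j \<Longrightarrow> \<epsilon> i = -1"
  shows "\<not> ascending_point circle G S c (K j 1) C"
proof
  assume "ascending_point circle G S c (K j 1) C"
  then obtain F where F: "F \<subseteq> one_cells G S" "K j 1 \<in> G closure_of \<Union>F"
    and mx: "maximum_of circle (c ` (G closure_of \<Union>F)) (-1)"
    using c_end[OF j] unfolding ascending_point_def by auto
  then obtain a u where u: "a < u" "u < a + 2 * pi" "cis u = -1"
    and max: "\<And>t. t \<in> {a<..<a + 2 * pi} \<Longrightarrow> cis t \<in> c ` (G closure_of \<Union>F) \<Longrightarrow> t \<le> u"
    unfolding maximum_of_def circle_def by auto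
  obtain t where t: "0 < t" "t < a + 2 * pi - u" "cis (- 1 * (pi - t)) \<in> c ` (G closure_of \<Union>F)"
    using values_near_end[OF j sgn F] u(2) by (metis diff_gt_0_iff_gt)
  have "cis (- 1 * (pi - t)) = cis (- pi) * cis t"
    by (simp only: cis_mult) simp
  also have "\<dots> = cis (u + t)"
    using u(3) by (simp flip: cis_mult)
  finally show False
    using max[of "u + t"] t u by simp
qed

lemma not_descending_end:
  assumes j: "j < n" and sgn: "\<And>i. i < n \<Longrightarrow> en i = en j \<Longrightarrow> \<epsilon> i = 1"
  shows "\<not> descending_point circle G S c (K j 1) C"
proof
  assume "descending_point circle G S c (K j 1) C"
  then obtain F where F: "F \<subseteq> one_cells G S" "K j 1 \<in> G closure_of \<Union>F"
    and mx: "minimum_of circle (c ` (G closure_of \<Union>F)) (-1)"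
    using c_end[OF j] unfolding descending_point_def by auto
  then obtain a u where u: "a < u" "u < a + 2 * pi" "cis u = -1"
    and min: "\<And>t. t \<in> {a<..<a + 2 * pi} \<Longrightarrow> cis t \<in> c ` (G closure_of \<Union>F) \<Longrightarrow> u \<le> t"
    unfolding minimum_of_def circle_def by auto
  obtain t where t: "0 < t" "t < u - a" "cis (1 * (pi - t)) \<in> c ` (G closure_of \<Union>F)"
    using values_near_end[OF j sgn F] u(1) by (metis diff_gt_0_iff_gt)
  have "cis (1 * (pi - t)) = cis pi * cis (- t)"
    by (simp only: cis_mult) simp
  also have "\<dots> = cis u * cis (- t)"
    using u(3) by simp
  also have "\<dots> = cis (u + - t)"
    by (rule cis_mult)
  finally show False
    using min[of "u - t"] t u by simp
qed

definition has_sign :: "nat \<Rightarrow> real \<Rightarrow> bool" where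
  "has_sign s e \<longleftrightarrow> (\<exists>i<n. en i = s \<and> \<epsilon> i = e)"

lemma departs_iff:
  assumes j: "j < n"
  shows "departs circle G S c (K j 1) {topspace G - NF G S} \<longleftrightarrow> has_sign (en j) 1"
proof
  assume "has_sign (en j) 1"
  then obtain i where i: "i < n" "en i = en j" "\<epsilon> i = 1"
    unfolding has_sign_def by blast
  then show "departs circle G S c (K j 1) {topspace G - NF G S}"
    unfolding departs_def using ascending_end[OF i(1,3)] K_1[OF TrueI i(1) j i(2)] by auto
next
  assume dep: "departs circle G S c (K j 1) {topspace G - NF G S}"
  show "has_sign (en j) 1"
  proof (rule ccontr)
    assume "\<not> has_sign (en j) 1"
    then have "\<epsilon> i = -1" if "i < n" "en i = en j" for i
      using that \<epsilon> unfolding has_sign_def by blast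
    then show False
      using not_ascending_end[OF j] dep unfolding departs_def by blast
  qed
qed

lemma enters_iff:
  assumes j: "j < n"
  shows "enters circle G S c (K j 1) {topspace G - NF G S} \<longleftrightarrow> has_sign (en j) (-1)"
proof
  assume "has_sign (en j) (-1)"
  then obtain i where i: "i < n" "en i = en j" "\<epsilon> i = -1"
    unfolding has_sign_def by blast
  then show "enters circle G S c (K j 1) {topspace G - NF G S}"
    unfolding enters_def using descending_end[OF i(1,3)] K_1[OF TrueI i(1) j i(2)] by auto
next
  assume ent: "enters circle G S c (K j 1) {topspace G - NF G S}"
  show "has_sign (en j) (-1)"
  proof (rule ccontr)
    assume "\<not> has_sign (en j) (-1)"
    then have "\<epsilon> i = 1" if "i < n" "en i = en j" for i
      using that \<epsilon> unfolding has_sign_def by blast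
    then show False
      using not_descending_end[OF j] ent unfolding enters_def by blast
  qed
qed

lemma normal_circle_star: "normal_diagram circle G S c"
  unfolding normal_diagram_def diagram_vertices_single[OF nf_components_eq] by simp

lemma one_vertex_circle_star:
  assumes "card {s \<in> en ` {..<n}. has_sign s 1 \<and> \<not> has_sign s (-1)} = nd"
    and "card {s \<in> en ` {..<n}. \<not> has_sign s 1 \<and> has_sign s (-1)} = ne"
    and "card {s \<in> en ` {..<n}. has_sign s 1 \<and> has_sign s (-1)} = nc"
  shows "one_vertex_diagram nd ne nc circle G S c"
proof (rule one_vertex_diagramI[OF diagram_vertices_single[OF nf_components_eq]])
  show "finite (NF G S)"
    unfolding NF_eq by simp
  show "departs circle G S c s {topspace G - NF G S} \<or> enters circle G S c s {topspace G - NF G S}"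
    if "s \<in> NF G S" for s
  proof -
    obtain j where j: "j < n" "s = K j 1"
      using \<open>s \<in> NF G S\<close> unfolding NF_eq by auto
    then show ?thesis
      using departs_iff[OF j(1)] enters_iff[OF j(1)] \<epsilon>[OF j(1)] unfolding has_sign_def by blast
  qed
  have count: "card {s \<in> NF G S. P (departs circle G S c s {topspace G - NF G S}) (enters circle G S c s {topspace G - NF G S})}
      = card {s \<in> en ` {..<n}. P (has_sign s 1) (has_sign s (-1))}" (is "card ?A = card ?B") for P
  proof -
    \<comment> \<open>Any arm with the label serves, since arms with equal labels have equal ends;
      \<open>h\<close> is a bijection from the labels to the non-finite points.\<close>
    define h where "h s = K (SOME j. j < n \<and> en j = s) 1" for s
    have h: "h (en j) = K j 1" if "j < n" for j
      unfolding h_def using someI[of "\<lambda>i. i < n \<and> en i = en j" j] that K_1 by blast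
    have inj: "inj_on h (en ` {..<n})"
    proof (rule inj_onI)
      fix s t assume st: "s \<in> en ` {..<n}" "t \<in> en ` {..<n}" "h s = h t"
      then obtain i j where ij: "i < n" "s = en i" "j < n" "t = en j" by blast
      then have "K i 1 = K j 1"
        using st(3) h by metis
      then show "s = t"
        using end_inj[OF TrueI ij(1,3)] ij(2,4) by simp
    qed
    have "?A = h ` ?B"
    proof (intro equalityI subsetI)
      fix s assume s: "s \<in> ?A"
      then obtain j where j: "j < n" "s = K j 1"
        unfolding NF_eq by auto
      then have "en j \<in> ?B"
        using s departs_iff[OF j(1)] enters_iff[OF j(1)] by simp
      then show "s \<in> h ` ?B"
        using h[OF j(1)] j(2) by (metis imageI)
    next
      fix s assume "s \<in> h ` ?B"
      then obtain j where j: "j < n" "s = K j 1" "P (has_sign (en j) 1) (has_sign (en j) (-1))"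
        using h by blast
      then show "s \<in> ?A"
        using departs_iff[OF j(1)] enters_iff[OF j(1)] end_in_NF by simp
    qed
    then show ?thesis
      using card_image[OF inj_on_subset[OF inj]] by (metis (no_types, lifting) mem_Collect_eq subsetI)
  qed
  show "card {s \<in> NF G S. departs circle G S c s {topspace G - NF G S} \<and> \<not> enters circle G S c s {topspace G - NF G S}} = nd"
    using count[of "\<lambda>a b. a \<and> \<not> b"] assms(1) by simp
  show "card {s \<in> NF G S. \<not> departs circle G S c s {topspace G - NF G S} \<and> enters circle G S c s {topspace G - NF G S}} = ne"
    using count[of "\<lambda>a b. \<not> a \<and> b"] assms(2) by simp
  show "card {s \<in> NF G S. departs circle G S c s {topspace G - NF G S} \<and> enters circle G S c s {topspace G - NF G S}} = nc"
    using count[of "\<lambda>a b. a \<and> b"] assms(3) by simp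
qed

end

section \<open>Reeb spaces that are star-shaped graphs\<close>

text \<open>Points are labelled by their radius \<open>\<rho>\<close> and a natural number \<open>lab\<close>: for \<open>0 < \<rho> x < 1\<close> the index of the
  arm, for \<open>\<rho> x = 1\<close> the class of the end.  The label sets are the components of the fibres of \<open>c\<close>.\<close>

locale star_labelling =
  fixes X :: "'a topology" and c :: "'a \<Rightarrow> 'y" and n :: nat and full :: bool
    and \<sigma> :: "nat \<Rightarrow> real \<Rightarrow> 'a" and \<rho> :: "'a \<Rightarrow> real" and lab :: "'a \<Rightarrow> nat" and en :: "nat \<Rightarrow> nat"
  assumes n_pos: "0 < n"
    and cont_\<rho>: "continuous_map X euclideanreal \<rho>"
    and \<rho>_dom: "x \<in> topspace X \<Longrightarrow> \<rho> x \<in> arm_dom full"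
    and lab_0: "x \<in> topspace X \<Longrightarrow> \<rho> x = 0 \<Longrightarrow> lab x = 0"
    and lab_less: "x \<in> topspace X \<Longrightarrow> 0 < \<rho> x \<Longrightarrow> \<rho> x < 1 \<Longrightarrow> lab x < n"
    and lab_1: "x \<in> topspace X \<Longrightarrow> \<rho> x = 1 \<Longrightarrow> lab x \<in> en ` {..<n}"
    and fibre_connected: "x \<in> topspace X \<Longrightarrow> connectedin X {y \<in> topspace X. \<rho> y = \<rho> x \<and> lab y = lab x}"
    and c_lab: "x \<in> topspace X \<Longrightarrow> y \<in> topspace X \<Longrightarrow> \<rho> y = \<rho> x \<Longrightarrow> lab y = lab x \<Longrightarrow> c y = c x"
    and c_\<rho>: "x \<in> topspace X \<Longrightarrow> y \<in> topspace X \<Longrightarrow> c y = c x \<Longrightarrow> \<rho> y = \<rho> x"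
    and lobe_open: "j < n \<Longrightarrow> openin X {x \<in> topspace X. 0 < \<rho> x \<and> \<rho> x < 1 \<and> lab x = j}"
    and end_nhd_open: "full \<Longrightarrow> j < n \<Longrightarrow>
      openin X {x \<in> topspace X. 1/2 < \<rho> x \<and> (if \<rho> x < 1 then en (lab x) = en j else lab x = en j)}"
    and cont_\<sigma>: "j < n \<Longrightarrow> continuous_map (top_of_set (arm_dom full)) X (\<sigma> j)"
    and \<rho>_\<sigma>: "j < n \<Longrightarrow> r \<in> arm_dom full \<Longrightarrow> \<rho> (\<sigma> j r) = r"
    and lab_\<sigma>: "j < n \<Longrightarrow> r \<in> arm_dom full \<Longrightarrow> lab (\<sigma> j r) = (if r = 0 then 0 else if r < 1 then j else en j)"
begin

lemma \<rho>_bounds: "x \<in> topspace X \<Longrightarrow> 0 \<le> \<rho> x \<and> \<rho> x \<le> 1"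
  using \<rho>_dom[of x] by (auto simp: arm_dom_def split: if_splits)

lemma \<sigma>_in: "j < n \<Longrightarrow> r \<in> arm_dom full \<Longrightarrow> \<sigma> j r \<in> topspace X"
  using continuous_map_funspace[OF cont_\<sigma>, of j] by auto

lemma full_if: "x \<in> topspace X \<Longrightarrow> \<rho> x = 1 \<Longrightarrow> full"
  using \<rho>_dom[of x] by (auto simp: arm_dom_def split: if_splits)

text \<open>The radius is constant on a fibre of \<open>c\<close>, so one of the sets from
  \<open>lobe_open\<close> and \<open>end_nhd_open\<close> cuts the label set out of it; at radius 0
  the label set is the whole fibre.\<close>

lemma fibre_open:
  assumes x: "x \<in> topspace X"
  shows "openin (subtopology X {y. c y = c x}) {y \<in> topspace X. \<rho> y = \<rho> x \<and> lab y = lab x}"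
proof -
  let ?F = "{y \<in> topspace X. \<rho> y = \<rho> x \<and> lab y = lab x}"
  have F: "y \<in> ?F \<longleftrightarrow> y \<in> topspace X \<and> c y = c x \<and> lab y = lab x" for y
    using c_lab[OF x] c_\<rho>[OF x] by blast
  consider "\<rho> x = 0" | "0 < \<rho> x" "\<rho> x < 1" | "\<rho> x = 1"
    using \<rho>_bounds[OF x] by fastforce
  then have "\<exists>U. openin X U \<and> ?F = U \<inter> {y. c y = c x}"
  proof cases
    case 1
    then have "lab y = lab x" if "y \<in> topspace X" "c y = c x" for y
      using lab_0[OF x] lab_0[OF that(1)] c_\<rho>[OF x that] by simp
    then have "?F = topspace X \<inter> {y. c y = c x}"
      using F by blast
    then show ?thesis
      using openin_topspace by blast
  next
    case 2
    then have "0 < \<rho> y \<and> \<rho> y < 1" if "y \<in> topspace X" "c y = c x" for y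
      using c_\<rho>[OF x that] by simp
    then have "?F = {y \<in> topspace X. 0 < \<rho> y \<and> \<rho> y < 1 \<and> lab y = lab x} \<inter> {y. c y = c x}"
      using F by blast
    then show ?thesis
      using lobe_open[OF lab_less[OF x 2]] by blast
  next
    case 3
    obtain j where j: "j < n" "lab x = en j"
      using lab_1[OF x 3] by blast
    have "1/2 < \<rho> y \<and> (if \<rho> y < 1 then en (lab y) = en j else lab y = en j) \<longleftrightarrow> lab y = lab x"
      if "y \<in> topspace X" "c y = c x" for y
      using c_\<rho>[OF x that] 3 j(2) by simp
    then have "?F = {y \<in> topspace X. 1/2 < \<rho> y \<and> (if \<rho> y < 1 then en (lab y) = en j else lab y = en j)} \<inter> {y. c y = c x}"
      using F by blast
    then show ?thesis
      using end_nhd_open[OF full_if[OF x 3] j(1)] by blast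
  qed
  then show ?thesis
    by (simp add: openin_subtopology)
qed

text \<open>The fibre is a disjoint union of label sets, all of them open in it. So each is closed
  in it too, and being connected it is a component.\<close>

lemma reeb_map_eq:
  assumes x: "x \<in> topspace X"
  shows "reeb_map X c x = {y \<in> topspace X. \<rho> y = \<rho> x \<and> lab y = lab x}"
  unfolding reeb_map_def
proof (rule connected_component_of_clopen)
  let ?F = "\<lambda>x. {y \<in> topspace X. \<rho> y = \<rho> x \<and> lab y = lab x}"
  let ?T = "subtopology X {y. c y = c x}"
  have sub: "?F x \<subseteq> {y. c y = c x}"
    using c_lab[OF x] by auto
  then show "connectedin ?T (?F x)"
    using fibre_connected[OF x] by (simp add: connectedin_subtopology)
  show "openin ?T (?F x)"
    by (rule fibre_open[OF x])
  have "openin ?T (?F y)" if "y \<in> topspace X" "c y = c x" for y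
    using fibre_open[OF that(1)] that(2) by simp
  moreover have "topspace ?T - ?F x = \<Union>(?F ` {y \<in> topspace X. c y = c x \<and> y \<notin> ?F x})"
  proof (intro equalityI subsetI)
    fix z assume "z \<in> \<Union>(?F ` {y \<in> topspace X. c y = c x \<and> y \<notin> ?F x})"
    then obtain y where y: "y \<in> topspace X" "c y = c x" "y \<notin> ?F x" "z \<in> ?F y" by blast
    then show "z \<in> topspace ?T - ?F x"
      using c_lab[of y z] by auto
  qed auto
  ultimately have "openin ?T (topspace ?T - ?F x)"
    by (auto intro!: openin_Union)
  then show "closedin ?T (?F x)"
    using sub by (auto simp: closedin_def)
qed (use x in auto)

lemma reeb_map_eq_iff:
  assumes "x \<in> topspace X" "y \<in> topspace X"
  shows "reeb_map X c x = reeb_map X c y \<longleftrightarrow> \<rho> x = \<rho> y \<and> lab x = lab y"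
  unfolding reeb_map_eq[OF assms(1)] reeb_map_eq[OF assms(2)] using assms by auto

text \<open>Here \<open>reeb_fun \<rho>\<close> is the map that \<open>\<rho>\<close> induces on the
  classes of \<open>c\<close>; it is well defined because these classes have constant
  radius.\<close>

lemma reeb_fun_\<rho>: "x \<in> topspace X \<Longrightarrow> reeb_fun \<rho> (reeb_map X c x) = \<rho> x"
proof -
  assume x: "x \<in> topspace X"
  then have "\<rho> ` reeb_map X c x = {\<rho> x}"
    unfolding reeb_map_eq[OF x] by (auto simp: image_iff)
  then show ?thesis
    by (simp add: reeb_fun_def)
qed

lemma continuous_map_reeb: "continuous_map X (reeb_space X c) (reeb_map X c)"
  using quotient_map_reeb_map quotient_imp_continuous_map by blast

lemma continuous_map_from_reeb:
  assumes "continuous_map X Y f" "\<And>x. x \<in> topspace X \<Longrightarrow> g (reeb_map X c x) = f x"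
  shows "continuous_map (reeb_space X c) Y g"
proof -
  have "continuous_map X Y (g \<circ> reeb_map X c)"
    using assms by (auto intro: continuous_map_eq)
  then show ?thesis
    using continuous_compose_quotient_map[OF quotient_map_reeb_map] by blast
qed

lemma continuous_reeb_fun: "continuous_map X Y c \<Longrightarrow> continuous_map (reeb_space X c) Y (reeb_fun c)"
  by (erule continuous_map_from_reeb) (rule reeb_fun_reeb_map)

lemma \<sigma>_cover:
  assumes x: "x \<in> topspace X"
  obtains j where "j < n" "reeb_map X c x = reeb_map X c (\<sigma> j (\<rho> x))"
    "\<rho> x = 1 \<Longrightarrow> en j = lab x" "0 < \<rho> x \<Longrightarrow> \<rho> x < 1 \<Longrightarrow> j = lab x"
proof -
  have dom: "\<rho> x \<in> arm_dom full"
    by (rule \<rho>_dom[OF x])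
  have eq: "reeb_map X c x = reeb_map X c (\<sigma> j (\<rho> x))"
    if "j < n" "lab x = (if \<rho> x = 0 then 0 else if \<rho> x < 1 then j else en j)" for j
    using that x dom by (subst reeb_map_eq_iff) (auto simp: \<sigma>_in \<rho>_\<sigma> lab_\<sigma>)
  consider "\<rho> x = 0" | "0 < \<rho> x" "\<rho> x < 1" | "\<rho> x = 1"
    using \<rho>_bounds[OF x] by fastforce
  then show thesis
  proof cases
    case 1
    then show thesis
      using that[OF n_pos eq[OF n_pos]] lab_0[OF x] by simp
  next
    case 2
    then show thesis
      using that[OF _ eq, of "lab x"] lab_less[OF x] by simp
  next
    case 3
    obtain j where j: "j < n" "lab x = en j"
      using lab_1[OF x 3] by auto
    have "reeb_map X c x = reeb_map X c (\<sigma> j (\<rho> x))"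
      using j 3 by (intro eq) simp_all
    then show thesis
      using j 3 by (intro that[of j]) simp_all
  qed
qed

text \<open>Openness in the Reeb space is openness of the preimage, and the preimages of the open
  arms and of the end neighbourhoods are the sets that the labelling assumes to be open.\<close>

sublocale reeb: star "reeb_space X c" n full "\<lambda>j r. reeb_map X c (\<sigma> j r)" "reeb_fun \<rho>" en
proof
  show "0 < n"
    by (rule n_pos)
  show "topspace (reeb_space X c) = (\<Union>j<n. (\<lambda>r. reeb_map X c (\<sigma> j r)) ` arm_dom full)"
    unfolding topspace_reeb_space
  proof (intro equalityI subsetI)
    fix p assume "p \<in> reeb_map X c ` topspace X"
    then obtain x where x: "x \<in> topspace X" "p = reeb_map X c x" by blast
    then obtain j where "j < n" "p = reeb_map X c (\<sigma> j (\<rho> x))"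
      using \<sigma>_cover by metis
    then show "p \<in> (\<Union>j<n. (\<lambda>r. reeb_map X c (\<sigma> j r)) ` arm_dom full)"
      using \<rho>_dom[OF x(1)] by blast
  qed (auto intro: \<sigma>_in)
  show "continuous_map (top_of_set (arm_dom full)) (reeb_space X c) (\<lambda>r. reeb_map X c (\<sigma> j r))" if "j < n" for j
    using continuous_map_compose[OF cont_\<sigma>[OF that] continuous_map_reeb] by (simp add: o_def)
  show "continuous_map (reeb_space X c) euclideanreal (reeb_fun \<rho>)"
    by (rule continuous_map_from_reeb[OF cont_\<rho> reeb_fun_\<rho>])
  show "reeb_fun \<rho> (reeb_map X c (\<sigma> j r)) = r" if "j < n" "r \<in> arm_dom full" for j r
    using reeb_fun_\<rho>[OF \<sigma>_in[OF that]] \<rho>_\<sigma>[OF that] by simp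
  have 0: "0 \<in> arm_dom full"
    by (simp add: arm_dom_def)
  show "reeb_map X c (\<sigma> i 0) = reeb_map X c (\<sigma> j 0)" if "i < n" "j < n" for i j
    using that 0 by (subst reeb_map_eq_iff) (auto simp: \<sigma>_in \<rho>_\<sigma> lab_\<sigma>)
  have 1: "1 \<in> arm_dom full" if full
    using that by (simp add: arm_dom_def)
  show "reeb_map X c (\<sigma> i 1) = reeb_map X c (\<sigma> j 1)" if "full" "i < n" "j < n" "en i = en j" for i j
    using that 1 by (subst reeb_map_eq_iff) (auto simp: \<sigma>_in \<rho>_\<sigma> lab_\<sigma>)
  show "en i = en j" if "full" "i < n" "j < n" "reeb_map X c (\<sigma> i 1) = reeb_map X c (\<sigma> j 1)" for i j
    using that(4) that(1-3) 1 by (subst (asm) reeb_map_eq_iff) (auto simp: \<sigma>_in \<rho>_\<sigma> lab_\<sigma>)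
  have inner: "r \<in> arm_dom full" if "0 < r" "r < 1" for r
    using that by (simp add: arm_dom_def)
  show "i = j" if "i < n" "j < n" "0 < r" "r < 1" "reeb_map X c (\<sigma> i r) = reeb_map X c (\<sigma> j r)" for i j r
    using that(5) that(1-4) inner by (subst (asm) reeb_map_eq_iff) (auto simp: \<sigma>_in \<rho>_\<sigma> lab_\<sigma>)
  show "openin (reeb_space X c) ((\<lambda>r. reeb_map X c (\<sigma> j r)) ` {0<..<1})" if j: "j < n" for j
    unfolding openin_reeb_space
  proof
    show "(\<lambda>r. reeb_map X c (\<sigma> j r)) ` {0<..<1} \<subseteq> reeb_map X c ` topspace X"
      using \<sigma>_in[OF j] inner by auto
    have "{x \<in> topspace X. reeb_map X c x \<in> (\<lambda>r. reeb_map X c (\<sigma> j r)) ` {0<..<1}} =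
        {x \<in> topspace X. 0 < \<rho> x \<and> \<rho> x < 1 \<and> lab x = j}"
    proof (intro equalityI subsetI)
      fix x assume "x \<in> {x \<in> topspace X. reeb_map X c x \<in> (\<lambda>r. reeb_map X c (\<sigma> j r)) ` {0<..<1}}"
      then obtain r where r: "x \<in> topspace X" "0 < r" "r < 1" "reeb_map X c x = reeb_map X c (\<sigma> j r)"
        by auto
      then have "\<rho> x = \<rho> (\<sigma> j r)" "lab x = lab (\<sigma> j r)"
        using reeb_map_eq_iff[OF r(1) \<sigma>_in[OF j inner[OF r(2,3)]]] by auto
      then show "x \<in> {x \<in> topspace X. 0 < \<rho> x \<and> \<rho> x < 1 \<and> lab x = j}"
        using r \<rho>_\<sigma>[OF j inner[OF r(2,3)]] lab_\<sigma>[OF j inner[OF r(2,3)]] by simp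
    next
      fix x assume x: "x \<in> {x \<in> topspace X. 0 < \<rho> x \<and> \<rho> x < 1 \<and> lab x = j}"
      then obtain i where "reeb_map X c x = reeb_map X c (\<sigma> i (\<rho> x))" "i = lab x"
        using \<sigma>_cover[of x] by auto
      then show "x \<in> {x \<in> topspace X. reeb_map X c x \<in> (\<lambda>r. reeb_map X c (\<sigma> j r)) ` {0<..<1}}"
        using x by auto
    qed
    then show "openin X {x \<in> topspace X. reeb_map X c x \<in> (\<lambda>r. reeb_map X c (\<sigma> j r)) ` {0<..<1}}"
      using lobe_open[OF j] by simp
  qed
  show "openin (reeb_space X c) {reeb_map X c (\<sigma> i r) | i r. i < n \<and> en i = en j \<and> 1/2 < r \<and> r \<le> 1}"
    if "full" and j: "j < n" for j
    unfolding openin_reeb_space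
  proof
    have dom: "r \<in> arm_dom full" if "1/2 < r" "r \<le> 1" for r
      using that \<open>full\<close> by (simp add: arm_dom_def)
    then show "{reeb_map X c (\<sigma> i r) | i r. i < n \<and> en i = en j \<and> 1/2 < r \<and> r \<le> 1} \<subseteq> reeb_map X c ` topspace X"
      using \<sigma>_in by blast
    have "{x \<in> topspace X. reeb_map X c x \<in> {reeb_map X c (\<sigma> i r) | i r. i < n \<and> en i = en j \<and> 1/2 < r \<and> r \<le> 1}} =
        {x \<in> topspace X. 1/2 < \<rho> x \<and> (if \<rho> x < 1 then en (lab x) = en j else lab x = en j)}"
    proof (intro equalityI subsetI)
      fix x assume "x \<in> {x \<in> topspace X. reeb_map X c x \<in> {reeb_map X c (\<sigma> i r) | i r. i < n \<and> en i = en j \<and> 1/2 < r \<and> r \<le> 1}}"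
      then obtain i r where r: "x \<in> topspace X" "i < n" "en i = en j" "1/2 < r" "r \<le> 1"
        "reeb_map X c x = reeb_map X c (\<sigma> i r)"
        by auto
      then have "\<rho> x = \<rho> (\<sigma> i r)" "lab x = lab (\<sigma> i r)"
        using reeb_map_eq_iff[OF r(1) \<sigma>_in[OF r(2) dom[OF r(4,5)]]] by auto
      then show "x \<in> {x \<in> topspace X. 1/2 < \<rho> x \<and> (if \<rho> x < 1 then en (lab x) = en j else lab x = en j)}"
        using r \<rho>_\<sigma>[OF r(2) dom[OF r(4,5)]] lab_\<sigma>[OF r(2) dom[OF r(4,5)]] by auto
    next
      fix x assume x: "x \<in> {x \<in> topspace X. 1/2 < \<rho> x \<and> (if \<rho> x < 1 then en (lab x) = en j else lab x = en j)}"
      then have xX: "x \<in> topspace X" by simp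
      obtain i where i: "i < n" "reeb_map X c x = reeb_map X c (\<sigma> i (\<rho> x))"
        "\<rho> x = 1 \<Longrightarrow> en i = lab x" "0 < \<rho> x \<Longrightarrow> \<rho> x < 1 \<Longrightarrow> i = lab x"
        using \<sigma>_cover[OF xX] by metis
      have "\<rho> x < 1 \<or> \<rho> x = 1"
        using \<rho>_bounds[OF xX] by auto
      then have "en i = en j"
        using x i(3,4) by (auto split: if_splits)
      then show "x \<in> {x \<in> topspace X. reeb_map X c x \<in> {reeb_map X c (\<sigma> i r) | i r. i < n \<and> en i = en j \<and> 1/2 < r \<and> r \<le> 1}}"
        using x i(1,2) \<rho>_bounds[OF xX] by blast
    qed
    then show "openin X {x \<in> topspace X. reeb_map X c x \<in> {reeb_map X c (\<sigma> i r) | i r. i < n \<and> en i = en j \<and> 1/2 < r \<and> r \<le> 1}}"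
      using end_nhd_open[OF that] by simp
  qed
qed

text \<open>Connectedness is lifted from the star, since the quotient map has connected
  fibres.\<close>

lemma connected_total: "connected_space X"
proof (rule connected_space_monotone_quotient_map_preimage)
  show "monotone_map X (reeb_space X c) (reeb_map X c)"
    unfolding monotone_map_def
  proof (intro conjI ballI)
    fix p assume "p \<in> topspace (reeb_space X c)"
    then obtain x where x: "x \<in> topspace X" "p = reeb_map X c x"
      unfolding topspace_reeb_space by blast
    have "{y \<in> topspace X. reeb_map X c y = p} = {y \<in> topspace X. \<rho> y = \<rho> x \<and> lab y = lab x}"
      unfolding x(2) using reeb_map_eq_iff[OF _ x(1)] by blast
    then show "connectedin X {y \<in> topspace X. reeb_map X c y = p}"
      using fibre_connected[OF x(1)] by simp
  qed (simp add: topspace_reeb_space)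
qed (rule quotient_map_reeb_map reeb.connected_G)+

end

section \<open>Adding points to a space\<close>

text \<open>A new point \<open>s\<close> has the basic neighbourhoods
  \<open>insert s (N s a)\<close>. They contain no other new point, so the new points are isolated
  from each other.\<close>

definition ext_open :: "'a topology \<Rightarrow> 'a set \<Rightarrow> ('a \<Rightarrow> real \<Rightarrow> 'a set) \<Rightarrow> 'a set \<Rightarrow> bool" where
  "ext_open X P N U \<longleftrightarrow> U \<subseteq> topspace X \<union> P \<and> openin X (U \<inter> topspace X) \<and> (\<forall>s\<in>U \<inter> P. \<exists>a>0. N s a \<subseteq> U)"

definition ext_top :: "'a topology \<Rightarrow> 'a set \<Rightarrow> ('a \<Rightarrow> real \<Rightarrow> 'a set) \<Rightarrow> 'a topology" where
  "ext_top X P N = topology (ext_open X P N)"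

locale extension =
  fixes X :: "'a topology" and P :: "'a set" and N :: "'a \<Rightarrow> real \<Rightarrow> 'a set"
  assumes P_disj: "P \<inter> topspace X = {}"
    and N_open: "s \<in> P \<Longrightarrow> openin X (N s a)"
    and N_mono: "s \<in> P \<Longrightarrow> a \<le> b \<Longrightarrow> N s a \<subseteq> N s b"
begin

abbreviation "Xext \<equiv> ext_top X P N"

lemma openin_ext: "openin Xext U \<longleftrightarrow> ext_open X P N U"
proof -
  have "istopology (ext_open X P N)"
    unfolding istopology_def
  proof (intro conjI allI impI)
    fix U V assume U: "ext_open X P N U" and V: "ext_open X P N V"
    have "\<exists>a>0. N s a \<subseteq> U \<inter> V" if s: "s \<in> U \<inter> V \<inter> P" for s
    proof -
      obtain a b where "a > 0" "N s a \<subseteq> U" "b > 0" "N s b \<subseteq> V"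
        using U V s unfolding ext_open_def by blast
      moreover have "N s (min a b) \<subseteq> N s a" "N s (min a b) \<subseteq> N s b"
        using s N_mono by auto
      ultimately show ?thesis
        by (intro exI[of _ "min a b"]) auto
    qed
    moreover have "U \<inter> V \<inter> topspace X = (U \<inter> topspace X) \<inter> (V \<inter> topspace X)"
      by blast
    ultimately show "ext_open X P N (U \<inter> V)"
      using U V unfolding ext_open_def by (auto simp: openin_Int)
  next
    fix \<U> assume \<U>: "\<forall>U\<in>\<U>. ext_open X P N U"
    have "openin X (\<Union>U\<in>\<U>. U \<inter> topspace X)"
      using \<U> unfolding ext_open_def by blast
    moreover have "\<Union>\<U> \<inter> topspace X = (\<Union>U\<in>\<U>. U \<inter> topspace X)"
      by blast
    ultimately have "openin X (\<Union>\<U> \<inter> topspace X)"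
      by (simp only:)
    then show "ext_open X P N (\<Union>\<U>)"
      unfolding ext_open_def
    proof (intro conjI ballI)
      show "\<Union>\<U> \<subseteq> topspace X \<union> P"
        using \<U> unfolding ext_open_def by blast
      fix s assume "s \<in> \<Union>\<U> \<inter> P"
      then obtain U where "U \<in> \<U>" "s \<in> U \<inter> P" by blast
      then obtain a where "a > 0" "N s a \<subseteq> U"
        using \<U> unfolding ext_open_def by blast
      then show "\<exists>a>0. N s a \<subseteq> \<Union>\<U>"
        using \<open>U \<in> \<U>\<close> by blast
    qed
  qed
  then show ?thesis
    unfolding ext_top_def by (simp add: topology_inverse')
qed

lemma N_sub: "s \<in> P \<Longrightarrow> N s a \<subseteq> topspace X"
  using N_open openin_subset by blast

lemma topspace_ext: "topspace Xext = topspace X \<union> P"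
proof
  show "topspace Xext \<subseteq> topspace X \<union> P"
    using openin_topspace[of Xext] unfolding openin_ext ext_open_def by blast
  have "ext_open X P N (topspace X \<union> P)"
    unfolding ext_open_def using N_sub
    by (auto intro!: exI[of _ 1] simp: Int_Un_distrib2 P_disj)
  then show "topspace X \<union> P \<subseteq> topspace Xext"
    using openin_ext openin_subset by blast
qed

lemma openin_ext_old: "openin X U \<Longrightarrow> openin Xext U"
proof -
  assume U: "openin X U"
  then have "U \<subseteq> topspace X"
    by (rule openin_subset)
  then have "U \<inter> P = {}" "U \<inter> topspace X = U"
    using P_disj by auto
  then show ?thesis
    using U \<open>U \<subseteq> topspace X\<close> unfolding openin_ext ext_open_def by auto
qed

lemma openin_ext_nhd: "s \<in> P \<Longrightarrow> a > 0 \<Longrightarrow> openin Xext (insert s (N s a))"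
proof -
  assume s: "s \<in> P" and a: "a > 0"
  have "insert s (N s a) \<inter> topspace X = N s a" "insert s (N s a) \<inter> P = {s}"
    using s N_sub[OF s] P_disj by auto
  then show ?thesis
    unfolding openin_ext ext_open_def using s a N_sub[OF s] N_open[OF s] by auto
qed

lemma subtopology_ext: "subtopology Xext (topspace X) = X"
proof (rule topology_eq[THEN iffD2], intro allI iffI)
  fix U assume "openin (subtopology Xext (topspace X)) U"
  then show "openin X U"
    unfolding openin_subtopology openin_ext ext_open_def by blast
next
  fix U assume U: "openin X U"
  have "U = U \<inter> topspace X"
    using openin_subset[OF U] by (rule inf.absorb1[symmetric])
  then show "openin (subtopology Xext (topspace X)) U"
    unfolding openin_subtopology by (intro exI[of _ U] conjI openin_ext_old U)
qed

lemma embedding_ext: "embedding_map X Xext id"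
proof -
  have "homeomorphic_map X (subtopology Xext (topspace X)) id"
    unfolding subtopology_ext by (rule homeomorphic_map_id[THEN iffD2]) simp
  then show ?thesis
    by (simp add: embedding_map_def)
qed

lemma connectedin_ext: "connectedin X C \<Longrightarrow> connectedin Xext C"
  using connectedin_subtopology[of Xext "topspace X" C] unfolding subtopology_ext by blast

lemma continuous_map_ext:
  assumes f: "continuous_map X Y f" and new: "\<And>s. s \<in> P \<Longrightarrow> f s \<in> topspace Y"
    and lim: "\<And>s V. s \<in> P \<Longrightarrow> openin Y V \<Longrightarrow> f s \<in> V \<Longrightarrow> \<exists>a>0. \<forall>x\<in>N s a. f x \<in> V"
  shows "continuous_map Xext Y f"
  unfolding continuous_map_def
proof (intro conjI allI impI)
  show "f \<in> topspace Xext \<rightarrow> topspace Y"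
    using funcset_mem[OF continuous_map_funspace[OF f]] new unfolding topspace_ext by (intro funcsetI) blast
  fix V assume V: "openin Y V"
  have "{x \<in> topspace X \<union> P. f x \<in> V} \<inter> topspace X = {x \<in> topspace X. f x \<in> V}"
    by auto
  moreover have "\<exists>a>0. N s a \<subseteq> {x \<in> topspace X \<union> P. f x \<in> V}" if "s \<in> P" "f s \<in> V" for s
    using lim[OF that(1) V that(2)] N_sub[OF that(1)] by blast
  ultimately show "openin Xext {x \<in> topspace Xext. f x \<in> V}"
    unfolding topspace_ext openin_ext ext_open_def using V f by (auto simp: continuous_map_def)
qed

lemma closure_ext:
  assumes "\<And>s a. s \<in> P \<Longrightarrow> a > 0 \<Longrightarrow> N s a \<noteq> {}"
  shows "Xext closure_of topspace X = topspace Xext"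
proof (intro equalityI subsetI)
  fix x assume x: "x \<in> topspace Xext"
  have "\<exists>y. y \<in> topspace X \<and> y \<in> U" if U: "x \<in> U" "openin Xext U" for U
  proof (cases "x \<in> P")
    case True
    then obtain a where "a > 0" "N x a \<subseteq> U"
      using U unfolding openin_ext ext_open_def by blast
    then show ?thesis
      using assms[OF True] N_sub[OF True] by blast
  next
    case False
    then show ?thesis
      using x U unfolding topspace_ext by blast
  qed
  then show "x \<in> Xext closure_of topspace X"
    using x by (auto simp: in_closure_of)
qed (simp add: in_closure_of)

text \<open>In an open cover, one member for each new point covers a set \<open>N s (a s)\<close>;
  what these finitely many sets leave of \<open>X\<close> is compact.\<close>

lemma compact_ext:
  assumes fin: "finite P"
    and com: "\<And>a. (\<And>s. s \<in> P \<Longrightarrow> a s > 0) \<Longrightarrow> compactin X (topspace X - (\<Union>s\<in>P. N s (a s)))"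
  shows "compact_space Xext"
  unfolding compact_space_def compactin_def
proof (intro conjI allI impI)
  fix \<U> assume "Ball \<U> (openin Xext) \<and> topspace Xext \<subseteq> \<Union>\<U>"
  then have \<U>: "\<forall>U\<in>\<U>. openin Xext U" and cov: "topspace Xext \<subseteq> \<Union>\<U>"
    by blast+
  have "\<forall>s\<in>P. \<exists>U a. U \<in> \<U> \<and> s \<in> U \<and> a > 0 \<and> N s a \<subseteq> U"
  proof
    fix s assume s: "s \<in> P"
    then obtain U where "U \<in> \<U>" "s \<in> U"
      using cov unfolding topspace_ext by blast
    then show "\<exists>U a. U \<in> \<U> \<and> s \<in> U \<and> a > 0 \<and> N s a \<subseteq> U"
      using \<U> s unfolding openin_ext ext_open_def by blast
  qed
  then obtain V a where V: "\<And>s. s \<in> P \<Longrightarrow> V s \<in> \<U>" "\<And>s. s \<in> P \<Longrightarrow> s \<in> V s"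
    "\<And>s. s \<in> P \<Longrightarrow> a s > 0" "\<And>s. s \<in> P \<Longrightarrow> N s (a s) \<subseteq> V s"
    by metis
  let ?K = "topspace X - (\<Union>s\<in>P. N s (a s))"
  have "compactin X ?K"
    by (rule com[OF V(3)])
  moreover have "\<forall>U\<in>(\<lambda>U. U \<inter> topspace X) ` \<U>. openin X U"
    using \<U> unfolding openin_ext ext_open_def by blast
  moreover have "?K \<subseteq> \<Union>((\<lambda>U. U \<inter> topspace X) ` \<U>)"
    using cov unfolding topspace_ext by blast
  ultimately obtain \<F> where \<F>: "finite \<F>" "\<F> \<subseteq> (\<lambda>U. U \<inter> topspace X) ` \<U>" "?K \<subseteq> \<Union>\<F>"
    unfolding compactin_def by meson
  obtain \<G> where \<G>: "finite \<G>" "\<G> \<subseteq> \<U>" "\<F> = (\<lambda>U. U \<inter> topspace X) ` \<G>"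
    using finite_subset_image[OF \<F>(1,2)] by blast
  have "topspace Xext \<subseteq> \<Union>(\<G> \<union> V ` P)"
  proof
    fix x assume "x \<in> topspace Xext"
    then consider "x \<in> P" | "x \<in> ?K" | s where "s \<in> P" "x \<in> N s (a s)"
      unfolding topspace_ext by blast
    then show "x \<in> \<Union>(\<G> \<union> V ` P)"
      by cases (use V \<G>(3) \<F>(3) in blast)+
  qed
  moreover have "finite (\<G> \<union> V ` P)" "\<G> \<union> V ` P \<subseteq> \<U>"
    using \<G> fin V(1) by auto
  ultimately show "\<exists>\<F>. finite \<F> \<and> \<F> \<subseteq> \<U> \<and> topspace Xext \<subseteq> \<Union>\<F>"
    by blast
qed simp

end

section \<open>Real analytic functions\<close>

lemma real_analytic_on_const: "real_analytic_on (\<lambda>_. c::real) U"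
  unfolding real_analytic_on_def
proof (intro ballI)
  fix x :: 'a assume "x \<in> U"
  \<comment> \<open>The zero multi-index, restricted so as to be an element of
    \<open>Basis \<rightarrow>\<^sub>E UNIV\<close>.\<close>
  define z :: "'a \<Rightarrow> nat" where "z = restrict (\<lambda>_. 0) Basis"
  define a where "a \<alpha> = (if \<alpha> = z then c else 0)" for \<alpha>
  have "((\<lambda>\<alpha>. (\<Prod>b\<in>Basis. ((y - x) \<bullet> b) ^ \<alpha> b) *\<^sub>R a \<alpha>) has_sum c) (Basis \<rightarrow>\<^sub>E UNIV)" for y
  proof -
    have "((\<lambda>\<alpha>. (\<Prod>b\<in>Basis. ((y - x) \<bullet> b) ^ \<alpha> b) *\<^sub>R a \<alpha>) has_sum c) {z}"
      by (simp add: has_sum_finiteI a_def z_def)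
    then show ?thesis
      by (subst has_sum_cong_neutral[where T = "{z}"]) (auto simp: a_def z_def)
  qed
  then show "\<exists>r>0. \<exists>a. \<forall>y\<in>ball x r.
      ((\<lambda>\<alpha>. (\<Prod>b\<in>Basis. ((y - x) \<bullet> b) ^ \<alpha> b) *\<^sub>R a \<alpha>) has_sum c) (Basis \<rightarrow>\<^sub>E UNIV)"
    by (intro exI[of _ 1] conjI exI[of _ a]) auto
qed

lemma real_analytic_on_add:
  fixes f g :: "'a::euclidean_space \<Rightarrow> real"
  assumes "real_analytic_on f U" "real_analytic_on g U"
  shows "real_analytic_on (\<lambda>x. f x + g x) U"
  unfolding real_analytic_on_def
proof (intro ballI)
  fix x assume "x \<in> U"
  obtain r a where r: "r > 0" and a: "\<forall>y\<in>ball x r.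
       ((\<lambda>\<alpha>. (\<Prod>b\<in>Basis. ((y - x) \<bullet> b) ^ \<alpha> b) *\<^sub>R a \<alpha>) has_sum f y) (Basis \<rightarrow>\<^sub>E UNIV)"
    using assms(1) \<open>x \<in> U\<close> unfolding real_analytic_on_def by blast
  obtain r' a' where r': "r' > 0" and a': "\<forall>y\<in>ball x r'.
       ((\<lambda>\<alpha>. (\<Prod>b\<in>Basis. ((y - x) \<bullet> b) ^ \<alpha> b) *\<^sub>R a' \<alpha>) has_sum g y) (Basis \<rightarrow>\<^sub>E UNIV)"
    using assms(2) \<open>x \<in> U\<close> unfolding real_analytic_on_def by blast
  have "((\<lambda>\<alpha>. (\<Prod>b\<in>Basis. ((y - x) \<bullet> b) ^ \<alpha> b) *\<^sub>R (a \<alpha> + a' \<alpha>)) has_sum f y + g y) (Basis \<rightarrow>\<^sub>E UNIV)"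
    if "y \<in> ball x (min r r')" for y
    using that a a' unfolding scaleR_add_right by (intro has_sum_add) auto
  then show "\<exists>r>0. \<exists>a. \<forall>y\<in>ball x r.
      ((\<lambda>\<alpha>. (\<Prod>b\<in>Basis. ((y - x) \<bullet> b) ^ \<alpha> b) *\<^sub>R a \<alpha>) has_sum f y + g y) (Basis \<rightarrow>\<^sub>E UNIV)"
    using r r' by (intro exI[of _ "min r r'"] conjI exI[of _ "\<lambda>\<alpha>. a \<alpha> + a' \<alpha>"]) auto
qed

text \<open>Summable families of reals are absolutely summable, so the family of products is
  summable and its sum can be iterated.\<close>

lemma has_sum_times_real:
  fixes f g :: "_ \<Rightarrow> real"
  assumes "(f has_sum s) A" "(g has_sum t) B"
  shows "((\<lambda>(x, y). f x * g y) has_sum s * t) (A \<times> B)"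
proof -
  have "(\<lambda>x. norm (f x)) summable_on A" "(\<lambda>y. norm (g y)) summable_on B"
    using assms has_sum_imp_summable summable_on_iff_abs_summable_on_real by blast+
  then have "(\<lambda>q. norm (case q of (x, y) \<Rightarrow> f x * g y)) summable_on A \<times> B"
    by (subst Infinite_Sum.abs_summable_on_Sigma_iff)
       (auto simp: abs_mult infsum_cmult_right' intro: summable_on_cmult_right summable_on_cmult_left)
  then have "(\<lambda>(x, y). f x * g y) summable_on A \<times> B"
    by (rule abs_summable_summable)
  then show ?thesis
    using assms
    by (intro has_sum_SigmaI[where g = "\<lambda>x. f x * t"] has_sum_cmult_left)
       (auto intro: has_sum_cmult_right)
qed

text \<open>Cauchy product: the pairs of multi-indices are grouped by their sum
  \<open>\<gamma>\<close>. A group is finite, as both members are bounded by \<open>\<gamma>\<close>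
  in each coordinate.\<close>

lemma real_analytic_on_mult:
  fixes f g :: "'a::euclidean_space \<Rightarrow> real"
  assumes "real_analytic_on f U" "real_analytic_on g U"
  shows "real_analytic_on (\<lambda>x. f x * g x) U"
  unfolding real_analytic_on_def
proof (intro ballI)
  fix x assume "x \<in> U"
  let ?E = "Basis \<rightarrow>\<^sub>E UNIV :: ('a \<Rightarrow> nat) set"
  define m where "m y \<alpha> = (\<Prod>b\<in>Basis. ((y - x) \<bullet> b) ^ \<alpha> b)" for y and \<alpha> :: "'a \<Rightarrow> nat"
  obtain r a where r: "r > 0" and a: "\<forall>y\<in>ball x r. ((\<lambda>\<alpha>. m y \<alpha> *\<^sub>R a \<alpha>) has_sum f y) ?E"
    using assms(1) \<open>x \<in> U\<close> unfolding real_analytic_on_def m_def by blast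
  obtain r' a' where r': "r' > 0" and a': "\<forall>y\<in>ball x r'. ((\<lambda>\<alpha>. m y \<alpha> *\<^sub>R a' \<alpha>) has_sum g y) ?E"
    using assms(2) \<open>x \<in> U\<close> unfolding real_analytic_on_def m_def by blast
  define p where "p = (\<lambda>(\<alpha>, \<beta>). restrict (\<lambda>b. \<alpha> b + \<beta> b) Basis :: 'a \<Rightarrow> nat)"
  define F where "F \<gamma> = {q \<in> ?E \<times> ?E. p q = \<gamma>}" for \<gamma>
  define c where "c \<gamma> = (\<Sum>(\<alpha>, \<beta>)\<in>F \<gamma>. a \<alpha> * a' \<beta>)" for \<gamma>
  have finF: "finite (F \<gamma>)" for \<gamma>
  proof (rule finite_subset)
    show "F \<gamma> \<subseteq> (\<Pi>\<^sub>E b\<in>Basis. {..\<gamma> b}) \<times> (\<Pi>\<^sub>E b\<in>Basis. {..\<gamma> b})"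
      by (auto simp: F_def p_def PiE_iff)
    show "finite ((\<Pi>\<^sub>E b\<in>Basis. {..\<gamma> b}) \<times> (\<Pi>\<^sub>E b\<in>Basis. {..\<gamma> b}))"
      by (intro finite_cartesian_product finite_PiE) auto
  qed
  have "((\<lambda>\<gamma>. m y \<gamma> *\<^sub>R c \<gamma>) has_sum f y * g y) ?E" if y: "y \<in> ball x (min r r')" for y
  proof -
    let ?T = "\<lambda>(\<alpha>, \<beta>). (m y \<alpha> * a \<alpha>) * (m y \<beta> * a' \<beta>)"
    have "((\<lambda>\<alpha>. m y \<alpha> * a \<alpha>) has_sum f y) ?E" "((\<lambda>\<alpha>. m y \<alpha> * a' \<alpha>) has_sum g y) ?E"
      using y a a' by auto
    then have T: "(?T has_sum f y * g y) (?E \<times> ?E)"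
      by (rule has_sum_times_real)
    have "bij_betw snd (Sigma ?E F) (?E \<times> ?E)"
    proof (rule bij_betwI[where g = "\<lambda>q. (p q, q)"])
      show "snd \<in> Sigma ?E F \<rightarrow> ?E \<times> ?E"
        by (force simp: F_def)
      show "(\<lambda>q. (p q, q)) \<in> ?E \<times> ?E \<rightarrow> Sigma ?E F"
        by (auto simp: F_def p_def)
      show "(p (snd x), snd x) = x" if "x \<in> Sigma ?E F" for x
        using that by (cases x) (simp add: F_def)
    qed simp
    from has_sum_reindex_bij_betw[OF this, of ?T] T
    have S: "((\<lambda>z. ?T (snd z)) has_sum f y * g y) (Sigma ?E F)"
      by simp
    have fibre: "(\<Sum>q\<in>F \<gamma>. ?T q) = m y \<gamma> * c \<gamma>" for \<gamma>
    proof -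
      have "?T q = m y \<gamma> * (case q of (\<alpha>, \<beta>) \<Rightarrow> a \<alpha> * a' \<beta>)" if "q \<in> F \<gamma>" for q
      proof -
        obtain \<alpha> \<beta> where q: "q = (\<alpha>, \<beta>)" by force
        then have "\<gamma> = restrict (\<lambda>b. \<alpha> b + \<beta> b) Basis"
          using that by (simp add: F_def p_def)
        then have "m y \<gamma> = m y \<alpha> * m y \<beta>"
          by (simp add: m_def power_add flip: prod.distrib)
        then show ?thesis
          by (simp add: q)
      qed
      then show ?thesis
        by (simp add: c_def sum_distrib_left)
    qed
    show ?thesis
      unfolding real_scaleR_def
      by (rule has_sum_Sigma'[OF S]) (auto simp: fibre finF intro!: has_sum_finiteI)
  qed
  then show "\<exists>r>0. \<exists>a. \<forall>y\<in>ball x r.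
      ((\<lambda>\<alpha>. (\<Prod>b\<in>Basis. ((y - x) \<bullet> b) ^ \<alpha> b) *\<^sub>R a \<alpha>) has_sum f y * g y) ?E"
    unfolding m_def[symmetric] using r r'
    by (intro exI[of _ "min r r'"] conjI exI[of _ c]) auto
qed

text \<open>A power series in the coordinate \<open>b\<close> alone: only the multi-indices
  \<open>e n\<close>, with \<open>n\<close> at \<open>b\<close> and 0 elsewhere, carry coefficients.
  Expansions at every centre with infinite radius are required, which fits the identity, sine and
  cosine.\<close>

lemma real_analytic_on_power_series:
  fixes f :: "real \<Rightarrow> real"
  assumes b: "b \<in> Basis"
    and c: "\<And>x h. ((\<lambda>n. c x n * h ^ n) has_sum f (x + h)) UNIV"
  shows "real_analytic_on (\<lambda>x. f (x \<bullet> b)) U"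
  unfolding real_analytic_on_def
proof (intro ballI)
  fix x assume "x \<in> U"
  let ?E = "Basis \<rightarrow>\<^sub>E UNIV :: ('a \<Rightarrow> nat) set"
  define e where "e n = restrict (\<lambda>d. if d = b then n else 0) Basis" for n :: nat
  define a where "a \<alpha> = (if \<alpha> \<in> range e then c (x \<bullet> b) (\<alpha> b) else 0)" for \<alpha>
  have eb: "e n b = n" for n
    using b by (simp add: e_def)
  have "((\<lambda>\<alpha>. (\<Prod>d\<in>Basis. ((y - x) \<bullet> d) ^ \<alpha> d) *\<^sub>R a \<alpha>) has_sum f (y \<bullet> b)) ?E" for y
  proof -
    have "inj e"
      by (metis eb injI)
    have "(\<Prod>d\<in>Basis. ((y - x) \<bullet> d) ^ e n d) = ((y - x) \<bullet> b) ^ n" for n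
    proof -
      have "(\<Prod>d\<in>Basis. ((y - x) \<bullet> d) ^ e n d) = (\<Prod>d\<in>Basis. if d = b then ((y - x) \<bullet> d) ^ n else 1)"
        by (rule prod.cong) (auto simp: e_def)
      then show ?thesis
        using b by (simp add: prod.delta)
    qed
    then have "((\<lambda>\<alpha>. (\<Prod>d\<in>Basis. ((y - x) \<bullet> d) ^ \<alpha> d) *\<^sub>R a \<alpha>) has_sum f (y \<bullet> b)) (range e)"
      using c[of "x \<bullet> b" "(y - x) \<bullet> b"]
      by (simp add: has_sum_reindex[OF \<open>inj e\<close>] o_def a_def eb inner_diff_left mult.commute)
    then show ?thesis
      by (subst has_sum_cong_neutral[where T = "range e"]) (auto simp: a_def e_def)
  qed
  then show "\<exists>r>0. \<exists>a. \<forall>y\<in>ball x r.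
      ((\<lambda>\<alpha>. (\<Prod>d\<in>Basis. ((y - x) \<bullet> d) ^ \<alpha> d) *\<^sub>R a \<alpha>) has_sum f (y \<bullet> b)) ?E"
    by (intro exI[of _ 1] conjI exI[of _ a]) auto
qed

lemma real_analytic_on_inner:
  assumes "b \<in> Basis"
  shows "real_analytic_on (\<lambda>x. x \<bullet> b) U"
proof (rule real_analytic_on_power_series[where f = "\<lambda>x. x", OF assms])
  fix x h :: real
  have "((\<lambda>n. (if n = 0 then x else if n = 1 then 1 else 0) * h ^ n) has_sum x + h) {0, 1}"
    by (auto intro: has_sum_finiteI)
  then show "((\<lambda>n. (if n = 0 then x else if n = 1 then 1 else 0) * h ^ n) has_sum x + h) UNIV"
    by (subst has_sum_cong_neutral[where T = "{0, 1}"]) auto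
qed

lemma has_sum_sin_cos:
  fixes h :: real
  shows "((\<lambda>n. sin_coeff n * h ^ n) has_sum sin h) UNIV"
    and "((\<lambda>n. cos_coeff n * h ^ n) has_sum cos h) UNIV"
  using norm_summable_imp_has_sum[OF summable_norm_sin sin_converges[of h]]
    norm_summable_imp_has_sum[OF summable_norm_cos cos_converges[of h]] by simp_all

text \<open>The addition theorems move the expansions at 0 to any centre.\<close>

lemma real_analytic_on_sin_cos:
  assumes "b \<in> Basis"
  shows "real_analytic_on (\<lambda>x. sin (x \<bullet> b)) U" "real_analytic_on (\<lambda>x. cos (x \<bullet> b)) U"
proof -
  have "((\<lambda>n. (sin x * cos_coeff n + cos x * sin_coeff n) * h ^ n) has_sum sin (x + h)) UNIV" for x h
    unfolding sin_add ring_distribs mult.assoc by (intro has_sum_add has_sum_cmult_right has_sum_sin_cos)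
  then show "real_analytic_on (\<lambda>x. sin (x \<bullet> b)) U"
    by (rule real_analytic_on_power_series[OF assms])
  have "((\<lambda>n. (cos x * cos_coeff n + (- sin x) * sin_coeff n) * h ^ n) has_sum cos x * cos h + (- sin x) * sin h) UNIV" for x h
    unfolding ring_distribs(2) mult.assoc by (intro has_sum_add has_sum_cmult_right has_sum_sin_cos)
  then have "((\<lambda>n. (cos x * cos_coeff n + (- sin x) * sin_coeff n) * h ^ n) has_sum cos (x + h)) UNIV" for x h
    unfolding cos_add by simp
  then show "real_analytic_on (\<lambda>x. cos (x \<bullet> b)) U"
    by (rule real_analytic_on_power_series[OF assms])
qed

lemma real_analytic_on_power:
  fixes f :: "'a::euclidean_space \<Rightarrow> real"
  shows "real_analytic_on f U \<Longrightarrow> real_analytic_on (\<lambda>x. f x ^ n) U"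
  by (induction n) (auto intro: real_analytic_on_const real_analytic_on_mult)

lemma real_analytic_on_diff:
  fixes f g :: "'a::euclidean_space \<Rightarrow> real"
  assumes "real_analytic_on f U" "real_analytic_on g U"
  shows "real_analytic_on (\<lambda>x. f x - g x) U"
  using real_analytic_on_add[OF assms(1) real_analytic_on_mult[OF real_analytic_on_const[of "-1"] assms(2)]]
  by simp

lemma real_analytic_on_sum:
  fixes f :: "'i \<Rightarrow> 'a::euclidean_space \<Rightarrow> real"
  shows "(\<And>i. i \<in> I \<Longrightarrow> real_analytic_on (f i) U) \<Longrightarrow> real_analytic_on (\<lambda>x. \<Sum>i\<in>I. f i x) U"
  by (induction I rule: infinite_finite_induct) (auto intro: real_analytic_on_const real_analytic_on_add)

section \<open>A strictly increasing function with critical points accumulating at both ends\<close>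

text \<open>The derivative in \<open>t\<close> is \<open>3 * (t - x)\<^sup>2 + (1 - cos x)\<close>,
  which vanishes only for \<open>t = x\<close> with \<open>cos x = 1\<close>. The term
  \<open>sin x / 2\<close> keeps the derivative in \<open>x\<close> away from 0 even there, so that
  the zero set is a graph over \<open>t\<close>.\<close>

definition wig :: "real \<Rightarrow> real \<Rightarrow> real" where
  "wig x t = (t - x) ^ 3 + (1 - cos x) * (t - x) - sin x / 2"

text \<open>Written with the sine and cosine of \<open>x / 2\<close>, the left side minus 1/2 is a
  sum of squares.\<close>

lemma wig_deriv_neg:
  "3 * u\<^sup>2 + (1 - cos x) - u * sin x + cos x / 2 \<ge> (1/2 :: real)"
proof -
  define s c where "s = sin (x / 2)" and "c = cos (x / 2)"
  have "c\<^sup>2 = 1 - s\<^sup>2"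
    using sin_cos_squared_add[of "x/2"] unfolding s_def c_def by linarith
  moreover have "cos x = 1 - 2 * s\<^sup>2"
    using cos_double_sin[of "x/2"] by (simp add: s_def)
  moreover have "sin x = 2 * s * c"
    using sin_double[of "x/2"] by (simp add: s_def c_def)
  moreover have "(u - s * c)\<^sup>2 = u\<^sup>2 - 2 * u * s * c + s\<^sup>2 * c\<^sup>2"
    by (simp add: power2_eq_square algebra_simps)
  moreover have "s\<^sup>2 * c\<^sup>2 = s\<^sup>2 - (s\<^sup>2)\<^sup>2"
    by (simp only: \<open>c\<^sup>2 = 1 - s\<^sup>2\<close> right_diff_distrib power2_eq_square[of "s\<^sup>2"] mult_1_right)
  ultimately have "3 * u\<^sup>2 + (1 - cos x) - u * sin x + cos x / 2 - 1/2 = 2 * u\<^sup>2 + (u - s * c)\<^sup>2 + (s\<^sup>2)\<^sup>2"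
    by (simp add: algebra_simps)
  then show ?thesis
    by (smt (verit) zero_le_power2)
qed

lemma wig_has_derivative:
  "((\<lambda>x. wig x t) has_real_derivative
     - (3 * (t - x)\<^sup>2 + (1 - cos x) - (t - x) * sin x + cos x / 2)) (at x)"
  unfolding wig_def by (rule derivative_eq_intros refl | simp add: field_simps)+

text \<open>The uniform rate 1/2 of decrease gives uniqueness of the root in \<open>x\<close> and,
  by linear growth, its existence.\<close>

lemma wig_decreases:
  assumes "x \<le> y"
  shows "wig y t + (y - x) / 2 \<le> wig x t"
proof (cases "x = y")
  case False
  then obtain z where "wig y t - wig x t =
      (y - x) * - (3 * (t - z)\<^sup>2 + (1 - cos z) - (t - z) * sin z + cos z / 2)"
    using MVT2[OF _ wig_has_derivative, of x y t] assms by force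
  moreover have "(y - x) * (3 * (t - z)\<^sup>2 + (1 - cos z) - (t - z) * sin z + cos z / 2) \<ge> (y - x) * (1 / 2)"
    using assms wig_deriv_neg by (intro mult_left_mono) auto
  ultimately show ?thesis by (simp only: mult_minus_right times_divide_eq_right mult_1_right)
qed simp

lemma power_less_cube: "a < b \<Longrightarrow> a ^ 3 < (b::real) ^ 3"
proof -
  assume "a < b"
  then have "0 < (b - a) * ((a + b)\<^sup>2 + a\<^sup>2 + b\<^sup>2)"
    by (intro mult_pos_pos) (auto simp: add_nonneg_eq_0_iff sum_power2_gt_zero_iff add_nonneg_pos add.assoc)
  also have "\<dots> = 2 * (b ^ 3 - a ^ 3)"
    by (simp add: power2_eq_square power3_eq_cube algebra_simps)
  finally show ?thesis by simp
qed

lemma wig_strict_mono: "s < t \<Longrightarrow> wig x s < wig x t"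
proof -
  assume "s < t"
  then have "(s - x) ^ 3 < (t - x) ^ 3"
    by (intro power_less_cube) simp
  moreover have "(1 - cos x) * (s - x) \<le> (1 - cos x) * (t - x)"
    using \<open>s < t\<close> by (intro mult_left_mono) auto
  ultimately show ?thesis
    unfolding wig_def by linarith
qed

lemma isCont_wig: "isCont (\<lambda>x. wig x t) x" "isCont (wig x) t"
  unfolding wig_def by (intro continuous_intros; simp)+

lemma ex1_wig: "\<exists>!x. wig x t = 0"
proof (rule ex_ex1I)
  \<comment> \<open>At rate 1/2 or more, this distance from 0 suffices to reach a zero.\<close>
  define r where "r = 2 * \<bar>wig 0 t\<bar>"
  have "wig r t \<le> 0" "0 \<le> wig (- r) t"
    using wig_decreases[of 0 r t] wig_decreases[of "- r" 0 t] by (auto simp: r_def)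
  moreover have "- r \<le> r"
    by (simp add: r_def)
  ultimately show "\<exists>x. wig x t = 0"
    using IVT2[of "\<lambda>x. wig x t" r 0 "- r"] isCont_wig by blast
next
  show "x = y" if "wig x t = 0" "wig y t = 0" for x y
    using that wig_decreases[of x y t] wig_decreases[of y x t] by (cases x y rule: linorder_le_cases) auto
qed

definition warp :: "real \<Rightarrow> real" where
  "warp t = (THE x. wig x t = 0)"

lemma wig_eq_0_iff: "wig x t = 0 \<longleftrightarrow> x = warp t"
  unfolding warp_def using ex1_wig[of t] theI'[OF ex1_wig[of t]] by auto

text \<open>As \<open>wig\<close> decreases in \<open>x\<close> through its root
  \<open>warp t\<close>, bounds on the implicit function become inequalities for the explicit one.
  Monotonicity and continuity of \<open>warp\<close> then follow from those of \<open>wig\<close> in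
  \<open>t\<close>.\<close>

lemma less_warp_iff: "x < warp t \<longleftrightarrow> 0 < wig x t"
proof -
  have z: "wig (warp t) t = 0"
    by (simp add: wig_eq_0_iff)
  show ?thesis
  proof (cases "x < warp t")
    case True
    then show ?thesis
      using wig_decreases[of x "warp t" t] z by simp
  next
    case False
    then have "(x - warp t) / 2 \<ge> 0" "wig x t + (x - warp t) / 2 \<le> 0"
      using wig_decreases[of "warp t" x t] z by auto
    then show ?thesis
      using False by linarith
  qed
qed

lemma warp_less_iff: "warp t < x \<longleftrightarrow> wig x t < 0"
  using less_warp_iff[of x t] wig_eq_0_iff[of x t] by fastforce

lemma strict_mono_warp: "strict_mono warp"
proof (rule strict_monoI)
  fix s t :: real assume "s < t"
  then show "warp s < warp t"
    using wig_strict_mono[of s t "warp s"] wig_eq_0_iff[of "warp s" s] by (simp add: less_warp_iff)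
qed

lemma isCont_warp: "isCont warp t"
  unfolding isCont_def order_tendsto_iff
proof (intro conjI allI impI)
  fix a assume "a < warp t"
  then have "\<forall>\<^sub>F s in at t. 0 < wig a s"
    using isCont_wig(2)[where x = a and t = t] unfolding isCont_def order_tendsto_iff by (simp add: less_warp_iff)
  then show "\<forall>\<^sub>F s in at t. a < warp s"
    by (simp add: less_warp_iff)
next
  fix a assume "warp t < a"
  then have "\<forall>\<^sub>F s in at t. wig a s < 0"
    using isCont_wig(2)[where x = a and t = t] unfolding isCont_def order_tendsto_iff by (simp add: warp_less_iff)
  then show "\<forall>\<^sub>F s in at t. warp s < a"
    by (simp add: warp_less_iff)
qed

lemma warp_minus: "warp (- t) = - warp t"
proof -
  have "wig (- warp t) (- t) = - wig (warp t) t"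
    by (simp add: wig_def power3_eq_cube algebra_simps)
  then show ?thesis
    by (metis wig_eq_0_iff minus_zero)
qed

lemma warp_2pi: "warp (2 * pi * of_int n) = 2 * pi * of_int n"
proof -
  have "wig (2 * pi * of_int n) (2 * pi * of_int n) = 0"
    using sin_int_2pin[of n] by (simp add: wig_def)
  then show ?thesis
    by (simp add: wig_eq_0_iff)
qed

text \<open>The quantity on the left is the derivative of \<^term>\<open>wig\<close> in its second argument, which is
  the numerator of the derivative of \<^const>\<open>warp\<close>.\<close>

lemma warp_critical_iff:
  "3 * (t - warp t)\<^sup>2 + (1 - cos (warp t)) = 0 \<longleftrightarrow> (\<exists>n. t = 2 * pi * of_int n)"
proof
  assume "3 * (t - warp t)\<^sup>2 + (1 - cos (warp t)) = 0"
  then have "(t - warp t)\<^sup>2 = 0" "cos (warp t) = 1"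
    using cos_le_one[of "warp t"] zero_le_power2[of "t - warp t"] by (smt (verit))+
  then have "t = warp t" "cos t = 1"
    by auto
  then show "\<exists>n. t = 2 * pi * of_int n"
    by (metis cos_one_2pi_int mult.commute mult.assoc)
next
  assume "\<exists>n. t = 2 * pi * of_int n"
  then obtain n where t: "t = 2 * pi * of_int n" by blast
  then show "3 * (t - warp t)\<^sup>2 + (1 - cos (warp t)) = 0"
    using cos_int_2pin[of n] by (simp add: warp_2pi)
qed

section \<open>A branched cover with star-shaped level structure\<close>

text \<open>The principal \<open>k\<close>-th root. It is used on the closed right half-plane only,
  where it is continuous, also at 0.\<close>

definition half_root :: "nat \<Rightarrow> complex \<Rightarrow> complex" where
  "half_root k z = z powr (1 / of_nat k)"

lemma half_root_power: "k > 0 \<Longrightarrow> half_root k z ^ k = z"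
  unfolding half_root_def by (cases "z = 0") (auto simp: powr_def exp_of_nat_mult[symmetric])

lemma continuous_on_half_root:
  assumes "k > 0"
  shows "continuous_on {z. 0 \<le> Re z} (half_root k)"
proof -
  have "(half_root k \<longlongrightarrow> half_root k z) (at z within {z. 0 \<le> Re z})" if z: "0 \<le> Re z" for z
  proof (cases "z = 0")
    case True
    have "((\<lambda>w. w powr (1 / of_nat k)) \<longlongrightarrow> 0) (at 0 within {z. 0 \<le> Re z})"
      using assms by (intro tendsto_powr_complex_0[where b = "1 / of_nat k"]) (auto intro!: tendsto_intros)
    then show ?thesis
      using True unfolding half_root_def by simp
  next
    case False
    then have "z \<notin> \<real>\<^sub>\<le>\<^sub>0"
      using z by (auto simp: complex_nonpos_Reals_iff complex_eq_iff)
    then show ?thesis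
      unfolding half_root_def by (intro tendsto_intros) auto
  qed
  then show ?thesis
    by (simp add: continuous_on_def)
qed

locale branched =
  fixes i0 i1 :: "'m::finite" and k :: nat
  assumes i01: "i0 \<noteq> i1" and k: "2 \<le> k"
begin

definition cpx :: "real ^ 'm \<Rightarrow> complex" where
  "cpx w = Complex (w $ i0) (w $ i1)"

definition rest :: "real ^ 'm \<Rightarrow> real" where
  "rest w = (\<Sum>i\<in>UNIV - {i0, i1}. (w $ i)\<^sup>2)"

definition put :: "real ^ 'm \<Rightarrow> complex \<Rightarrow> real ^ 'm" where
  "put w z = (\<chi> i. if i = i0 then Re z else if i = i1 then Im z else w $ i)"

definition NN :: "real ^ 'm \<Rightarrow> real" where
  "NN w = 2 * Re (cpx w ^ k)"

definition BB :: "real ^ 'm \<Rightarrow> real" where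
  "BB w = 1 + rest w + ((w $ i0)\<^sup>2 + (w $ i1)\<^sup>2) ^ k"

text \<open>In the coordinates in which \<open>cpx w\<close> is replaced by its \<open>k\<close>-th power, \<open>mu\<close> is the height function of the
  unit sphere seen through stereographic projection.\<close>

definition mu :: "real ^ 'm \<Rightarrow> real" where
  "mu w = NN w / BB w"

lemma cpx_put [simp]: "cpx (put w z) = z"
  using i01 by (simp add: cpx_def put_def complex_eq_iff)

lemma rest_put [simp]: "rest (put w z) = rest w"
  unfolding rest_def put_def by (intro sum.cong) auto

lemma put_put [simp]: "put (put w z) y = put w y"
  unfolding put_def by (simp add: vec_eq_iff)

lemma put_cpx [simp]: "put w (cpx w) = w"
  unfolding put_def cpx_def by (simp add: vec_eq_iff)

lemma rest_0: "rest 0 = 0"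
  by (simp add: rest_def)

lemma rest_nonneg: "0 \<le> rest w"
  unfolding rest_def by (intro sum_nonneg) auto

lemma norm_split: "(norm w)\<^sup>2 = rest w + (cmod (cpx w))\<^sup>2"
proof -
  have "(norm w)\<^sup>2 = (\<Sum>i\<in>UNIV. (w $ i)\<^sup>2)"
    by (simp add: norm_vec_def L2_set_def sum_nonneg)
  also have "\<dots> = rest w + (\<Sum>i\<in>{i0, i1}. (w $ i)\<^sup>2)"
    unfolding rest_def by (rule sum.subset_diff) auto
  finally show ?thesis
    using i01 by (simp add: cpx_def cmod_power2)
qed

lemma BB_eq: "BB w = 1 + rest w + (cmod (cpx w ^ k))\<^sup>2"
  by (simp add: BB_def cpx_def norm_power cmod_power2 flip: power_mult) (simp add: cmod_power2 power_mult mult.commute[of k])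

lemma BB_ge: "1 \<le> BB w"
  using rest_nonneg by (simp add: BB_eq)

text \<open>The gap as a sum of nonnegative terms: \<open>\<bar>mu w\<bar>\<close> is at most 1,
  with equality only where \<open>rest w = 0\<close> and \<open>cpx w ^ k\<close> is 1 or -1. These
  finitely many points are the outer ends of the lobes.\<close>

lemma BB_NN: "BB w - \<bar>NN w\<bar> = (1 - \<bar>Re (cpx w ^ k)\<bar>)\<^sup>2 + (Im (cpx w ^ k))\<^sup>2 + rest w"
  unfolding BB_eq NN_def cmod_power2 by (simp add: power2_eq_square algebra_simps abs_mult)

lemma NN_le_BB: "\<bar>NN w\<bar> \<le> BB w"
  using BB_NN[of w] rest_nonneg[of w] by (smt (verit) zero_le_power2)

lemma mu_eq_0_iff: "mu w = 0 \<longleftrightarrow> NN w = 0"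
  using BB_ge[of w] by (auto simp: mu_def)

lemma mu_less_1_iff: "\<bar>mu w\<bar> < 1 \<longleftrightarrow> \<bar>NN w\<bar> < BB w"
  using BB_ge[of w] by (simp add: mu_def abs_divide)

lemma continuous_on_cpx: "continuous_on A cpx"
  unfolding cpx_def[abs_def] complex_eq_iff by (intro continuous_on_Complex continuous_intros)

lemma continuous_on_put:
  assumes "continuous_on A f" "continuous_on A g"
  shows "continuous_on A (\<lambda>x. put (f x) (g x))"
  unfolding put_def
proof (rule continuous_on_vec_lambda)
  show "continuous_on A (\<lambda>x. if i = i0 then Re (g x) else if i = i1 then Im (g x) else f x $ i)" for i
    using assms by (cases "i = i0"; cases "i = i1") (auto intro!: continuous_intros)
qed

lemma continuous_on_NN: "continuous_on A NN"
  unfolding NN_def[abs_def] by (intro continuous_intros continuous_on_cpx)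

lemma continuous_on_BB: "continuous_on A BB"
  unfolding BB_def[abs_def] rest_def by (intro continuous_intros)

lemma continuous_on_mu: "continuous_on A mu"
  unfolding mu_def[abs_def] using BB_ge
  by (intro continuous_intros continuous_on_NN continuous_on_BB) (metis not_one_le_zero)

section \<open>The lobes and their level sets\<close>

definition dir :: "nat \<Rightarrow> complex" where
  "dir j = cis (pi * j / k)"

lemma dir_power: "dir j ^ k = (-1) ^ j"
proof -
  have "dir j ^ k = cis (real k * (pi * j / k))"
    unfolding dir_def by (rule Complex.DeMoivre)
  also have "real k * (pi * j / k) = real j * pi"
    using k by simp
  also have "cis (real j * pi) = cis pi ^ j"
    by (simp only: Complex.DeMoivre)
  finally show ?thesis
    by simp
qed

lemma dir_inj: "i < 2 * k \<Longrightarrow> j < 2 * k \<Longrightarrow> dir i = dir j \<Longrightarrow> i = j"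
proof -
  assume ij: "i < 2 * k" "j < 2 * k" "dir i = dir j"
  have "\<bar>real i - real j\<bar> < 2 * k"
    using ij(1,2) by auto
  then have "pi / k * \<bar>real i - real j\<bar> < pi / k * (2 * k)"
    using k by (intro mult_strict_left_mono) auto
  then have "\<bar>pi * i / k - pi * j / k\<bar> < 2 * pi"
    using k by (simp add: abs_mult[symmetric] right_diff_distrib flip: abs_divide) (simp add: abs_mult abs_divide right_diff_distrib[symmetric] diff_divide_distrib[symmetric])
  then have "pi * i / k = pi * j / k"
    using cis_eq_near ij(3) unfolding dir_def by blast
  then show "i = j"
    using k by simp
qed

lemma sign_cancel: "(-1) ^ j * ((-1) ^ j * z) = (z :: complex)"
  by (cases "even j") auto

text \<open>The closed sector around the \<open>2 * k\<close>-th root of unity \<open>dir j\<close>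
  in which the \<open>k\<close>-th power, up to the sign of \<open>j\<close>, has nonnegative real
  part. Describing it by the equation with \<open>half_root\<close> instead of by angles makes
  closedness a matter of continuity.\<close>

definition clobe :: "nat \<Rightarrow> (real ^ 'm) set" where
  "clobe j = {w. 0 \<le> Re ((-1) ^ j * cpx w ^ k) \<and> cpx w = dir j * half_root k ((-1) ^ j * cpx w ^ k)}"

lemma closed_clobe: "closed (clobe j)"
proof -
  let ?A = "{w. 0 \<le> Re ((-1) ^ j * cpx w ^ k)}"
  have A: "closed ?A"
    by (intro closed_Collect_le continuous_intros continuous_on_cpx)
  have "continuous_on ?A (\<lambda>w. cpx w - dir j * half_root k ((-1) ^ j * cpx w ^ k))"
    using k by (intro continuous_intros continuous_on_cpx continuous_on_compose2[OF continuous_on_half_root]) auto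
  from continuous_closed_preimage_constant[OF this A, of 0] show ?thesis
    unfolding clobe_def by simp
qed

lemma ex_clobe:
  assumes "NN w \<noteq> 0"
  shows "\<exists>j<2 * k. w \<in> clobe j"
proof -
  obtain e :: nat where e: "0 < Re ((-1) ^ e * cpx w ^ k)"
  proof (cases "0 < Re (cpx w ^ k)")
    case True
    then show thesis using that[of 0] by simp
  next
    case False
    then show thesis using that[of 1] assms by (simp add: NN_def)
  qed
  define h where "h = half_root k ((-1) ^ e * cpx w ^ k)"
  have hk: "h ^ k = (-1) ^ e * cpx w ^ k"
    unfolding h_def using k by (simp add: half_root_power)
  have "h \<noteq> 0"
  proof
    assume "h = 0"
    then have "h ^ k = 0"
      using k by (simp add: zero_power)
    then have "(-1) ^ e * cpx w ^ k = 0"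
      unfolding hk .
    then show False
      using e by (metis less_irrefl zero_complex.sel(1))
  qed
  \<comment> \<open>\<open>cpx w\<close> and \<open>h\<close> have the same \<open>k\<close>-th
    power up to sign, so \<open>q\<close> is a \<open>2 * k\<close>-th root of unity and thus some
    \<open>dir j\<close>.\<close>
  define q where "q = cpx w / h"
  have "cpx w ^ k = (-1) ^ e * h ^ k"
    unfolding hk by (rule sign_cancel[symmetric])
  then have qk: "q ^ k = (-1) ^ e"
    using \<open>h \<noteq> 0\<close> by (simp add: q_def power_divide)
  then have "q ^ (2 * k) = 1"
    unfolding mult.commute[of 2] power_mult qk by (cases "even e") auto
  then obtain j where j: "j < 2 * k" "q = exp (2 * of_real pi * \<i> * of_nat j / of_nat (2 * k))"
    using complex_roots_unity[of "2 * k"] k by auto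
  then have "q = dir j"
    unfolding dir_def cis_conv_exp by (simp add: field_simps)
  then have "(-1 :: complex) ^ j = (-1) ^ e"
    using dir_power[of j] qk by simp
  moreover have "cpx w = dir j * h"
    using \<open>q = dir j\<close> \<open>h \<noteq> 0\<close> by (simp add: q_def field_simps)
  ultimately have "w \<in> clobe j"
    unfolding clobe_def using e by (simp add: h_def)
  then show ?thesis
    using j(1) by blast
qed

lemma clobe_sign:
  assumes "w \<in> clobe j"
  shows "NN w = (-1) ^ j * \<bar>NN w\<bar>"
  using assms unfolding clobe_def NN_def by (cases "even j") auto

lemma clobe_unique:
  assumes "NN w \<noteq> 0" "i < 2 * k" "j < 2 * k" "w \<in> clobe i" "w \<in> clobe j"
  shows "i = j"
proof -
  have s: "(-1 :: complex) ^ i = (-1) ^ j"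
    using clobe_sign[OF assms(4)] clobe_sign[OF assms(5)] assms(1) by (cases "even i"; cases "even j") auto
  define h where "h = half_root k ((-1) ^ i * cpx w ^ k)"
  have "dir i * h = dir j * h"
    using assms(4,5) unfolding clobe_def h_def s by simp
  moreover have "h ^ k \<noteq> 0"
    unfolding h_def using k assms(1) by (auto simp: half_root_power NN_def)
  then have "h \<noteq> 0"
    using k by auto
  ultimately have "dir i = dir j"
    by simp
  then show ?thesis
    using dir_inj assms(2,3) by blast
qed

text \<open>All closed lobes meet over 0, so no index is distinguished there; the value 0 on the
  zero level fits the convention \<open>lab_0\<close> of \<open>star_labelling\<close>.\<close>

definition lobe :: "real ^ 'm \<Rightarrow> nat" where
  "lobe w = (if NN w = 0 then 0 else (THE j. j < 2 * k \<and> w \<in> clobe j))"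

lemma lobe: "NN w \<noteq> 0 \<Longrightarrow> lobe w < 2 * k \<and> w \<in> clobe (lobe w)"
proof -
  assume "NN w \<noteq> 0"
  then have "\<exists>!j. j < 2 * k \<and> w \<in> clobe j"
    using ex_clobe clobe_unique by blast
  from theI'[OF this] \<open>NN w \<noteq> 0\<close> show ?thesis
    by (simp add: lobe_def)
qed

lemma lobe_eqI: "NN w \<noteq> 0 \<Longrightarrow> j < 2 * k \<Longrightarrow> w \<in> clobe j \<Longrightarrow> lobe w = j"
  using lobe clobe_unique by blast

text \<open>Off the zero level the closed lobes are disjoint and cover everything, so each is the
  complement of the finitely many others.\<close>

lemma open_lobe:
  assumes "j < 2 * k"
  shows "open {w. NN w \<noteq> 0 \<and> lobe w = j}"
proof -
  have "{w. NN w \<noteq> 0 \<and> lobe w = j} = {w. NN w \<noteq> 0} - (\<Union>i\<in>{..<2 * k} - {j}. clobe i)"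
    using lobe lobe_eqI by blast
  moreover have "open {w. NN w \<noteq> 0}"
    by (intro open_Collect_neq continuous_on_NN continuous_on_const)
  moreover have "closed (\<Union>i\<in>{..<2 * k} - {j}. clobe i)"
    by (rule closed_UN) (auto simp: closed_clobe)
  ultimately show ?thesis
    by (simp add: open_Diff)
qed

lemma mu_lobe: "mu w = (-1) ^ lobe w * \<bar>mu w\<bar>"
proof (cases "NN w = 0")
  case False
  then show ?thesis
    using clobe_sign[of w "lobe w"] lobe[OF False] BB_ge[of w] by (simp add: mu_def abs_divide)
qed (simp add: mu_def)

text \<open>Taking the \<open>k\<close>-th power of the complex coordinate turns the level set in
  one lobe into the round sphere \<open>r * (1 + (norm v)\<^sup>2) = 2 * v $ i0\<close>. This sphere
  lies in the half-space of positive \<open>v $ i0\<close>, where \<open>half_root\<close> lifts it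
  back continuously, and it is connected as the dimension is at least 2.\<close>

lemma connected_level:
  assumes j: "j < 2 * k" and r: "0 < r" "r < 1"
  shows "connected {w. lobe w = j \<and> \<bar>mu w\<bar> = r}"
proof -
  \<comment> \<open>Completing the square in the equation of the sphere gives this centre and the
    radius in \<open>?S\<close>.\<close>
  define a :: "real ^ 'm" where "a = (1 / r) *\<^sub>R axis i0 1"
  let ?S = "sphere a (sqrt (1 / r\<^sup>2 - 1))"
  define f where "f v = put v (dir j * half_root k (cpx v))" for v
  have r2: "r\<^sup>2 < 1"
    using r by (simp add: power_less_one_iff abs_square_less_1)
  then have pos: "0 \<le> 1 / r\<^sup>2 - 1"
    using r by (simp add: field_simps)
  have S: "v \<in> ?S \<longleftrightarrow> r * (1 + (norm v)\<^sup>2) = 2 * v $ i0" for v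
  proof -
    have "v \<in> ?S \<longleftrightarrow> sqrt ((norm (v - a))\<^sup>2) = sqrt (1 / r\<^sup>2 - 1)"
      by (simp add: dist_norm norm_minus_commute)
    then have "v \<in> ?S \<longleftrightarrow> (norm (v - a))\<^sup>2 = 1 / r\<^sup>2 - 1"
      by (simp only: real_sqrt_eq_iff)
    moreover have "(norm (v - a))\<^sup>2 = (norm v)\<^sup>2 - 2 * (v \<bullet> a) + (norm a)\<^sup>2"
      by (simp add: power2_norm_eq_inner inner_diff_left inner_diff_right inner_commute)
    moreover have "v \<bullet> a = v $ i0 / r"
      by (simp add: a_def inner_axis)
    moreover have "(norm a)\<^sup>2 = 1 / r\<^sup>2"
      by (simp add: a_def norm_axis_1 power_divide)
    ultimately have "v \<in> ?S \<longleftrightarrow> (norm v)\<^sup>2 - 2 * (v $ i0 / r) + 1 / r\<^sup>2 = 1 / r\<^sup>2 - 1"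
      by (simp only:)
    also have "\<dots> \<longleftrightarrow> 1 + (norm v)\<^sup>2 = 2 * v $ i0 / r"
      by auto
    also have "\<dots> \<longleftrightarrow> r * (1 + (norm v)\<^sup>2) = 2 * v $ i0"
      using r by (simp add: field_simps)
    finally show ?thesis .
  qed
  have im: "f ` ?S = {w. lobe w = j \<and> \<bar>mu w\<bar> = r}"
  proof (intro equalityI subsetI)
    fix w assume "w \<in> f ` ?S"
    then obtain v where v: "r * (1 + (norm v)\<^sup>2) = 2 * v $ i0" "w = f v"
      using S by blast
    have Re: "Re (cpx v) = v $ i0"
      by (simp add: cpx_def)
    have "0 < r * (1 + (norm v)\<^sup>2)"
      using r(1) by (intro mult_pos_pos add_pos_nonneg) auto
    then have p: "0 < v $ i0"
      using v(1) by simp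
    have ck: "cpx w ^ k = (-1) ^ j * cpx v"
      unfolding v(2) f_def using k by (simp add: power_mult_distrib dir_power half_root_power)
    then have ck': "(-1) ^ j * cpx w ^ k = cpx v"
      by (simp add: sign_cancel)
    have "w \<in> clobe j"
      unfolding clobe_def mem_Collect_eq ck' using p Re by (simp add: v(2) f_def)
    moreover have N: "\<bar>NN w\<bar> = 2 * v $ i0"
      unfolding NN_def ck using p Re by (cases "even j") (auto simp: abs_mult)
    moreover have "BB w = 1 + (norm v)\<^sup>2"
      unfolding BB_eq ck norm_split by (simp add: v(2) f_def norm_mult norm_power)
    ultimately show "w \<in> {w. lobe w = j \<and> \<bar>mu w\<bar> = r}"
      using lobe_eqI[of w j] j p v(1) r by (auto simp: mu_def abs_divide field_simps add_nonneg_eq_0_iff)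
  next
    fix w assume w: "w \<in> {w. lobe w = j \<and> \<bar>mu w\<bar> = r}"
    then have "NN w \<noteq> 0"
      using r mu_eq_0_iff by force
    then have cl: "w \<in> clobe j"
      using lobe w by blast
    define v where "v = put w ((-1) ^ j * cpx w ^ k)"
    have cv: "cpx v = (-1) ^ j * cpx w ^ k"
      by (simp add: v_def)
    have "f v = put w (dir j * half_root k ((-1) ^ j * cpx w ^ k))"
      unfolding f_def cv by (simp add: v_def)
    also have "\<dots> = w"
      using cl unfolding clobe_def by (metis (mono_tags, lifting) mem_Collect_eq put_cpx)
    finally have fv: "f v = w" .
    have "BB w = 1 + (norm v)\<^sup>2"
      unfolding BB_eq norm_split cv by (simp add: v_def norm_mult norm_power)
    moreover have "\<bar>NN w\<bar> = 2 * v $ i0"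
      using cl unfolding clobe_def NN_def cv[symmetric]
      by (cases "even j") (use cv in \<open>auto simp: cpx_def complex_eq_iff\<close>)
    ultimately have "v \<in> ?S"
      using w BB_ge[of w] unfolding S by (auto simp: mu_def abs_divide field_simps)
    then show "w \<in> f ` ?S"
      using fv by blast
  qed
  have "continuous_on ?S f"
    unfolding f_def
  proof (intro continuous_on_put continuous_intros continuous_on_compose2[OF continuous_on_half_root] continuous_on_cpx)
    have "0 \<le> v $ i0" if "v \<in> ?S" for v
    proof -
      have "0 \<le> r * (1 + (norm v)\<^sup>2)" using r by simp
      then show ?thesis using that S by simp
    qed
    then show "cpx ` ?S \<subseteq> {z. 0 \<le> Re z}"
      by (auto simp: cpx_def)
  qed (use k in auto)
  moreover have "connected ?S"
  proof (rule connected_sphere)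
    have "card {i0, i1} \<le> CARD('m)"
      by (intro card_mono) auto
    then show "2 \<le> DIM(real ^ 'm)"
      using i01 by simp
  qed
  ultimately show ?thesis
    unfolding im[symmetric] by (rule connected_continuous_image)
qed

text \<open>\<open>NN\<close> is homogeneous of degree \<open>k\<close> under real scaling, so its
  zero set is a cone.\<close>

lemma connected_zero_level: "connected {w. mu w = 0}"
proof (rule starlike_imp_connected)
  have scale: "cpx (u *\<^sub>R w) = of_real u * cpx w" for u w
    by (simp add: cpx_def complex_eq_iff)
  have "NN (u *\<^sub>R w) = u ^ k * NN w" for u w
    unfolding NN_def scale power_mult_distrib by (simp flip: of_real_power)
  then have "mu (u *\<^sub>R w) = 0" if "mu w = 0" for u w
    using that mu_eq_0_iff by simp
  moreover have "mu 0 = 0"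
    using k by (simp add: mu_def NN_def cpx_def Complex_eq_0)
  ultimately show "starlike {w. mu w = 0}"
    unfolding starlike_def by (intro bexI[of _ 0]) (auto simp: closed_segment_def)
qed

text \<open>The solution \<open>q\<close> in \<open>[0, 1]\<close> of \<open>2 * q / (1 + q\<^sup>2) = r\<close>.\<close>

definition lift :: "real \<Rightarrow> real" where
  "lift r = r / (1 + sqrt (1 - r\<^sup>2))"

text \<open>A path along the axis of the \<open>j\<close>-th lobe, parametrised so that
  \<open>\<bar>mu\<bar>\<close> has the value \<open>r\<close> at \<open>r\<close>.\<close>

definition ray :: "nat \<Rightarrow> real \<Rightarrow> real ^ 'm" where
  "ray j r = put 0 (dir j * half_root k (of_real (lift r)))"

lemma lift:
  assumes "0 \<le> r" "r \<le> 1"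
  shows "0 \<le> lift r" "2 * lift r / (1 + (lift r)\<^sup>2) = r"
proof -
  define s where "s = sqrt (1 - r\<^sup>2)"
  have s: "0 \<le> s" "s\<^sup>2 = 1 - r\<^sup>2"
    using assms by (auto simp: s_def power_le_one_iff abs_square_le_1)
  show "0 \<le> lift r"
    using assms s unfolding lift_def s_def[symmetric] by simp
  have "1 + (lift r)\<^sup>2 = ((1 + s)\<^sup>2 + r\<^sup>2) / (1 + s)\<^sup>2"
    using s(1) unfolding lift_def s_def[symmetric] by (simp add: power_divide add_divide_distrib)
  also have "(1 + s)\<^sup>2 + r\<^sup>2 = 2 * (1 + s)"
    using s(2) by (simp add: power2_eq_square algebra_simps)
  also have "2 * (1 + s) / (1 + s)\<^sup>2 = 2 / (1 + s)"
    unfolding power2_eq_square using s(1) by (intro nonzero_mult_divide_mult_cancel_right) simp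
  finally show "2 * lift r / (1 + (lift r)\<^sup>2) = r"
    using s(1) unfolding lift_def s_def[symmetric] by simp
qed

lemma ray:
  assumes "0 \<le> r" "r \<le> 1"
  shows "ray j r \<in> clobe j" "\<bar>mu (ray j r)\<bar> = r"
proof -
  have c: "cpx (ray j r) ^ k = (-1) ^ j * of_real (lift r)"
    unfolding ray_def using k by (simp add: power_mult_distrib dir_power half_root_power)
  then have c': "(-1) ^ j * cpx (ray j r) ^ k = of_real (lift r)"
    by (simp add: sign_cancel)
  show "ray j r \<in> clobe j"
    unfolding clobe_def mem_Collect_eq c' using lift(1)[OF assms] by (simp add: ray_def)
  have "\<bar>NN (ray j r)\<bar> = 2 * lift r"
    unfolding NN_def c using lift(1)[OF assms] by (cases "even j") auto
  moreover have "BB (ray j r) = 1 + (lift r)\<^sup>2"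
    unfolding BB_eq c by (simp add: ray_def rest_0 norm_mult norm_power)
  ultimately show "\<bar>mu (ray j r)\<bar> = r"
    using lift(2)[OF assms] BB_ge[of "ray j r"] by (simp add: mu_def abs_divide)
qed

lemma lobe_ray: "0 < r \<Longrightarrow> r \<le> 1 \<Longrightarrow> j < 2 * k \<Longrightarrow> lobe (ray j r) = j"
  using ray[of r j] mu_eq_0_iff by (intro lobe_eqI) force+

lemma continuous_on_ray: "continuous_on {0..1} (ray j)"
  unfolding ray_def[abs_def]
proof (intro continuous_on_put continuous_intros continuous_on_compose2[OF continuous_on_half_root])
  have "0 \<le> sqrt (1 - r\<^sup>2)" if "r \<in> {0..1}" for r :: real
    using that by (simp add: power_le_one_iff abs_square_le_1)
  then have "1 + sqrt (1 - r\<^sup>2) \<noteq> 0" if "r \<in> {0..1}" for r :: real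
    using that by (smt (verit))
  then show "continuous_on {0..1} lift"
    unfolding lift_def[abs_def] by (intro continuous_intros) auto
qed (use k lift(1) in auto)

text \<open>\<open>mu\<close> tends to 0 at infinity: with \<open>m = cmod (cpx w ^ k)\<close>, the
  numerator is at most \<open>2 * m\<close>, while the denominator is
  \<open>1 + rest w + m\<^sup>2\<close>. So the inequality bounds first \<open>m\<close> and then
  \<open>rest w\<close>. Hence one point at infinity, placed at the central level, is
  enough.\<close>

lemma compact_mu_ge:
  assumes a: "0 < a"
  shows "compact {w. a \<le> \<bar>mu w\<bar>}"
proof -
  have "closed {w. a \<le> \<bar>mu w\<bar>}"
    by (intro closed_Collect_le continuous_intros continuous_on_mu)
  moreover have "norm w \<le> sqrt (4 / a\<^sup>2 + (1 + 2 / a)\<^sup>2)" if w: "a \<le> \<bar>mu w\<bar>" for w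
  proof -
    define m where "m = cmod (cpx w ^ k)"
    have m0: "0 \<le> m" by (simp add: m_def)
    have "a * BB w \<le> \<bar>NN w\<bar>"
      using w BB_ge[of w] by (simp add: mu_def abs_divide field_simps)
    also have "\<dots> \<le> 2 * m"
      using abs_Re_le_cmod[of "cpx w ^ k"] by (simp add: NN_def m_def abs_mult)
    finally have le: "a * (1 + rest w + m\<^sup>2) \<le> 2 * m"
      by (simp add: BB_eq m_def)
    have "m \<le> 2 / a"
    proof (cases "m = 0")
      case False
      have "0 \<le> a * (1 + rest w)"
        using a rest_nonneg[of w] by simp
      then have "a * m * m \<le> 2 * m"
        using le by (simp add: power2_eq_square algebra_simps)
      then show ?thesis
        using False m0 a by (simp add: field_simps)
    qed (use a in simp)
    have "0 \<le> a * (1 + m\<^sup>2)"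
      using a by simp
    then have "a * rest w \<le> 2 * m"
      using le by (simp add: algebra_simps)
    also have "\<dots> \<le> 2 * (2 / a)"
      using \<open>m \<le> 2 / a\<close> by simp
    finally have "rest w \<le> 4 / a\<^sup>2"
      using a by (simp add: field_simps power2_eq_square)
    moreover have "cmod (cpx w) \<le> 1 + 2 / a"
    proof (cases "cmod (cpx w) \<le> 1")
      case True
      then show ?thesis
        using a by (smt (verit) divide_pos_pos)
    next
      case False
      then have "cmod (cpx w) \<le> cmod (cpx w) ^ k"
        using k by (intro self_le_power) auto
      then show ?thesis
        using \<open>m \<le> 2 / a\<close> by (simp add: m_def norm_power)
    qed
    then have "(cmod (cpx w))\<^sup>2 \<le> (1 + 2 / a)\<^sup>2"
      by (intro power_mono) auto
    ultimately have "(norm w)\<^sup>2 \<le> 4 / a\<^sup>2 + (1 + 2 / a)\<^sup>2"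
      unfolding norm_split by linarith
    then show ?thesis
      by (rule real_le_rsqrt)
  qed
  then have "bounded {w. a \<le> \<bar>mu w\<bar>}"
    unfolding bounded_iff by blast
  ultimately show ?thesis
    by (simp add: compact_eq_bounded_closed)
qed

section \<open>The differential of the height function\<close>

definition NN' :: "real ^ 'm \<Rightarrow> real ^ 'm \<Rightarrow> real" where
  "NN' w h = 2 * Re (of_nat k * cpx w ^ (k - 1) * cpx h)"

definition BB' :: "real ^ 'm \<Rightarrow> real ^ 'm \<Rightarrow> real" where
  "BB' w h = 2 * (\<Sum>i\<in>UNIV - {i0, i1}. w $ i * h $ i) +
     k * ((w $ i0)\<^sup>2 + (w $ i1)\<^sup>2) ^ (k - 1) * (2 * (w $ i0 * h $ i0 + w $ i1 * h $ i1))"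

lemma bounded_linear_cpx: "bounded_linear cpx"
  by (rule linear_conv_bounded_linear[THEN iffD1])
     (auto simp: linear_iff cpx_def complex_eq_iff)

lemma NN_has_derivative: "(NN has_derivative NN' w) (at w)"
proof -
  have "(cpx has_derivative cpx) (at w)"
    by (rule bounded_linear_imp_has_derivative[OF bounded_linear_cpx])
  then have "((\<lambda>w. 2 * Re (cpx w ^ k)) has_derivative (\<lambda>h. 2 * Re (of_nat k * cpx h * cpx w ^ (k - 1)))) (at w)"
    by (auto intro!: derivative_eq_intros bounded_linear.has_derivative[OF bounded_linear_Re])
  then show ?thesis
    unfolding NN_def[abs_def] NN'_def[abs_def] by (simp only: mult.assoc mult.commute[of "cpx _" "cpx w ^ (k - 1)"])
qed

lemma BB_has_derivative: "(BB has_derivative BB' w) (at w)"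
  unfolding BB_def[abs_def] rest_def BB'_def[abs_def]
  by (auto intro!: derivative_eq_intros bounded_linear.has_derivative[OF bounded_linear_vec_nth] ext
      simp: sum_distrib_left algebra_simps)

text \<open>The expression is the numerator of the derivative of \<open>NN / BB = mu\<close> in the
  direction \<open>h\<close>.\<close>

lemma nondegenerate:
  assumes "mu w \<noteq> 0" "\<bar>mu w\<bar> < 1"
  obtains h where "BB w * NN' w h - NN w * BB' w h \<noteq> 0"
proof (cases "rest w = 0")
  case False
  \<comment> \<open>The direction of \<open>w\<close> with its complex coordinate deleted: along it
    \<open>BB\<close> changes to first order, but \<open>NN\<close> does not.\<close>
  let ?h = "put w 0"
  have "NN' w ?h = 0"
    by (simp add: NN'_def)
  moreover have "BB' w ?h = 2 * rest w"
    using i01 by (simp add: BB'_def rest_def put_def power2_eq_square)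
  ultimately show thesis
    using that[of ?h] False assms(1) mu_eq_0_iff by simp
next
  case True
  define z where "z = cpx w ^ k"
  \<comment> \<open>The directions used are \<open>cpx w * c\<close> with \<open>c = 1\<close>
    (radial) and \<open>c = \<i>\<close> (angular); the factor \<open>cpx w\<close> completes
    \<open>cpx w ^ (k - 1)\<close> to \<open>z\<close>.\<close>
  have zz: "of_nat k * cpx w ^ (k - 1) * (cpx w * c) = of_nat k * (z * c)" for c
    using k power_minus_mult[of k "cpx w"] by (simp add: z_def mult.assoc[symmetric])
  have N: "NN' w (put 0 (cpx w * c)) = 2 * k * Re (z * c)" for c
    by (simp only: NN'_def cpx_put zz) simp
  have "((w $ i0)\<^sup>2 + (w $ i1)\<^sup>2) ^ (k - 1) * ((w $ i0)\<^sup>2 + (w $ i1)\<^sup>2) = ((w $ i0)\<^sup>2 + (w $ i1)\<^sup>2) ^ k"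
    using k by (intro power_minus_mult) simp
  also have "\<dots> = (cmod z)\<^sup>2"
    using BB_eq[of w] BB_def[of w] by (simp add: z_def)
  finally have pz: "((w $ i0)\<^sup>2 + (w $ i1)\<^sup>2) ^ (k - 1) * ((w $ i0)\<^sup>2 + (w $ i1)\<^sup>2) = (cmod z)\<^sup>2" .
  have BI: "BB' w (put 0 (cpx w * \<i>)) = 0"
    using i01 by (simp add: BB'_def put_def cpx_def)
  have B1: "BB' w (put 0 (cpx w * 1)) = 2 * k * (cmod z)\<^sup>2"
  proof -
    define q where "q = (w $ i0)\<^sup>2 + (w $ i1)\<^sup>2"
    have "BB' w (put 0 (cpx w * 1)) = k * q ^ (k - 1) * (2 * q)"
      using i01 by (simp add: BB'_def put_def cpx_def q_def power2_eq_square)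
    also have "\<dots> = 2 * k * (q ^ (k - 1) * q)"
      by (simp add: algebra_simps)
    finally show ?thesis
      unfolding q_def pz .
  qed
  have BBz: "BB w = 1 + (cmod z)\<^sup>2" and NNz: "NN w = 2 * Re z"
    using True by (simp_all add: BB_eq NN_def z_def)
  show thesis
  proof (cases "Im z = 0")
    case False
    then show thesis
      using that[of "put 0 (cpx w * \<i>)"] N[of \<i>] BI BB_ge[of w] k by simp
  next
    \<comment> \<open>Now \<open>z\<close> is real, and the radial derivative vanishes only if
      \<open>Re z\<close> is 0, 1 or -1, that is, if \<open>mu w\<close> is 0, 1 or -1.\<close>
    case Im0: True
    then have cz: "(cmod z)\<^sup>2 = (Re z)\<^sup>2"
      by (simp add: cmod_power2)
    have "(Re z)\<^sup>2 \<noteq> 1"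
    proof
      assume "(Re z)\<^sup>2 = 1"
      then have "\<bar>Re z\<bar> = 1"
        by (simp add: power2_eq_1_iff) auto
      then show False
        using assms(2) mu_less_1_iff[of w] BBz NNz cz \<open>(Re z)\<^sup>2 = 1\<close> by simp
    qed
    moreover have "Re z \<noteq> 0"
      using assms(1) mu_eq_0_iff NNz by auto
    moreover have "BB w * NN' w (put 0 (cpx w * 1)) - NN w * BB' w (put 0 (cpx w * 1)) =
        2 * k * Re z * (1 - (Re z)\<^sup>2)"
      unfolding N[of 1] B1 BBz NNz cz by (simp add: algebra_simps)
    ultimately show thesis
      using that[of "put 0 (cpx w * 1)"] k by simp
  qed
qed

lemma NN_0: "NN 0 = 0"
proof -
  have "cpx 0 = 0"
    by (simp add: cpx_def complex_eq_iff)
  then show ?thesis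
    using k by (simp add: NN_def)
qed

section \<open>Analyticity of the numerator and the denominator\<close>

lemma analytic_coord: "real_analytic_on (\<lambda>p :: real \<times> (real ^ 'm). snd p $ i) UNIV"
proof -
  have "(0, axis i 1) \<in> (Basis :: (real \<times> (real ^ 'm)) set)"
    by (auto simp: Basis_prod_def Basis_vec_def)
  from real_analytic_on_inner[OF this] show ?thesis
    by (simp add: inner_axis inner_prod_def)
qed

lemma analytic_cpx_power:
  "real_analytic_on (\<lambda>p :: real \<times> (real ^ 'm). Re (cpx (snd p) ^ l)) UNIV \<and>
   real_analytic_on (\<lambda>p :: real \<times> (real ^ 'm). Im (cpx (snd p) ^ l)) UNIV"
proof (induction l)
  case (Suc l)
  have "Re (cpx w) = w $ i0" "Im (cpx w) = w $ i1" for w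
    by (simp_all add: cpx_def)
  then show ?case
    using Suc by (auto intro!: real_analytic_on_add real_analytic_on_diff real_analytic_on_mult analytic_coord)
qed (simp add: real_analytic_on_const)

lemma analytic_NN: "real_analytic_on (\<lambda>p :: real \<times> (real ^ 'm). NN (snd p)) UNIV"
  unfolding NN_def by (intro real_analytic_on_mult real_analytic_on_const conjunct1[OF analytic_cpx_power])

lemma analytic_BB: "real_analytic_on (\<lambda>p :: real \<times> (real ^ 'm). BB (snd p)) UNIV"
  unfolding BB_def rest_def
  by (intro real_analytic_on_add real_analytic_on_const real_analytic_on_sum real_analytic_on_power analytic_coord)

end

section \<open>The hypersurface\<close>

lemma has_derivative_square:
  fixes f :: "'a::real_normed_vector \<Rightarrow> real"
  assumes "(f has_derivative f') (at p)"
  shows "((\<lambda>p. (f p)\<^sup>2) has_derivative (\<lambda>v. 2 * f p * f' v)) (at p)"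
  by (rule has_derivative_eq_rhs[OF has_derivative_power[OF assms]]) (simp add: fun_eq_iff)

lemma has_derivative_cube:
  fixes f :: "'a::real_normed_vector \<Rightarrow> real"
  assumes "(f has_derivative f') (at p)"
  shows "((\<lambda>p. f p ^ 3) has_derivative (\<lambda>v. 3 * (f p)\<^sup>2 * f' v)) (at p)"
  by (rule has_derivative_eq_rhs[OF has_derivative_power[OF assms]]) (simp add: fun_eq_iff)

text \<open>The sign \<open>s\<close> selects the direction of the ends: towards both sides alternately for \<open>s = 0\<close>, to the side of
  \<open>s\<close> otherwise.\<close>

locale hypersurface = branched i0 i1 k for i0 i1 :: "'m::finite" and k :: nat +
  fixes s :: real
  assumes s: "s = 0 \<or> s = 1 \<or> s = -1"
begin

text \<open>\<open>PP / QQ\<close> is \<open>mu / (1 - mu\<^sup>2)\<close>, or \<open>s\<close>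
  times its square, expanded by a power of \<open>BB\<close> so that numerator and denominator are
  polynomials.\<close>

definition PP :: "real ^ 'm \<Rightarrow> real" where
  "PP w = (if s = 0 then NN w * BB w else s * (NN w * BB w)\<^sup>2)"

definition QQ :: "real ^ 'm \<Rightarrow> real" where
  "QQ w = (if s = 0 then (BB w)\<^sup>2 - (NN w)\<^sup>2 else ((BB w)\<^sup>2 - (NN w)\<^sup>2)\<^sup>2)"

definition Psi :: "real ^ 'm \<Rightarrow> real" where
  "Psi w = PP w / QQ w"

text \<open>This is \<open>wig (fst p) (PP / QQ)\<close> multiplied by \<open>QQ ^ 3\<close>. Where
  \<open>QQ\<close> vanishes it reduces to \<open>PP ^ 3\<close>, which is not 0 there.\<close>

definition eqn :: "real \<times> (real ^ 'm) \<Rightarrow> real" where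
  "eqn p = (PP (snd p) - fst p * QQ (snd p)) ^ 3
     + (1 - cos (fst p)) * (PP (snd p) - fst p * QQ (snd p)) * (QQ (snd p))\<^sup>2
     - sin (fst p) / 2 * QQ (snd p) ^ 3"

definition XX :: "(real \<times> (real ^ 'm)) set" where
  "XX = {p. eqn p = 0}"

definition pt :: "real ^ 'm \<Rightarrow> real \<times> (real ^ 'm)" where
  "pt w = (warp (Psi w), w)"

lemma QQ_pos: "\<bar>mu w\<bar> < 1 \<Longrightarrow> 0 < QQ w"
proof -
  assume "\<bar>mu w\<bar> < 1"
  then have "\<bar>NN w\<bar> < \<bar>BB w\<bar>"
    using mu_less_1_iff BB_ge[of w] by simp
  then have "(NN w)\<^sup>2 < (BB w)\<^sup>2"
    by (metis abs_le_square_iff linorder_not_le)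
  then show ?thesis
    by (simp add: QQ_def)
qed

lemma pole: "\<not> \<bar>mu w\<bar> < 1 \<Longrightarrow> QQ w = 0 \<and> PP w \<noteq> 0"
proof -
  assume "\<not> \<bar>mu w\<bar> < 1"
  then have eq: "\<bar>NN w\<bar> = BB w"
    using mu_less_1_iff NN_le_BB[of w] by (metis antisym_conv2)
  then have "(NN w)\<^sup>2 = (BB w)\<^sup>2"
    by (metis power2_abs)
  moreover have "NN w \<noteq> 0" "BB w \<noteq> 0"
    using eq BB_ge[of w] by auto
  ultimately show ?thesis
    using s by (auto simp: QQ_def PP_def)
qed

lemma eqn_wig: "QQ w \<noteq> 0 \<Longrightarrow> eqn (x, w) = QQ w ^ 3 * wig x (Psi w)"
proof -
  assume q: "QQ w \<noteq> 0"
  have "PP w - x * QQ w = QQ w * (Psi w - x)"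
    using q by (simp add: Psi_def field_simps)
  then show ?thesis
    by (simp add: eqn_def wig_def power_mult_distrib power2_eq_square power3_eq_cube algebra_simps)
qed

lemma XX_iff: "p \<in> XX \<longleftrightarrow> \<bar>mu (snd p)\<bar> < 1 \<and> p = pt (snd p)"
proof (cases "\<bar>mu (snd p)\<bar> < 1")
  case True
  then show ?thesis
    using QQ_pos[OF True] eqn_wig[of "snd p" "fst p"] wig_eq_0_iff[of "fst p" "Psi (snd p)"]
    by (cases p) (auto simp: XX_def pt_def)
next
  case False
  then show ?thesis
    using pole[OF False] by (simp add: XX_def eqn_def)
qed

lemma pt_in: "\<bar>mu w\<bar> < 1 \<Longrightarrow> pt w \<in> XX"
  by (simp add: XX_iff pt_def)

lemma snd_pt [simp]: "snd (pt w) = w" and fst_pt [simp]: "fst (pt w) = warp (Psi w)"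
  by (simp_all add: pt_def)

lemma continuous_on_PP: "continuous_on A PP"
  unfolding PP_def[abs_def] by (cases "s = 0") (auto intro!: continuous_intros continuous_on_NN continuous_on_BB)

lemma continuous_on_QQ: "continuous_on A QQ"
  unfolding QQ_def[abs_def] by (cases "s = 0") (auto intro!: continuous_intros continuous_on_NN continuous_on_BB)

lemma continuous_on_pt: "A \<subseteq> {w. \<bar>mu w\<bar> < 1} \<Longrightarrow> continuous_on A pt"
proof -
  assume "A \<subseteq> {w. \<bar>mu w\<bar> < 1}"
  then have "continuous_on A Psi"
    unfolding Psi_def[abs_def] using QQ_pos
    by (intro continuous_intros continuous_on_PP continuous_on_QQ) force
  moreover have "continuous_on UNIV warp"
    by (simp add: continuous_at_imp_continuous_on isCont_warp)
  ultimately have "continuous_on A (\<lambda>w. warp (Psi w))"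
    using continuous_on_compose2[of UNIV warp A Psi] by simp
  then show ?thesis
    unfolding pt_def[abs_def] by (intro continuous_on_Pair continuous_on_id)
qed

definition sgnj :: "nat \<Rightarrow> real" where
  "sgnj j = (if s = 0 then (-1) ^ j else s)"

text \<open>The modulus of \<open>Psi\<close> as a function of \<open>\<bar>mu\<bar>\<close>; its
  sign on the \<open>j\<close>-th lobe is \<open>sgnj j\<close>.\<close>

definition V :: "real \<Rightarrow> real" where
  "V r = (if s = 0 then r / (1 - r\<^sup>2) else (r / (1 - r\<^sup>2))\<^sup>2)"

lemma sgnj: "sgnj j = 1 \<or> sgnj j = -1"
  using s by (cases "even j") (auto simp: sgnj_def)

lemma Psi_eq:
  assumes "\<bar>mu w\<bar> < 1"
  shows "Psi w = sgnj (lobe w) * V \<bar>mu w\<bar>"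
proof -
  have B: "BB w > 0"
    using BB_ge[of w] by simp
  have N: "NN w = mu w * BB w"
    using B by (simp add: mu_def)
  have m: "1 - (mu w)\<^sup>2 \<noteq> 0"
    using assms by (simp add: abs_square_eq_1)
  have q: "NN w * BB w / ((BB w)\<^sup>2 - (NN w)\<^sup>2) = mu w / (1 - (mu w)\<^sup>2)"
  proof -
    have "NN w * BB w = (BB w)\<^sup>2 * mu w" "(BB w)\<^sup>2 - (NN w)\<^sup>2 = (BB w)\<^sup>2 * (1 - (mu w)\<^sup>2)"
      unfolding N by (simp_all add: power2_eq_square algebra_simps)
    then show ?thesis
      using B by simp
  qed
  show ?thesis
  proof (cases "s = 0")
    case True
    then have "Psi w = mu w / (1 - (mu w)\<^sup>2)"
      unfolding Psi_def PP_def QQ_def if_P[OF True] by (simp only: q)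
    also have "\<dots> = (-1) ^ lobe w * (\<bar>mu w\<bar> / (1 - \<bar>mu w\<bar>\<^sup>2))"
      by (subst mu_lobe) simp
    finally show ?thesis
      unfolding sgnj_def V_def if_P[OF True] .
  next
    case False
    then have "Psi w = s * (mu w / (1 - (mu w)\<^sup>2))\<^sup>2"
      unfolding q[symmetric] Psi_def PP_def QQ_def if_not_P[OF False] by (simp add: power_divide)
    then show ?thesis
      unfolding sgnj_def V_def if_not_P[OF False] by (simp add: power_divide)
  qed
qed

lemma V_0: "V 0 = 0"
  by (simp add: V_def)

lemma V_strict_mono:
  assumes "0 \<le> a" "a < b" "b < 1"
  shows "V a < V b"
proof -
  have "a\<^sup>2 < b\<^sup>2" "b\<^sup>2 < 1"
    using assms by (auto simp: power_strict_mono abs_square_less_1)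
  then have le: "a / (1 - a\<^sup>2) < b / (1 - b\<^sup>2)" "0 \<le> a / (1 - a\<^sup>2)"
    using assms by (auto intro!: frac_less divide_nonneg_pos)
  then show ?thesis
    by (auto simp: V_def intro!: power_strict_mono)
qed

lemma V_nonneg: "0 \<le> a \<Longrightarrow> a < 1 \<Longrightarrow> 0 \<le> V a"
  using V_strict_mono[of 0 a] V_0 by (cases "a = 0") auto

lemma V_surj:
  assumes "0 \<le> y"
  obtains r where "0 \<le> r" "r < 1" "V r = y"
proof -
  define t where "t = (if s = 0 then y else sqrt y)"
  have t: "0 \<le> t"
    using assms by (simp add: t_def)
  \<comment> \<open>The nonnegative root of \<open>t * r\<^sup>2 + r - t = 0\<close>, written so
    that \<open>t = 0\<close> is no exception.\<close>
  define r where "r = 2 * t / (1 + sqrt (1 + 4 * t\<^sup>2))"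
  define q where "q = sqrt (1 + 4 * t\<^sup>2)"
  have q: "q\<^sup>2 = 1 + 4 * t\<^sup>2" "1 \<le> q"
    using t by (auto simp: q_def)
  have "(2 * t)\<^sup>2 < (1 + q)\<^sup>2"
    using q by (simp add: power2_sum)
  then have "2 * t < 1 + q"
    by (rule power2_less_imp_less) (use q(2) in linarith)
  then have r: "0 \<le> r" "r < 1"
    unfolding r_def q_def[symmetric] using t q(2) by (simp_all add: divide_less_eq)
  have "t * (1 + q)\<^sup>2 - t * (2 * t)\<^sup>2 = t * (2 + 2 * q)"
    using q(1) by (simp add: power2_eq_square algebra_simps)
  moreover have nz: "1 + q \<noteq> 0"
    using q(2) by simp
  then have "t * (1 - r\<^sup>2) = (t * (1 + q)\<^sup>2 - t * (2 * t)\<^sup>2) / (1 + q)\<^sup>2"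
    unfolding r_def q_def[symmetric] power_divide by (simp add: diff_divide_distrib right_diff_distrib)
  ultimately have "t * (1 - r\<^sup>2) = (2 * t) * (1 + q) / ((1 + q) * (1 + q))"
    by (simp add: power2_eq_square distrib_left mult.left_commute)
  also have "\<dots> = r"
    unfolding r_def q_def[symmetric] using nz by (rule nonzero_mult_divide_mult_cancel_right)
  finally have "r = t * (1 - r\<^sup>2)" ..
  moreover have "1 - r\<^sup>2 \<noteq> 0"
    using r by (simp add: power2_eq_1_iff)
  ultimately have "r / (1 - r\<^sup>2) = t"
    by (simp add: nonzero_divide_eq_eq)
  then have "V r = y"
    using assms by (simp add: V_def t_def)
  then show thesis
    using r that by blast
qed

section \<open>Critical points of the first coordinate\<close>

definition PP' :: "real ^ 'm \<Rightarrow> real ^ 'm \<Rightarrow> real" where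
  "PP' w h = (if s = 0 then NN w * BB' w h + NN' w h * BB w
     else s * (2 * (NN w * BB w) * (NN w * BB' w h + NN' w h * BB w)))"

definition QQ' :: "real ^ 'm \<Rightarrow> real ^ 'm \<Rightarrow> real" where
  "QQ' w h = (if s = 0 then 2 * BB w * BB' w h - 2 * NN w * NN' w h
     else 2 * ((BB w)\<^sup>2 - (NN w)\<^sup>2) * (2 * BB w * BB' w h - 2 * NN w * NN' w h))"

lemma PP_has_derivative: "(PP has_derivative PP' w) (at w)"
proof -
  have prod: "((\<lambda>w. NN w * BB w) has_derivative (\<lambda>h. NN w * BB' w h + NN' w h * BB w)) (at w)"
    by (rule has_derivative_mult[OF NN_has_derivative BB_has_derivative])
  have "((\<lambda>w. s * (NN w * BB w)\<^sup>2) has_derivative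
      (\<lambda>h. s * (2 * (NN w * BB w) * (NN w * BB' w h + NN' w h * BB w)))) (at w)"
    by (rule has_derivative_mult_right[OF has_derivative_square[OF prod]])
  then show ?thesis
    using prod unfolding PP_def[abs_def] PP'_def[abs_def] by (cases "s = 0") simp_all
qed

lemma QQ_has_derivative: "(QQ has_derivative QQ' w) (at w)"
proof -
  have sq: "((\<lambda>w. (BB w)\<^sup>2 - (NN w)\<^sup>2) has_derivative (\<lambda>h. 2 * BB w * BB' w h - 2 * NN w * NN' w h)) (at w)"
    by (intro has_derivative_diff has_derivative_square BB_has_derivative NN_has_derivative)
  have "((\<lambda>w. ((BB w)\<^sup>2 - (NN w)\<^sup>2)\<^sup>2) has_derivative
      (\<lambda>h. 2 * ((BB w)\<^sup>2 - (NN w)\<^sup>2) * (2 * BB w * BB' w h - 2 * NN w * NN' w h))) (at w)"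
    by (rule has_derivative_square[OF sq])
  then show ?thesis
    using sq unfolding QQ_def[abs_def] QQ'_def[abs_def] by (cases "s = 0") simp_all
qed

text \<open>The numerator of the derivative of \<open>Psi\<close>, computed by the chain rule
  through \<open>mu\<close>. The sum of squares stems from the derivative
  \<open>(1 + t\<^sup>2) / (1 - t\<^sup>2)\<^sup>2\<close> of \<open>t / (1 - t\<^sup>2)\<close>,
  which has no zero; the factor for nonzero \<open>s\<close> stems from the outer square.\<close>

lemma wronskian:
  "QQ w * PP' w h - PP w * QQ' w h =
     (if s = 0 then 1 else 2 * s * (NN w * BB w) * ((BB w)\<^sup>2 - (NN w)\<^sup>2)) *
     (((BB w)\<^sup>2 + (NN w)\<^sup>2) * (BB w * NN' w h - NN w * BB' w h))"
proof -
  define p q p' q' where "p = NN w * BB w" and "q = (BB w)\<^sup>2 - (NN w)\<^sup>2"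
    and "p' = NN w * BB' w h + NN' w h * BB w" and "q' = 2 * BB w * BB' w h - 2 * NN w * NN' w h"
  have core: "q * p' - p * q' = ((BB w)\<^sup>2 + (NN w)\<^sup>2) * (BB w * NN' w h - NN w * BB' w h)"
    unfolding p_def q_def p'_def q'_def by (simp add: power2_eq_square algebra_simps)
  have "q\<^sup>2 * (s * (2 * p * p')) - s * p\<^sup>2 * (2 * q * q') = 2 * s * p * q * (q * p' - p * q')"
    by (simp add: power2_eq_square algebra_simps)
  with core show ?thesis
    unfolding PP_def QQ_def PP'_def QQ'_def p_def[symmetric] q_def[symmetric] p'_def[symmetric] q'_def[symmetric]
    by (cases "s = 0") simp_all
qed

lemma wronskian_nonzero:
  assumes "mu w \<noteq> 0" "\<bar>mu w\<bar> < 1"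
  obtains h where "QQ w * PP' w h - PP w * QQ' w h \<noteq> 0"
proof -
  obtain h where h: "BB w * NN' w h - NN w * BB' w h \<noteq> 0"
    using nondegenerate[OF assms] .
  have N: "NN w \<noteq> 0" "BB w \<noteq> 0"
    using assms(1) mu_eq_0_iff BB_ge[of w] by auto
  moreover have "(BB w)\<^sup>2 - (NN w)\<^sup>2 \<noteq> 0"
    using QQ_pos[OF assms(2)] by (auto simp: QQ_def split: if_splits)
  moreover have "(BB w)\<^sup>2 + (NN w)\<^sup>2 \<noteq> 0"
    using N by (simp add: add_nonneg_eq_0_iff)
  ultimately have "QQ w * PP' w h - PP w * QQ' w h \<noteq> 0"
    unfolding wronskian using h by simp
  then show thesis
    by (rule that)
qed

text \<open>Up to a positive factor, the derivative of \<open>warp\<close> at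
  \<open>Psi w\<close>.\<close>

definition slope :: "real ^ 'm \<Rightarrow> real" where
  "slope w = 3 * (Psi w - warp (Psi w))\<^sup>2 + (1 - cos (warp (Psi w)))"

lemma eqn_derivative_aux:
  fixes u q :: "real \<times> 'b::real_normed_vector \<Rightarrow> real"
  assumes u: "(u has_derivative u') (at p)" and q: "(q has_derivative q') (at p)"
  shows "((\<lambda>p. u p ^ 3 + (1 - cos (fst p)) * u p * (q p)\<^sup>2 - sin (fst p) / 2 * q p ^ 3) has_derivative
    (\<lambda>v. 3 * (u p)\<^sup>2 * u' v + ((1 - cos (fst p)) * u p * (2 * q p * q' v)
        + ((1 - cos (fst p)) * u' v + sin (fst p) * fst v * u p) * (q p)\<^sup>2)
      - (sin (fst p) / 2 * (3 * (q p)\<^sup>2 * q' v) + cos (fst p) * fst v / 2 * q p ^ 3))) (at p)"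
proof -
  have "(fst has_derivative fst) (at p)"
    by (rule bounded_linear_imp_has_derivative[OF bounded_linear_fst])
  then have trig: "((\<lambda>p. 1 - cos (fst p)) has_derivative (\<lambda>v. sin (fst p) * fst v)) (at p)"
    "((\<lambda>p. sin (fst p) / 2) has_derivative (\<lambda>v. cos (fst p) * fst v / 2)) (at p)"
    by (auto intro!: derivative_eq_intros simp: mult.commute)
  show ?thesis
    by (intro has_derivative_diff has_derivative_add has_derivative_mult has_derivative_square has_derivative_cube trig u q)
qed

text \<open>The differential of \<open>QQ ^ 3 * wig x Psi\<close>. The coefficient \<open>b\<close>
  is \<open>QQ w ^ 3\<close> times the derivative of \<open>wig\<close> in \<open>x\<close>, hence
  not 0 by \<open>wig_deriv_neg\<close>; the second summand belongs to the derivative in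
  \<open>t\<close>, times the differential of \<open>Psi\<close>. The derivative of
  \<open>QQ ^ 3\<close> drops out because \<open>wig\<close> is 0 on the hypersurface.\<close>

lemma eqn_derivative:
  assumes w: "\<bar>mu w\<bar> < 1"
  obtains b where "b \<noteq> 0"
    "(eqn has_derivative (\<lambda>v. b * fst v + QQ w * slope w * (QQ w * PP' w (snd v) - PP w * QQ' w (snd v)))) (at (pt w))"
proof -
  define x where "x = warp (Psi w)"
  define y where "y = Psi w - x"
  define u where "u = PP w - x * QQ w"
  define b where "b = - (QQ w ^ 3 * (3 * y\<^sup>2 + (1 - cos x) - y * sin x + cos x / 2))"
  have q: "0 < QQ w"
    by (rule QQ_pos[OF w])
  then have uy: "u = QQ w * y" and PP: "PP w = QQ w * (x + y)"
    by (simp_all add: u_def y_def Psi_def field_simps)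
  have "wig x (Psi w) = 0"
    by (simp add: wig_eq_0_iff x_def)
  \<comment> \<open>The equation of the hypersurface; it serves to eliminate the sine from the terms
    with \<open>QQ'\<close>.\<close>
  then have root: "sin x / 2 = y ^ 3 + (1 - cos x) * y"
    by (simp add: wig_def y_def)
  have sl: "slope w = 3 * y\<^sup>2 + (1 - cos x)"
    by (simp add: slope_def y_def x_def)
  have "(eqn has_derivative (\<lambda>v.
      3 * u\<^sup>2 * (PP' w (snd v) - (x * QQ' w (snd v) + fst v * QQ w))
      + ((1 - cos x) * u * (2 * QQ w * QQ' w (snd v))
        + ((1 - cos x) * (PP' w (snd v) - (x * QQ' w (snd v) + fst v * QQ w)) + sin x * fst v * u) * (QQ w)\<^sup>2)
      - (sin x / 2 * (3 * (QQ w)\<^sup>2 * QQ' w (snd v)) + cos x * fst v / 2 * QQ w ^ 3))) (at (pt w))"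
    (is "(_ has_derivative ?D) _")
  proof -
    have "((\<lambda>p. PP (snd p)) has_derivative (\<lambda>v. PP' w (snd v))) (at (pt w))"
      "((\<lambda>p. QQ (snd p)) has_derivative (\<lambda>v. QQ' w (snd v))) (at (pt w))"
      using has_derivative_compose[OF bounded_linear_imp_has_derivative[OF bounded_linear_snd], of PP "PP' w" "pt w"]
        has_derivative_compose[OF bounded_linear_imp_has_derivative[OF bounded_linear_snd], of QQ "QQ' w" "pt w"]
        PP_has_derivative[of w] QQ_has_derivative[of w] by simp_all
    note P = this(1) and Q = this(2)
    have "((\<lambda>p. PP (snd p) - fst p * QQ (snd p)) has_derivative
        (\<lambda>v. PP' w (snd v) - (x * QQ' w (snd v) + fst v * QQ w))) (at (pt w))"
      using has_derivative_diff[OF P has_derivative_mult[OF bounded_linear_imp_has_derivative[OF bounded_linear_fst] Q]]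
      by (simp add: x_def)
    from eqn_derivative_aux[OF this Q] show ?thesis
      unfolding eqn_def[abs_def] by (simp only: snd_pt fst_pt x_def[symmetric] u_def[symmetric])
  qed
  moreover have "?D v = b * fst v + QQ w * slope w * (QQ w * PP' w (snd v) - PP w * QQ' w (snd v))" for v
  proof -
    have "?D v = b * fst v + (QQ w)\<^sup>2 * slope w * (PP' w (snd v) - x * QQ' w (snd v))
        + (QQ w)\<^sup>2 * QQ' w (snd v) * (2 * (1 - cos x) * y - 3 * (sin x / 2))"
      unfolding uy b_def sl by (simp add: power2_eq_square power3_eq_cube algebra_simps)
    also have "2 * (1 - cos x) * y - 3 * (sin x / 2) = - y * slope w"
      unfolding root sl by (simp add: power2_eq_square power3_eq_cube algebra_simps)
    also have "b * fst v + (QQ w)\<^sup>2 * slope w * (PP' w (snd v) - x * QQ' w (snd v)) + (QQ w)\<^sup>2 * QQ' w (snd v) * (- y * slope w)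
        = b * fst v + QQ w * slope w * (QQ w * PP' w (snd v) - PP w * QQ' w (snd v))"
      unfolding PP by (simp add: power2_eq_square algebra_simps)
    finally show ?thesis .
  qed
  moreover have "b \<noteq> 0"
    using q wig_deriv_neg[of y x] by (simp add: b_def)
  ultimately show thesis
    using that[of b] by (simp only: simp_thms)
qed

lemma surj_real_linear: "linear f \<Longrightarrow> f v \<noteq> 0 \<Longrightarrow> surj (f :: _ \<Rightarrow> real)"
proof (rule surjI[of _ "\<lambda>r. (r / f v) *\<^sub>R v"])
  fix r assume "linear f" "f v \<noteq> 0"
  then show "f ((r / f v) *\<^sub>R v) = r"
    by (simp add: linear_scale)
qed

lemma regular: "p \<in> XX \<Longrightarrow> surj (frechet_derivative eqn (at p))"
proof -
  assume "p \<in> XX"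
  then have w: "\<bar>mu (snd p)\<bar> < 1" and p: "p = pt (snd p)"
    using XX_iff by blast+
  let ?w = "snd p"
  obtain b where b: "b \<noteq> 0" and d: "(eqn has_derivative (\<lambda>v. b * fst v + QQ ?w * slope ?w *
      (QQ ?w * PP' ?w (snd v) - PP ?w * QQ' ?w (snd v)))) (at (pt ?w))"
    using eqn_derivative[OF w] .
  have "PP' ?w 0 = 0" "QQ' ?w 0 = 0"
    using has_derivative_linear[OF PP_has_derivative] has_derivative_linear[OF QQ_has_derivative]
    by (auto simp: linear_0)
  then have "surj (\<lambda>v. b * fst v + QQ ?w * slope ?w * (QQ ?w * PP' ?w (snd v) - PP ?w * QQ' ?w (snd v)))"
    using b by (intro surj_real_linear[OF has_derivative_linear[OF d], of "(1, 0)"]) simp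
  then show ?thesis
    unfolding frechet_derivative_at[OF d] p[symmetric] .
qed

text \<open>As \<open>b\<close> is not 0, \<open>fst\<close> maps the tangent space onto the line
  exactly if the part of the differential in \<open>snd v\<close> is not 0, that is, if neither the
  slope nor the Wronskian vanishes. The Wronskian can vanish only on the level
  \<open>mu = 0\<close>, but there \<open>Psi = 0\<close> and the slope vanishes as well.\<close>

lemma critical_points_eq: "critical_points eqn XX fst = {p \<in> XX. \<exists>n :: int. Psi (snd p) = 2 * pi * n}"
proof -
  have "frechet_derivative fst (at p) ` tangent_space eqn p \<noteq> UNIV \<longleftrightarrow> (\<exists>n :: int. Psi (snd p) = 2 * pi * n)"
    if "p \<in> XX" for p
  proof -
    have w: "\<bar>mu (snd p)\<bar> < 1" and p: "p = pt (snd p)"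
      using XX_iff that by blast+
    let ?w = "snd p"
    obtain b where b: "b \<noteq> 0" and d: "(eqn has_derivative (\<lambda>v. b * fst v + QQ ?w * slope ?w *
        (QQ ?w * PP' ?w (snd v) - PP ?w * QQ' ?w (snd v)))) (at (pt ?w))"
      using eqn_derivative[OF w] .
    have T: "tangent_space eqn p = {v. b * fst v + QQ ?w * slope ?w * (QQ ?w * PP' ?w (snd v) - PP ?w * QQ' ?w (snd v)) = 0}"
      unfolding tangent_space_def using frechet_derivative_at[OF d] p by (metis (no_types, lifting))
    have F: "frechet_derivative fst (at p) = fst"
      by (rule frechet_derivative_at[OF bounded_linear_imp_has_derivative[OF bounded_linear_fst], symmetric])
    have crit: "slope ?w = 0 \<longleftrightarrow> (\<exists>n :: int. Psi ?w = 2 * pi * n)"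
      unfolding slope_def by (rule warp_critical_iff)
    show ?thesis
    proof (cases "slope ?w = 0")
      case True
      then have "fst ` tangent_space eqn p \<subseteq> {0}"
        unfolding T using b by auto
      then have "fst ` tangent_space eqn p \<noteq> UNIV"
        by (metis UNIV_I singletonD subsetD zero_neq_one)
      then show ?thesis
        using crit True F by simp
    next
      case False
      have "mu ?w \<noteq> 0"
      proof
        assume "mu ?w = 0"
        then have "Psi ?w = 0"
          using Psi_eq[OF w] V_0 by simp
        then show False
          using crit False by (metis mult_zero_right of_int_0)
      qed
      then obtain h where h: "QQ ?w * PP' ?w h - PP ?w * QQ' ?w h \<noteq> 0"
        using wronskian_nonzero[OF _ w] by blast
      have lin: "linear (PP' ?w)" "linear (QQ' ?w)"
        using has_derivative_linear[OF PP_has_derivative] has_derivative_linear[OF QQ_has_derivative] by auto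
      have "x \<in> fst ` tangent_space eqn p" for x
      proof -
        define g where "g = QQ ?w * slope ?w * (QQ ?w * PP' ?w h - PP ?w * QQ' ?w h)"
        have "g \<noteq> 0"
          using h False QQ_pos[OF w] by (simp add: g_def)
        define l where "l = - (b * x / g)"
        have "QQ ?w * slope ?w * (QQ ?w * PP' ?w (l *\<^sub>R h) - PP ?w * QQ' ?w (l *\<^sub>R h)) = l * g"
          using lin by (simp add: linear_scale g_def algebra_simps)
        then have "(x, l *\<^sub>R h) \<in> tangent_space eqn p"
          unfolding T using \<open>g \<noteq> 0\<close> by (simp add: l_def)
        then show ?thesis
          by force
      qed
      then show ?thesis
        using crit False F by auto
    qed
  qed
  then show ?thesis
    unfolding critical_points_def by blast
qed

lemma real_analytic_eqn: "real_analytic_on eqn UNIV"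
proof -
  have *: "(1, 0) \<in> (Basis :: (real \<times> (real ^ 'm)) set)"
    by (auto simp: Basis_prod_def)
  have "real_analytic_on (\<lambda>p :: real \<times> (real ^ 'm). fst p) UNIV"
    "real_analytic_on (\<lambda>p :: real \<times> (real ^ 'm). sin (fst p)) UNIV"
    "real_analytic_on (\<lambda>p :: real \<times> (real ^ 'm). cos (fst p)) UNIV"
    using real_analytic_on_inner[OF *] real_analytic_on_sin_cos[OF *] by (simp_all add: inner_prod_def)
  moreover have "real_analytic_on (\<lambda>p :: real \<times> (real ^ 'm). PP (snd p)) UNIV"
    unfolding PP_def by (cases "s = 0") (auto intro!: real_analytic_on_mult real_analytic_on_power
      real_analytic_on_const analytic_NN analytic_BB)
  moreover have "real_analytic_on (\<lambda>p :: real \<times> (real ^ 'm). QQ (snd p)) UNIV"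
    unfolding QQ_def by (cases "s = 0") (auto intro!: real_analytic_on_diff real_analytic_on_power
      real_analytic_on_const analytic_NN analytic_BB)
  ultimately show ?thesis
    unfolding eqn_def[abs_def] divide_inverse
    by (intro real_analytic_on_add real_analytic_on_diff real_analytic_on_mult real_analytic_on_power real_analytic_on_const)
qed

lemma manifold: "real_analytic_manifold eqn XX"
  unfolding real_analytic_manifold_def
proof (intro conjI ballI real_analytic_eqn regular)
  show "\<exists>\<K>\<subseteq>components {x. eqn x = 0}. XX = \<Union>\<K>"
    unfolding XX_def by (intro exI[of _ "components {x. eqn x = 0}"] conjI order_refl Union_components[symmetric])
qed

end

section \<open>The compactification\<close>

text \<open>The new points lie on the axis over the origin, where the hypersurface has only the point \<open>(0, 0)\<close>.\<close>

locale compactified = hypersurface i0 i1 k s for i0 i1 :: "'m::finite" and k s +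
  fixes en :: "nat \<Rightarrow> nat"
begin

definition endp :: "nat \<Rightarrow> real \<times> (real ^ 'm)" where
  "endp c = (2 + real c, 0)"

definition infp :: "real \<times> (real ^ 'm)" where
  "infp = (1, 0)"

definition is_end :: "real \<times> (real ^ 'm) \<Rightarrow> bool" where
  "is_end p \<longleftrightarrow> snd p = 0 \<and> 2 \<le> fst p"

definition rad :: "real \<times> (real ^ 'm) \<Rightarrow> real" where
  "rad p = (if is_end p then 1 else \<bar>mu (snd p)\<bar>)"

text \<open>The label \<open>c\<close> of an end is read off its first coordinate
  \<open>2 + c\<close>.\<close>

definition lab :: "real \<times> (real ^ 'm) \<Rightarrow> nat" where
  "lab p = (if is_end p then nat \<lfloor>fst p\<rfloor> - 2 else lobe (snd p))"

text \<open>The neighbourhoods of an end consist of the outer parts of all arms that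
  \<open>en\<close> sends to it. Those of \<open>infp\<close> contain the whole level
  \<open>mu = 0\<close>; the two are not separated, but the Reeb quotient identifies them.\<close>

definition NB :: "real \<times> (real ^ 'm) \<Rightarrow> real \<Rightarrow> (real \<times> (real ^ 'm)) set" where
  "NB q a = (if is_end q
     then {p \<in> XX. snd p \<in> {w. 1 - a < \<bar>mu w\<bar>} \<inter> (\<Union>j\<in>{j. j < 2 * k \<and> en j = lab q}. {w. NN w \<noteq> 0 \<and> lobe w = j})}
     else {p \<in> XX. snd p \<in> {w. \<bar>mu w\<bar> < a}})"

definition new_points :: "bool \<Rightarrow> (real \<times> (real ^ 'm)) set" where
  "new_points full = (if full then insert infp (endp ` en ` {..<2 * k}) else {})"

text \<open>Without the new points this is the hypersurface itself, so the following lemmas treat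
  both Reeb spaces at once.\<close>

definition TT :: "bool \<Rightarrow> (real \<times> (real ^ 'm)) topology" where
  "TT full = ext_top (top_of_set XX) (new_points full) NB"

definition \<sigma> :: "nat \<Rightarrow> real \<Rightarrow> real \<times> (real ^ 'm)" where
  "\<sigma> j r = (if r < 1 then pt (ray j r) else endp (en j))"

lemma mu_0: "mu 0 = 0"
  by (simp add: mu_def NN_0)

lemma lobe_0: "mu w = 0 \<Longrightarrow> lobe w = 0"
  by (simp add: lobe_def mu_eq_0_iff)

lemma Psi_0: "mu w = 0 \<Longrightarrow> Psi w = 0"
  using Psi_eq[of w] V_0 by simp

lemma warp_0: "warp 0 = 0"
  using warp_2pi[of 0] by simp

lemma XX_not_end: "p \<in> XX \<Longrightarrow> \<not> is_end p"
proof
  assume "p \<in> XX" "is_end p"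
  then have "fst p = warp (Psi 0)" "2 \<le> fst p"
    using XX_iff[of p] fst_pt[of "snd p"] by (auto simp: is_end_def)
  then show False
    using Psi_0[OF mu_0] warp_0 by simp
qed

lemma endp [simp]: "is_end (endp c)" "lab (endp c) = c" "rad (endp c) = 1"
proof -
  show "is_end (endp c)"
    by (simp add: is_end_def endp_def)
  then show "rad (endp c) = 1"
    by (simp add: rad_def)
  have "\<lfloor>2 + real c\<rfloor> = 2 + int c"
    by (metis floor_of_int of_int_add of_int_numeral of_int_of_nat_eq)
  then have "nat \<lfloor>2 + real c\<rfloor> - 2 = c"
    by simp
  then show "lab (endp c) = c"
    unfolding lab_def if_P[OF \<open>is_end (endp c)\<close>] by (simp add: endp_def)
qed

lemma infp [simp]: "\<not> is_end infp" "lab infp = 0" "rad infp = 0"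
  using mu_0 lobe_0 by (simp_all add: infp_def is_end_def rad_def lab_def)

lemma infp_notin: "infp \<notin> XX"
proof
  assume "infp \<in> XX"
  then have "fst infp = warp (Psi 0)"
    using XX_iff[of infp] fst_pt[of 0] by (metis infp_def snd_conv)
  then show False
    using Psi_0[OF mu_0] warp_0 by (simp add: infp_def)
qed

lemma open_mu: "open {w. \<bar>mu w\<bar> < a}" "open {w. a < \<bar>mu w\<bar>}"
  by (auto intro!: open_Collect_less continuous_intros continuous_on_mu)

lemma openin_XX: "open U \<Longrightarrow> openin (top_of_set XX) {p \<in> XX. snd p \<in> U}"
proof -
  assume "open U"
  then have "openin (top_of_set XX) (XX \<inter> (snd -` U))"
    by (intro openin_open_Int open_vimage_snd)
  moreover have "XX \<inter> (snd -` U) = {p \<in> XX. snd p \<in> U}"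
    by auto
  ultimately show ?thesis
    by simp
qed

sublocale ext: extension "top_of_set XX" "new_points full" NB for full
proof
  show "new_points full \<inter> topspace (top_of_set XX) = {}"
  proof -
    have "endp c \<notin> XX" for c
      using XX_not_end endp(1) by blast
    then show ?thesis
      using infp_notin by (auto simp: new_points_def)
  qed
  show "openin (top_of_set XX) (NB q a)" for q a
  proof (cases "is_end q")
    case True
    have "open ({w. 1 - a < \<bar>mu w\<bar>} \<inter> (\<Union>j\<in>{j. j < 2 * k \<and> en j = lab q}. {w. NN w \<noteq> 0 \<and> lobe w = j}))"
      by (intro open_Int open_mu open_UN ballI open_lobe) simp
    from openin_XX[OF this] show ?thesis
      unfolding NB_def if_P[OF True] .
  next
    case False
    from openin_XX[OF open_mu(1)] show ?thesis
      unfolding NB_def if_not_P[OF False] .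
  qed
  show "NB q a \<subseteq> NB q b" if "a \<le> b" for q a b
    using that unfolding NB_def by auto
qed

lemma topspace_TT: "topspace (TT full) = XX \<union> new_points full"
  unfolding TT_def ext.topspace_ext by simp

lemma pt_continuous: "A \<subseteq> {w. \<bar>mu w\<bar> < 1} \<Longrightarrow> continuous_map (top_of_set A) (top_of_set XX) pt"
  using continuous_on_pt[of A] pt_in by (auto simp: continuous_map_in_subtopology)

lemma connectedin_pt: "connected A \<Longrightarrow> A \<subseteq> {w. \<bar>mu w\<bar> < 1} \<Longrightarrow> connectedin (TT full) (pt ` A)"
  unfolding TT_def
  by (intro ext.connectedin_ext connectedin_continuous_map_image[OF pt_continuous[of A]])
     (simp_all add: connectedin_subtopology)

lemma rad_XX: "p \<in> XX \<Longrightarrow> rad p = \<bar>mu (snd p)\<bar>" and lab_XX: "p \<in> XX \<Longrightarrow> lab p = lobe (snd p)"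
  using XX_not_end by (auto simp: rad_def lab_def)

lemma rad_XX_less: "p \<in> XX \<Longrightarrow> rad p < 1"
  using XX_iff[of p] rad_XX by simp

lemma new_pointE:
  assumes "p \<in> new_points full"
  obtains "full" "p = infp" | j where full "j < 2 * k" "p = endp (en j)"
  using assms unfolding new_points_def by (auto split: if_splits)

lemma ray_01: "0 \<le> r \<Longrightarrow> r < 1 \<Longrightarrow> \<bar>mu (ray j r)\<bar> < 1"
  using ray(2)[of r j] by simp

lemma \<sigma>_XX: "0 \<le> r \<Longrightarrow> r < 1 \<Longrightarrow> \<sigma> j r \<in> XX"
  using ray_01 pt_in by (simp add: \<sigma>_def)

lemma NB_end: "NB (endp c) a = {p \<in> XX. 1 - a < \<bar>mu (snd p)\<bar> \<and> NN (snd p) \<noteq> 0 \<and> en (lobe (snd p)) = c}"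
  unfolding NB_def using lobe by auto

lemma NB_inf: "NB infp a = {p \<in> XX. \<bar>mu (snd p)\<bar> < a}"
  unfolding NB_def by auto

lemma ray_near_end: "0 < a \<Longrightarrow> j < 2 * k \<Longrightarrow> max (1 - a) 0 < r \<Longrightarrow> r < 1 \<Longrightarrow> pt (ray j r) \<in> NB (endp (en j)) a"
  using ray[of r j] lobe_ray[of r j] mu_eq_0_iff[of "ray j r"] pt_in[of "ray j r"] by (auto simp: NB_end)

lemma NB_nonempty: "p \<in> new_points full \<Longrightarrow> 0 < a \<Longrightarrow> NB p a \<noteq> {}"
proof (erule new_pointE)
  assume "p = infp" "0 < a"
  then have "pt 0 \<in> NB p a"
    using pt_in[of 0] mu_0 by (simp add: NB_inf)
  then show ?thesis by blast
next
  fix j assume "j < 2 * k" "p = endp (en j)" "0 < a"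
  then have "pt (ray j ((max (1 - a) 0 + 1) / 2)) \<in> NB p a"
    using ray_near_end[of a j "(max (1 - a) 0 + 1) / 2"] by simp
  then show ?thesis by blast
qed

lemma continuous_\<sigma>:
  assumes j: "j < 2 * k"
  shows "continuous_map (top_of_set (arm_dom full)) (TT full) (\<sigma> j)"
  unfolding continuous_map_def
proof (intro conjI allI impI)
  have end_in: "endp (en j) \<in> new_points full" if "1 \<in> arm_dom full"
    using that j by (auto simp: new_points_def arm_dom_def split: if_splits)
  have dom: "0 \<le> r \<and> (r < 1 \<or> r = 1)" if "r \<in> arm_dom full" for r
    using that by (auto simp: arm_dom_def split: if_splits)
  show "\<sigma> j \<in> topspace (top_of_set (arm_dom full)) \<rightarrow> topspace (TT full)"
  proof
    fix r assume r: "r \<in> topspace (top_of_set (arm_dom full))"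
    then show "\<sigma> j r \<in> topspace (TT full)"
      using dom[of r] \<sigma>_XX[of r j] end_in unfolding topspace_TT by (auto simp: \<sigma>_def)
  qed
  fix U assume U: "openin (TT full) U"
  let ?A = "{r \<in> topspace (top_of_set (arm_dom full)). \<sigma> j r \<in> U}"
  have "openin (top_of_set XX) (U \<inter> XX)"
    using U unfolding TT_def ext.openin_ext ext_open_def by simp
  moreover have "continuous_map (top_of_set {0..<1}) (top_of_set XX) (\<lambda>r. pt (ray j r))"
  proof -
    have "continuous_on {0..<1} (ray j)"
      using continuous_on_ray by (rule continuous_on_subset) auto
    then have "continuous_map (top_of_set {0..<1}) (top_of_set {w. \<bar>mu w\<bar> < 1}) (ray j)"
      using ray_01 by (auto simp: continuous_map_in_subtopology)
    from continuous_map_compose[OF this pt_continuous[OF order_refl]] show ?thesis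
      by (simp add: o_def)
  qed
  ultimately have inner: "openin (top_of_set {0..<1}) {r \<in> {0..<1}. pt (ray j r) \<in> U \<inter> XX}"
    using openin_continuous_map_preimage[of "top_of_set {0..<1}" "top_of_set XX"] by fastforce
  have sub: "{0..<1} \<subseteq> arm_dom full"
    by (auto simp: arm_dom_def)
  have op: "openin (top_of_set (arm_dom full)) {0..<1}"
  proof -
    have "{0..<1} = arm_dom full \<inter> {..<1}"
      by (auto simp: arm_dom_def)
    then show ?thesis
      by (metis openin_open_Int open_lessThan)
  qed
  show "openin (top_of_set (arm_dom full)) ?A"
  proof (subst openin_subopen, intro ballI)
    fix r assume r: "r \<in> ?A"
    then consider "0 \<le> r" "r < 1" | "r = 1"
      using dom by auto
    then show "\<exists>B. openin (top_of_set (arm_dom full)) B \<and> r \<in> B \<and> B \<subseteq> ?A"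
    proof cases
      case 1
      let ?B = "{r \<in> {0..<1}. pt (ray j r) \<in> U \<inter> XX}"
      have "openin (top_of_set (arm_dom full)) ?B"
        using openin_trans[OF inner op] .
      moreover have "r \<in> ?B"
        using r 1 \<sigma>_XX[OF 1] by (simp add: \<sigma>_def)
      moreover have "?B \<subseteq> ?A"
        using sub by (auto simp: \<sigma>_def)
      ultimately show ?thesis by blast
    next
      case 2
      then have 1: "1 \<in> arm_dom full" and "endp (en j) \<in> U"
        using r by (auto simp: \<sigma>_def)
      then obtain a where a: "a > 0" "NB (endp (en j)) a \<subseteq> U"
        using U end_in unfolding TT_def ext.openin_ext ext_open_def by blast
      let ?B = "arm_dom full \<inter> {max (1 - a) 0<..}"
      have "openin (top_of_set (arm_dom full)) ?B"
        by (intro openin_open_Int open_greaterThan)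
      moreover have "r \<in> ?B"
        using 2 1 a by simp
      moreover have "?B \<subseteq> ?A"
      proof
        fix t assume t: "t \<in> ?B"
        then show "t \<in> ?A"
          using dom[of t] a ray_near_end[OF a(1) j, of t] \<open>endp (en j) \<in> U\<close> by (auto simp: \<sigma>_def)
      qed
      ultimately show ?thesis by blast
    qed
  qed
qed

lemma continuous_rad: "continuous_map (TT full) euclideanreal rad"
  unfolding TT_def
proof (rule ext.continuous_map_ext)
  have "continuous_map (top_of_set XX) euclideanreal (\<lambda>p. \<bar>mu (snd p)\<bar>)"
    by (simp add: continuous_on_compose2[OF continuous_on_mu[of UNIV]] continuous_on_rabs continuous_on_snd)
  then show "continuous_map (top_of_set XX) euclideanreal rad"
    by (rule continuous_map_eq) (simp add: rad_XX)
  fix p V assume p: "p \<in> new_points full" and V: "openin euclideanreal V" "rad p \<in> V"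
  then obtain e where e: "e > 0" "ball (rad p) e \<subseteq> V"
    using open_contains_ball by (metis open_openin)
  have "rad x \<in> V" if x: "x \<in> NB p e" for x
    using p
  proof (cases rule: new_pointE)
    case 1
    then have "x \<in> XX" "\<bar>mu (snd x)\<bar> < e"
      using x by (auto simp: NB_inf)
    then show ?thesis
      using e(2) 1 by (intro subsetD[OF e(2)]) (simp add: rad_XX dist_real_def)
  next
    case (2 j)
    then have "x \<in> XX" "1 - e < \<bar>mu (snd x)\<bar>"
      using x by (auto simp: NB_end)
    then show ?thesis
      using 2 rad_XX_less[of x] by (intro subsetD[OF e(2)]) (simp add: rad_XX dist_real_def)
  qed
  then show "\<exists>a>0. \<forall>x\<in>NB p a. rad x \<in> V"
    using e(1) by blast
qed simp

lemma TT_cases: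
  assumes "p \<in> topspace (TT full)"
  obtains "p \<in> XX" "rad p < 1" "\<not> is_end p" | "full" "p = infp" | j where full "j < 2 * k" "p = endp (en j)"
  using assms rad_XX_less XX_not_end unfolding topspace_TT by (auto elim: new_pointE)

text \<open>The point \<open>infp\<close> lies in the closure of the zero level, so adding it keeps
  the central class connected. An end is a class by itself, and the other classes are the level sets
  of \<open>connected_level\<close>.\<close>

lemma label_set_connected:
  assumes x: "x \<in> topspace (TT full)"
  shows "connectedin (TT full) {y \<in> topspace (TT full). rad y = rad x \<and> lab y = lab x}"
proof -
  let ?F = "{y \<in> topspace (TT full). rad y = rad x \<and> lab y = lab x}"
  have center: "connectedin (TT full) ?F" if "rad x = 0" "lab x = 0"
  proof -
    let ?Z = "pt ` {w. mu w = 0}"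
    have Z: "connectedin (TT full) ?Z"
      by (rule connectedin_pt[OF connected_zero_level]) auto
    moreover have "?Z \<subseteq> ?F"
      using that pt_in lobe_0 unfolding topspace_TT by (auto simp: rad_XX lab_XX)
    moreover have "?F \<subseteq> TT full closure_of ?Z"
    proof
      fix y assume y: "y \<in> ?F"
      then have "y \<in> topspace (TT full)" by simp
      then show "y \<in> TT full closure_of ?Z"
      proof (cases rule: TT_cases)
        case 1
        then have "y = pt (snd y)" "snd y \<in> {w. mu w = 0}"
          using y that XX_iff[of y] rad_XX[of y] by auto
        then have "y \<in> ?Z"
          by (rule image_eqI)
        then show ?thesis
          using closure_of_subset[OF connectedin_subset_topspace[OF Z]] by blast
      next
        case 2
        have "\<exists>z. z \<in> ?Z \<and> z \<in> U" if U: "infp \<in> U" "openin (TT full) U" for U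
        proof -
          have "infp \<in> new_points full"
            using 2 by (simp add: new_points_def)
          then obtain a where "a > 0" "NB infp a \<subseteq> U"
            using U unfolding TT_def ext.openin_ext ext_open_def by blast
          moreover have "pt 0 \<in> NB infp a"
            using \<open>a > 0\<close> pt_in[of 0] mu_0 by (simp add: NB_inf)
          ultimately show ?thesis
            using mu_0 by blast
        qed
        then show ?thesis
          using \<open>y \<in> topspace (TT full)\<close> 2 unfolding in_closure_of by blast
      next
        case (3 j)
        then show ?thesis
          using y that by simp
      qed
    qed
    ultimately show ?thesis
      by (rule connectedin_intermediate_closure_of)
  qed
  from x show ?thesis
  proof (cases rule: TT_cases)
    case 1
    show ?thesis
    proof (cases "rad x = 0")
      case True
      then show ?thesis
        using center lobe_0 1 by (simp add: rad_XX lab_XX)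
    next
      case False
      then have r: "0 < rad x" "rad x < 1"
        using 1 by (auto simp: rad_XX)
      have "?F = pt ` {w. lobe w = lab x \<and> \<bar>mu w\<bar> = rad x}"
      proof (intro equalityI subsetI)
        fix y assume y: "y \<in> ?F"
        then have "y \<in> topspace (TT full)" by simp
        then have "y \<in> XX"
          by (cases rule: TT_cases) (use y r in auto)
        then have "y = pt (snd y)" "snd y \<in> {w. lobe w = lab x \<and> \<bar>mu w\<bar> = rad x}"
          using y XX_iff[of y] by (auto simp: rad_XX lab_XX)
        then show "y \<in> pt ` {w. lobe w = lab x \<and> \<bar>mu w\<bar> = rad x}"
          by (rule image_eqI)
      next
        fix y assume "y \<in> pt ` {w. lobe w = lab x \<and> \<bar>mu w\<bar> = rad x}"
        then obtain w where w: "y = pt w" "lobe w = lab x" "\<bar>mu w\<bar> = rad x" by blast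
        then have "y \<in> XX"
          using pt_in r by simp
        then show "y \<in> ?F"
          using w unfolding topspace_TT by (simp add: rad_XX lab_XX)
      qed
      moreover have "NN (snd x) \<noteq> 0"
        using False 1 mu_eq_0_iff by (simp add: rad_XX)
      then have "lab x < 2 * k"
        using lobe 1 by (simp add: lab_XX)
      then have "connectedin (TT full) (pt ` {w. lobe w = lab x \<and> \<bar>mu w\<bar> = rad x})"
        using r by (intro connectedin_pt connected_level) auto
      ultimately show ?thesis by simp
    qed
  next
    case 2
    then show ?thesis
      using center by simp
  next
    case (3 j)
    have "?F = {x}"
    proof (intro equalityI subsetI)
      fix y assume y: "y \<in> ?F"
      then have "y \<in> topspace (TT full)" by simp
      then show "y \<in> {x}"
        by (cases rule: TT_cases) (use y 3 in auto)
    qed (use x in simp)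
    then show ?thesis
      using x by (simp add: connectedin_sing)
  qed
qed

text \<open>Applied to \<open>fst\<close> on the hypersurface and to \<open>cc\<close> on its
  compactification; only the relation between values, radius and label depends on the
  function.\<close>

lemma labelling:
  assumes c_lab: "\<And>x y. x \<in> topspace (TT full) \<Longrightarrow> y \<in> topspace (TT full) \<Longrightarrow> rad y = rad x \<Longrightarrow> lab y = lab x \<Longrightarrow> c y = c x"
    and c_rad: "\<And>x y. x \<in> topspace (TT full) \<Longrightarrow> y \<in> topspace (TT full) \<Longrightarrow> c y = c x \<Longrightarrow> rad y = rad x"
  shows "star_labelling (TT full) c (2 * k) full \<sigma> rad lab en"
proof
  show "0 < 2 * k"
    using k by simp
  show "continuous_map (TT full) euclideanreal rad"
    by (rule continuous_rad)
  show "rad x \<in> arm_dom full" if "x \<in> topspace (TT full)" for x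
    using that by (cases rule: TT_cases) (auto simp: arm_dom_def rad_XX)
  show "lab x = 0" if "x \<in> topspace (TT full)" "rad x = 0" for x
    using that by (cases rule: TT_cases) (auto simp: rad_XX lab_XX lobe_0)
  show "lab x < 2 * k" if "x \<in> topspace (TT full)" "0 < rad x" "rad x < 1" for x
    using that(1)
  proof (cases rule: TT_cases)
    case 1
    then show ?thesis
      using that(2) lobe[of "snd x"] mu_eq_0_iff[of "snd x"] by (auto simp: rad_XX lab_XX)
  qed (use that in auto)
  show "lab x \<in> en ` {..<2 * k}" if "x \<in> topspace (TT full)" "rad x = 1" for x
    using that by (cases rule: TT_cases) auto
  show "connectedin (TT full) {y \<in> topspace (TT full). rad y = rad x \<and> lab y = lab x}"
    if "x \<in> topspace (TT full)" for x
    by (rule label_set_connected[OF that])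
  show "c y = c x" if "x \<in> topspace (TT full)" "y \<in> topspace (TT full)" "rad y = rad x" "lab y = lab x" for x y
    by (rule c_lab[OF that])
  show "rad y = rad x" if "x \<in> topspace (TT full)" "y \<in> topspace (TT full)" "c y = c x" for x y
    by (rule c_rad[OF that])
  show "openin (TT full) {x \<in> topspace (TT full). 0 < rad x \<and> rad x < 1 \<and> lab x = j}" if "j < 2 * k" for j
  proof -
    have "{x \<in> topspace (TT full). 0 < rad x \<and> rad x < 1 \<and> lab x = j} = {p \<in> XX. snd p \<in> {w. NN w \<noteq> 0 \<and> lobe w = j}}"
    proof (intro equalityI subsetI)
      fix x assume x: "x \<in> {x \<in> topspace (TT full). 0 < rad x \<and> rad x < 1 \<and> lab x = j}"
      then have "x \<in> topspace (TT full)" by simp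
      then have "x \<in> XX"
        by (cases rule: TT_cases) (use x in auto)
      then show "x \<in> {p \<in> XX. snd p \<in> {w. NN w \<noteq> 0 \<and> lobe w = j}}"
        using x mu_eq_0_iff[of "snd x"] by (auto simp: rad_XX lab_XX)
    next
      fix x assume "x \<in> {p \<in> XX. snd p \<in> {w. NN w \<noteq> 0 \<and> lobe w = j}}"
      then show "x \<in> {x \<in> topspace (TT full). 0 < rad x \<and> rad x < 1 \<and> lab x = j}"
        using mu_eq_0_iff[of "snd x"] rad_XX_less[of x] unfolding topspace_TT by (auto simp: rad_XX lab_XX)
    qed
    then show ?thesis
      using ext.openin_ext_old[OF openin_XX[OF open_lobe[OF that]], of full] unfolding TT_def by simp
  qed
  show "openin (TT full) {x \<in> topspace (TT full). 1/2 < rad x \<and> (if rad x < 1 then en (lab x) = en j else lab x = en j)}"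
    if "full" "j < 2 * k" for j
  proof -
    have "{x \<in> topspace (TT full). 1/2 < rad x \<and> (if rad x < 1 then en (lab x) = en j else lab x = en j)}
        = insert (endp (en j)) (NB (endp (en j)) (1/2))" (is "?L = ?R")
    proof (intro equalityI subsetI)
      fix x assume x: "x \<in> ?L"
      then have "x \<in> topspace (TT full)" by simp
      then show "x \<in> ?R"
      proof (cases rule: TT_cases)
        case 1
        then show ?thesis
          using x mu_eq_0_iff[of "snd x"] by (auto simp: NB_end rad_XX lab_XX)
      qed (use x in auto)
    next
      fix x assume "x \<in> ?R"
      then consider "x = endp (en j)" | "x \<in> XX" "1/2 < rad x" "en (lab x) = en j"
        by (auto simp: NB_end rad_XX lab_XX)
      then show "x \<in> ?L"
      proof cases
        case 1
        then show ?thesis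
          using that unfolding topspace_TT by (simp add: new_points_def)
      next
        case 2
        then show ?thesis
          using rad_XX_less[of x] unfolding topspace_TT by simp
      qed
    qed
    moreover have "endp (en j) \<in> new_points full"
      using that by (simp add: new_points_def)
    ultimately show ?thesis
      using ext.openin_ext_nhd[of "endp (en j)" full "1/2"] unfolding TT_def by simp
  qed
  show "continuous_map (top_of_set (arm_dom full)) (TT full) (\<sigma> j)" if "j < 2 * k" for j
    by (rule continuous_\<sigma>[OF that])
  have dom: "0 \<le> r \<and> (r < 1 \<or> r = 1)" if "r \<in> arm_dom full" for r
    using that by (auto simp: arm_dom_def split: if_splits)
  show "rad (\<sigma> j r) = r" if "j < 2 * k" "r \<in> arm_dom full" for j r
    using dom[OF that(2)] \<sigma>_XX[of r j] ray(2)[of r j] by (auto simp: \<sigma>_def rad_XX)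
  show "lab (\<sigma> j r) = (if r = 0 then 0 else if r < 1 then j else en j)" if jr: "j < 2 * k" "r \<in> arm_dom full" for j r
  proof -
    consider "r = 0" | "0 < r" "r < 1" | "r = 1"
      using dom[OF jr(2)] by fastforce
    then show ?thesis
    proof cases
      case 1
      then show ?thesis
        using \<sigma>_XX[of r j] ray(2)[of r j] lobe_0[of "ray j r"] by (simp add: \<sigma>_def lab_XX)
    next
      case 2
      then show ?thesis
        using \<sigma>_XX[of r j] lobe_ray[of r j] jr(1) by (simp add: \<sigma>_def lab_XX)
    qed (simp add: \<sigma>_def)
  qed
qed

lemma TT_False: "TT False = top_of_set XX"
proof -
  have "subtopology (TT False) XX = top_of_set XX"
    using ext.subtopology_ext[of False] unfolding TT_def by simp
  moreover have "topspace (TT False) = XX"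
    unfolding topspace_TT by (simp add: new_points_def)
  ultimately show ?thesis
    by (metis subtopology_topspace)
qed

end

section \<open>The compactified coordinate function\<close>

text \<open>Inverse stereographic projection from -1: it respects the orientations and misses only
  -1, which plays the point at infinity.\<close>

definition phi :: "real \<Rightarrow> complex" where
  "phi x = cis (2 * arctan x)"

lemma phi_tan: "- pi < t \<Longrightarrow> t < pi \<Longrightarrow> phi (tan (t / 2)) = cis t"
  by (simp add: phi_def arctan_tan)

lemma continuous_phi: "continuous_on UNIV phi"
  unfolding phi_def[abs_def] by (intro continuous_intros)

lemma cis_near:
  assumes "openin (top_of_set (sphere 0 1)) U" "cis a \<in> U"
  obtains d where "d > 0" "\<And>t. \<bar>t - a\<bar> < d \<Longrightarrow> cis t \<in> U"
proof -
  obtain W where W: "open W" "U = sphere 0 1 \<inter> W"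
    using assms(1) by (auto simp: openin_open)
  have "open (cis -` W)"
    using W(1) by (intro open_vimage continuous_intros)
  moreover have "a \<in> cis -` W"
    using assms(2) W(2) by simp
  ultimately obtain d where "d > 0" "ball a d \<subseteq> cis -` W"
    using open_contains_ball by blast
  then show thesis
    using that[of d] W(2) by (auto simp: dist_real_def abs_minus_commute subset_iff)
qed

text \<open>The inverse is the tangent of half the angle, by the double-angle formulas.\<close>

lemma embedding_phi: "embedding_map euclideanreal (top_of_set (sphere 0 1)) phi"
proof -
  have "homeomorphic_maps euclideanreal (subtopology (top_of_set (sphere 0 1)) (range phi)) phi (\<lambda>z. Im z / (1 + Re z))"
    unfolding homeomorphic_maps_def
  proof (intro conjI ballI)
    show "continuous_map euclideanreal (subtopology (top_of_set (sphere 0 1)) (range phi)) phi"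
      using continuous_phi by (auto simp: continuous_map_in_subtopology phi_def)
    have cos: "1 + Re (phi x) = 2 * (cos (arctan x))\<^sup>2" "Im (phi x) = 2 * sin (arctan x) * cos (arctan x)" for x
      using cos_double_cos[of "arctan x"] sin_double[of "arctan x"] by (simp_all add: phi_def)
    have ne: "cos (arctan x) \<noteq> 0" for x
      by (rule cos_arctan_not_zero)
    show "Im (phi x) / (1 + Re (phi x)) = x" for x
    proof -
      have "Im (phi x) / (1 + Re (phi x)) = sin (arctan x) / cos (arctan x)"
        unfolding cos using ne[of x] by (simp add: power2_eq_square)
      then show ?thesis
        by (metis tan_arctan tan_def)
    qed
    then show "phi (Im z / (1 + Re z)) = z" if "z \<in> topspace (subtopology (top_of_set (sphere 0 1)) (range phi))" for z
      using that by auto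
    have "1 + Re z \<noteq> 0" if "z \<in> range phi" for z
      using that cos(1) ne by auto
    then have "continuous_on (sphere 0 1 \<inter> range phi) (\<lambda>z. Im z / (1 + Re z))"
      by (intro continuous_intros) auto
    then show "continuous_map (subtopology (top_of_set (sphere 0 1)) (range phi)) euclideanreal (\<lambda>z. Im z / (1 + Re z))"
      by (simp add: subtopology_subtopology)
  qed
  then show ?thesis
    unfolding embedding_map_def by (auto simp: homeomorphic_map_maps)
qed

lemma dense_phi: "top_of_set (sphere 0 1) closure_of (range phi) = sphere 0 1"
proof (intro equalityI subsetI)
  fix z :: complex assume z: "z \<in> sphere 0 1"
  have "\<exists>y. y \<in> range phi \<and> y \<in> U" if U: "z \<in> U" "openin (top_of_set (sphere 0 1)) U" for U
  proof -
    have "z \<noteq> 0"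
      using z by auto
    then have "cis (Arg z) = z"
      using z cis_Arg[of z] by (simp add: sgn_eq)
    then obtain a where a: "- pi < a" "a \<le> pi" "z = cis a"
      using Arg_bounded[of z] by metis
    obtain d where d: "d > 0" "\<And>t. \<bar>t - a\<bar> < d \<Longrightarrow> cis t \<in> U"
      using cis_near[OF U(2)] U(1) a(3) by metis
    \<comment> \<open>The angle \<open>a\<close> may be \<open>pi\<close>, which
      \<open>phi_tan\<close> does not reach, so it is lowered a little while staying above
      \<open>- pi\<close>.\<close>
    define t where "t = a - min (d / 2) ((a + pi) / 2)"
    have t: "- pi < t" "t < pi" "\<bar>t - a\<bar> < d"
      using a d(1) by (auto simp: t_def min_def field_simps)
    then have "cis t \<in> range phi"
      using phi_tan[OF t(1,2)] by (metis rangeI)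
    then show ?thesis
      using d(2)[OF t(3)] by blast
  qed
  then show "z \<in> top_of_set (sphere 0 1) closure_of (range phi)"
    using z by (auto simp: in_closure_of)
qed (simp add: in_closure_of)

context compactified
begin

section \<open>Values and angles along the arms\<close>

definition thet :: "real \<Rightarrow> real" where
  "thet r = (if r = 1 then pi else 2 * arctan (warp (V r)))"

text \<open>The second case also gives the value at \<open>infp\<close>: its second component is the
  origin, where \<open>Psi\<close> is 0, so the value is that of the central level.\<close>

definition cc :: "real \<times> (real ^ 'm) \<Rightarrow> complex" where
  "cc p = (if is_end p then -1 else phi (warp (Psi (snd p))))"

lemma warp_sgnj: "warp (sgnj j * y) = sgnj j * warp y"
  using sgnj[of j] warp_minus by auto

lemma fst_XX: "p \<in> XX \<Longrightarrow> fst p = sgnj (lab p) * warp (V (rad p))"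
proof -
  assume p: "p \<in> XX"
  then have "fst p = warp (Psi (snd p))"
    using XX_iff[of p] fst_pt[of "snd p"] by metis
  then show ?thesis
    using Psi_eq[of "snd p"] XX_iff[of p] p by (simp add: rad_XX lab_XX warp_sgnj)
qed

lemma cc_XX: "p \<in> XX \<Longrightarrow> cc p = phi (fst p)"
proof -
  assume p: "p \<in> XX"
  then have "fst p = warp (Psi (snd p))"
    using XX_iff[of p] fst_pt[of "snd p"] by metis
  then show ?thesis
    using XX_not_end[OF p] by (simp add: cc_def)
qed

text \<open>At an end the label is not the number of an arm, but the sign is immaterial there
  because \<open>thet 1 = pi\<close>.\<close>

lemma cc_eq:
  assumes "p \<in> topspace (TT full)"
  shows "cc p = cis (sgnj (lab p) * thet (rad p))"
  using assms
proof (cases rule: TT_cases)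
  case 1
  then show ?thesis
    using sgnj[of "lab p"] by (auto simp: cc_XX fst_XX phi_def thet_def arctan_minus)
next
  case 2
  then show ?thesis
  proof -
    have "cc infp = phi (warp (Psi (snd infp)))"
      by (simp add: cc_def)
    also have "snd infp = 0"
      by (simp add: infp_def)
    finally show ?thesis
      using 2 Psi_0[OF mu_0] warp_0 V_0 by (simp add: phi_def thet_def)
  qed
next
  case (3 j)
  then show ?thesis
    using sgnj[of "en j"] by (auto simp: cc_def thet_def)
qed

lemma warp_less: "a < b \<Longrightarrow> warp a < warp b"
  using strict_mono_warp by (simp add: strict_mono_def)

lemma warp_V_strict_mono: "0 \<le> a \<Longrightarrow> a < b \<Longrightarrow> b < 1 \<Longrightarrow> warp (V a) < warp (V b)"
  by (intro warp_less V_strict_mono)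

lemma warp_V_nonneg: "0 \<le> a \<Longrightarrow> a < 1 \<Longrightarrow> 0 \<le> warp (V a)"
  using warp_V_strict_mono[of 0 a] V_0 warp_0 by (cases "a = 0") auto

lemma thet_0: "thet 0 = 0" and thet_1: "thet 1 = pi"
  using V_0 warp_0 by (simp_all add: thet_def)

lemma thet_strict_mono: "strict_mono_on {0..1} thet"
proof (rule strict_mono_onI)
  fix a b :: real assume ab: "a \<in> {0..1}" "b \<in> {0..1}" "a < b"
  then have a: "0 \<le> a" "a < 1" and b: "b \<le> 1"
    by auto
  have ta: "thet a = 2 * arctan (warp (V a))"
    using a by (simp add: thet_def)
  show "thet a < thet b"
  proof (cases "b = 1")
    case True
    then have "thet b = pi"
      by (simp add: thet_def)
    then show ?thesis
      using ta arctan_ubound[of "warp (V a)"] by linarith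
  next
    case False
    then have "warp (V a) < warp (V b)"
      using a b ab(3) by (intro warp_V_strict_mono) auto
    then have "arctan (warp (V a)) < arctan (warp (V b))"
      by (simp only: arctan_less_iff)
    then show ?thesis
      using False ta by (simp add: thet_def)
  qed
qed

lemma thet_inj: "a \<in> {0..1} \<Longrightarrow> b \<in> {0..1} \<Longrightarrow> thet a = thet b \<Longrightarrow> a = b"
  using strict_mono_on_imp_inj_on[OF thet_strict_mono] by (auto simp: inj_on_def)

lemma thet_mono: "a \<in> {0..1} \<Longrightarrow> b \<in> {0..1} \<Longrightarrow> a \<le> b \<Longrightarrow> thet a \<le> thet b"
  using strict_mono_onD[OF thet_strict_mono, of a b] by (cases "a = b") auto

lemma thet_bounds: "a \<in> {0..1} \<Longrightarrow> 0 \<le> thet a \<and> thet a \<le> pi"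
  using thet_mono[of 0 a] thet_mono[of a 1] thet_0 thet_1 by auto

lemma thet_lim:
  assumes "0 < d"
  shows "\<exists>a. 0 \<le> a \<and> a < 1 \<and> pi - thet a < d"
proof -
  define e where "e = min (d / 2) 1"
  have e: "0 < e" "e < d" "e \<le> 1"
    using assms by (auto simp: e_def)
  define y where "y = tan ((pi - e) / 2)"
  have y: "2 * arctan y = pi - e"
    using e pi_gt3 unfolding y_def by (subst arctan_tan) auto
  \<comment> \<open>\<open>warp\<close> fixes the multiples of \<open>2 * pi\<close> and is
    therefore unbounded; the radius at which \<open>V\<close> equals \<open>2 * pi * N\<close> has
    an angle beyond \<open>pi - e\<close>.\<close>
  obtain N :: nat where N: "y < 2 * pi * real N"
    using reals_Archimedean3[of "2 * pi"] pi_gt_zero by (auto simp: mult.commute)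
  obtain a where a: "0 \<le> a" "a < 1" "V a = 2 * pi * real N"
    using V_surj[of "2 * pi * real N"] by auto
  have "warp (V a) = 2 * pi * real N"
    using a(3) warp_2pi[of "int N"] by simp
  then have "arctan y < arctan (warp (V a))"
    using N by (simp add: arctan_less_iff)
  then show ?thesis
    using a y e by (intro exI[of _ a]) (simp add: thet_def)
qed

lemma continuous_cc: "continuous_map (TT full) (top_of_set (sphere 0 1)) cc"
  unfolding TT_def
proof (rule ext.continuous_map_ext)
  have "continuous_on XX (\<lambda>p. phi (fst p))"
    using continuous_on_compose2[OF continuous_phi continuous_on_fst[OF continuous_on_id], of XX] by simp
  then have "continuous_map (top_of_set XX) (top_of_set (sphere 0 1)) (\<lambda>p. phi (fst p))"
    by (auto simp: continuous_map_in_subtopology phi_def)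
  then show "continuous_map (top_of_set XX) (top_of_set (sphere 0 1)) cc"
    by (rule continuous_map_eq) (simp add: cc_XX)
  have cc_in: "cc p = cis (sgnj (lab p) * thet (rad p))" if "p \<in> XX \<union> new_points full" for p
    using cc_eq that topspace_TT by blast
  fix p assume p: "p \<in> new_points full"
  then show "cc p \<in> topspace (top_of_set (sphere 0 1))"
    using cc_in[of p] by simp
  fix U assume U: "openin (top_of_set (sphere 0 1)) U" "cc p \<in> U"
  from p show "\<exists>a>0. \<forall>x\<in>NB p a. cc x \<in> U"
  proof (cases rule: new_pointE)
    case 1
    then have "phi (warp 0) \<in> U"
      using U(2) cc_in[of p] p warp_0 thet_0 by (simp add: phi_def)
    moreover have "openin euclideanreal {t \<in> topspace euclideanreal. phi (warp t) \<in> U}"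
    proof (rule openin_continuous_map_preimage[OF _ U(1)])
      have "continuous_on UNIV (\<lambda>t. phi (warp t))"
        using continuous_on_compose2[OF continuous_phi, of UNIV warp] by (simp add: continuous_at_imp_continuous_on isCont_warp)
      then show "continuous_map euclideanreal (top_of_set (sphere 0 1)) (\<lambda>t. phi (warp t))"
        by (auto simp: continuous_map_in_subtopology phi_def)
    qed
    ultimately obtain e where e: "e > 0" "ball 0 e \<subseteq> {t. phi (warp t) \<in> U}"
      using open_contains_ball[of "{t. phi (warp t) \<in> U}"] by auto
    \<comment> \<open>With this radius, \<open>\<bar>mu\<bar> < a\<close> forces
      \<open>\<bar>Psi\<bar> < e\<close>.\<close>
    obtain a where a: "0 \<le> a" "a < 1" "V a = e"
      using V_surj[of e] e(1) by auto
    have "a > 0"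
      using a e V_0 by (cases "a = 0") auto
    have "cc x \<in> U" if "x \<in> NB p a" for x
    proof -
      have x: "x \<in> XX" "\<bar>mu (snd x)\<bar> < a"
        using that 1 by (auto simp: NB_inf)
      then have "\<bar>mu (snd x)\<bar> < 1"
        using a by simp
      then have "\<bar>Psi (snd x)\<bar> = V \<bar>mu (snd x)\<bar>"
        using Psi_eq[of "snd x"] sgnj[of "lobe (snd x)"] V_nonneg[of "\<bar>mu (snd x)\<bar>"] by (auto simp: abs_mult)
      also have "\<dots> < e"
        using V_strict_mono[of "\<bar>mu (snd x)\<bar>" a] x(2) a by simp
      finally have "Psi (snd x) \<in> ball 0 e"
        by simp
      then show ?thesis
        using e(2) XX_not_end[OF x(1)] by (auto simp: cc_def)
    qed
    then show ?thesis
      using \<open>a > 0\<close> by blast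
  next
    case (2 j)
    then have m1: "-1 \<in> U"
      using U(2) by (simp add: cc_def)
    \<comment> \<open>Arms of both signs may lead to the end, so -1 is approached both as
      \<open>cis pi\<close> and as \<open>cis (- pi)\<close>.\<close>
    obtain d where d: "d > 0" "\<And>t. \<bar>t - pi\<bar> < d \<Longrightarrow> cis t \<in> U"
      using cis_near[OF U(1), of pi] m1 by auto
    obtain d' where d': "d' > 0" "\<And>t. \<bar>t - (- pi)\<bar> < d' \<Longrightarrow> cis t \<in> U"
      using cis_near[OF U(1), of "- pi"] m1 by auto
    obtain b where b: "0 \<le> b" "b < 1" "pi - thet b < min d d'"
      using thet_lim[of "min d d'"] d(1) d'(1) by auto
    have "cc x \<in> U" if "x \<in> NB p (1 - b)" for x
    proof -
      have x: "x \<in> XX" "b < rad x" "rad x < 1"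
        using that 2 rad_XX_less by (auto simp: NB_end rad_XX)
      then have "thet b \<le> thet (rad x)" "thet (rad x) \<le> pi"
        using thet_mono[of b "rad x"] thet_bounds[of "rad x"] b by auto
      then have near: "\<bar>thet (rad x) - pi\<bar> < d" "\<bar>- thet (rad x) - (- pi)\<bar> < d'"
        using b(3) by auto
      have "cis (thet (rad x)) \<in> U" "cis (- thet (rad x)) \<in> U"
        by (rule d(2)[OF near(1)], rule d'(2)[OF near(2)])
      then show ?thesis
        using cc_in[of x] x(1) sgnj[of "lab x"] by auto
    qed
    then show ?thesis
      using b(2) by (intro exI[of _ "1 - b"]) auto
  qed
qed

lemma rad_01:
  assumes "p \<in> topspace (TT full)"
  shows "rad p \<in> {0..1}"
  using assms by (cases rule: TT_cases) (auto simp: rad_XX)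

lemma labelling_fst: "star_labelling (TT False) fst (2 * k) False \<sigma> rad lab en"
proof (rule labelling)
  fix x y assume "x \<in> topspace (TT False)" "y \<in> topspace (TT False)"
  then have x: "x \<in> XX" and y: "y \<in> XX"
    by (auto simp: topspace_TT new_points_def)
  show "fst y = fst x" if "rad y = rad x" "lab y = lab x"
    using that x y by (simp add: fst_XX)
  show "rad y = rad x" if "fst y = fst x"
  proof -
    have b: "0 \<le> rad x" "rad x < 1" "0 \<le> rad y" "rad y < 1"
      using x y rad_XX_less by (auto simp: rad_XX)
    have "\<bar>sgnj (lab y) * warp (V (rad y))\<bar> = \<bar>sgnj (lab x) * warp (V (rad x))\<bar>"
      using that x y fst_XX by simp
    then have "warp (V (rad y)) = warp (V (rad x))"
      using sgnj[of "lab x"] sgnj[of "lab y"] warp_V_nonneg[OF b(1,2)] warp_V_nonneg[OF b(3,4)]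
      by (auto simp: abs_mult)
    then show ?thesis
      using warp_V_strict_mono[of "rad x" "rad y"] warp_V_strict_mono[of "rad y" "rad x"] b
      by (metis less_irrefl linorder_neqE_linordered_idom)
  qed
qed

text \<open>The real part of the value does not see the sign of the arm, and it determines the angle
  because the cosine is injective on \<open>{0..pi}\<close>; the angle determines the
  radius.\<close>

lemma labelling_cc: "star_labelling (TT True) cc (2 * k) True \<sigma> rad lab en"
proof (rule labelling)
  fix x y assume x: "x \<in> topspace (TT True)" and y: "y \<in> topspace (TT True)"
  show "cc y = cc x" if "rad y = rad x" "lab y = lab x"
    using that cc_eq[OF x] cc_eq[OF y] by simp
  show "rad y = rad x" if "cc y = cc x"
  proof -
    have c: "Re (cc p) = cos (thet (rad p))" if "p \<in> topspace (TT True)" for p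
      using cc_eq[OF that] sgnj[of "lab p"] by auto
    have "cos (thet (rad y)) = cos (thet (rad x))"
      using that c[OF x] c[OF y] by simp
    then have "thet (rad y) = thet (rad x)"
      using thet_bounds[OF rad_01[OF x]] thet_bounds[OF rad_01[OF y]] by (simp add: cos_inj_pi)
    then show ?thesis
      using thet_inj rad_01[OF x] rad_01[OF y] by blast
  qed
qed

text \<open>The radii at which \<open>\<bar>Psi\<bar>\<close> is a multiple of
  \<open>2 * pi\<close>, that is, those of the critical classes. The choice is unique as
  \<open>V\<close> is injective on the range in question.\<close>

definition zz :: "nat \<Rightarrow> real" where
  "zz i = (SOME r. 0 \<le> r \<and> r < 1 \<and> V r = 2 * pi * real i)"

lemma zz: "0 \<le> zz i" "zz i < 1" "V (zz i) = 2 * pi * real i"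
proof -
  have "\<exists>r. 0 \<le> r \<and> r < 1 \<and> V r = 2 * pi * real i"
    using V_surj[of "2 * pi * real i"] by auto
  from someI_ex[OF this] show "0 \<le> zz i" "zz i < 1" "V (zz i) = 2 * pi * real i"
    unfolding zz_def by auto
qed

lemma V_less_iff: "0 \<le> a \<Longrightarrow> a < 1 \<Longrightarrow> 0 \<le> b \<Longrightarrow> b < 1 \<Longrightarrow> V a < V b \<longleftrightarrow> a < b"
  using V_strict_mono[of a b] V_strict_mono[of b a] by (metis less_asym less_irrefl linorder_neqE_linordered_idom)

lemma V_eq_iff: "0 \<le> a \<Longrightarrow> a < 1 \<Longrightarrow> 0 \<le> b \<Longrightarrow> b < 1 \<Longrightarrow> V a = V b \<longleftrightarrow> a = b"
  using V_less_iff[of a b] V_less_iff[of b a] by (metis less_irrefl linorder_neqE_linordered_idom)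

lemma zz_strict_mono: "strict_mono zz"
proof (rule strict_monoI)
  fix i j :: nat assume "i < j"
  then have "V (zz i) < V (zz j)"
    using pi_gt_zero by (simp add: zz)
  then show "zz i < zz j"
    using V_less_iff zz by blast
qed

lemma zz_0: "zz 0 = 0"
  using V_eq_iff[of "zz 0" 0] zz[of 0] V_0 by simp

lemma zz_lim: "zz \<longlonglongrightarrow> 1"
proof (rule order_tendstoI)
  fix a :: real assume a: "a < 1"
  define b where "b = max a 0"
  have b: "0 \<le> b" "b < 1" "a \<le> b"
    using a by (auto simp: b_def)
  obtain N :: nat where N: "V b < 2 * pi * real N"
    using reals_Archimedean3[of "2 * pi"] pi_gt_zero by (auto simp: mult.commute)
  have "a < zz i" if "i \<ge> N" for i
  proof -
    have "2 * pi * real N \<le> 2 * pi * real i"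
      using that pi_gt_zero by simp
    then have "V b < V (zz i)"
      unfolding zz(3) by (rule less_le_trans[OF N])
    then show ?thesis
      using V_less_iff[of b "zz i"] b zz[of i] by simp
  qed
  then show "\<forall>\<^sub>F i in sequentially. a < zz i"
    by (auto simp: eventually_sequentially)
next
  fix a :: real assume "1 < a"
  then show "\<forall>\<^sub>F i in sequentially. zz i < a"
    using zz(2) by (intro always_eventually allI) (meson less_trans)
qed

lemma critical_iff: "p \<in> critical_points eqn XX fst \<longleftrightarrow> p \<in> XX \<and> rad p \<in> range zz"
proof -
  have "(\<exists>n :: int. Psi (snd p) = 2 * pi * n) \<longleftrightarrow> rad p \<in> range zz" if p: "p \<in> XX"
  proof -
    have r: "0 \<le> rad p" "rad p < 1"
      using p rad_XX_less by (auto simp: rad_XX)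
    have P: "Psi (snd p) = sgnj (lab p) * V (rad p)"
      using Psi_eq[of "snd p"] XX_iff[of p] p by (simp add: rad_XX lab_XX)
    show ?thesis
    proof
      assume "\<exists>n :: int. Psi (snd p) = 2 * pi * n"
      then obtain n :: int where "sgnj (lab p) * V (rad p) = 2 * pi * n"
        using P by auto
      then have "\<bar>sgnj (lab p) * V (rad p)\<bar> = 2 * pi * \<bar>real_of_int n\<bar>"
        by (simp add: abs_mult)
      then have "V (rad p) = 2 * pi * real (nat \<bar>n\<bar>)"
        using sgnj[of "lab p"] V_nonneg[OF r] by (auto simp: abs_mult)
      then have "V (rad p) = V (zz (nat \<bar>n\<bar>))"
        by (simp only: zz)
      then show "rad p \<in> range zz"
        using V_eq_iff[OF r zz(1,2)] by blast
    next
      assume "rad p \<in> range zz"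
      then obtain i where "V (rad p) = 2 * pi * real i"
        using zz(3) by auto
      then have "Psi (snd p) = 2 * pi * of_int (int i) \<or> Psi (snd p) = 2 * pi * of_int (- int i)"
        using P sgnj[of "lab p"] by auto
      then show "\<exists>n :: int. Psi (snd p) = 2 * pi * n"
        by blast
    qed
  qed
  then show ?thesis
    unfolding critical_points_eq by blast
qed

lemma critical_classes:
  assumes "star_labelling (TT full) c (2 * k) full \<sigma> rad lab en"
  shows "reeb_map (TT full) c ` critical_points eqn XX fst = {reeb_map (TT full) c (\<sigma> j (zz i)) | i j. j < 2 * k}"
proof -
  interpret star_labelling "TT full" c "2 * k" full \<sigma> rad lab en
    by (rule assms)
  show ?thesis
  proof (intro equalityI subsetI)
    fix q assume "q \<in> reeb_map (TT full) c ` critical_points eqn XX fst"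
    then obtain p i where p: "p \<in> XX" "rad p = zz i" "q = reeb_map (TT full) c p"
      using critical_iff by blast
    then have "p \<in> topspace (TT full)"
      by (simp add: topspace_TT)
    then obtain j where "j < 2 * k" "reeb_map (TT full) c p = reeb_map (TT full) c (\<sigma> j (rad p))"
      using \<sigma>_cover by blast
    then show "q \<in> {reeb_map (TT full) c (\<sigma> j (zz i)) | i j. j < 2 * k}"
      using p by auto
  next
    fix q assume "q \<in> {reeb_map (TT full) c (\<sigma> j (zz i)) | i j. j < 2 * k}"
    then obtain i j where q: "j < 2 * k" "q = reeb_map (TT full) c (\<sigma> j (zz i))" by blast
    have "\<sigma> j (zz i) \<in> XX"
      using \<sigma>_XX zz by blast
    moreover have "rad (\<sigma> j (zz i)) = zz i"
      using \<rho>_\<sigma>[OF q(1)] zz[of i] by (simp add: arm_dom_def)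
    ultimately have "\<sigma> j (zz i) \<in> critical_points eqn XX fst"
      using critical_iff by auto
    then show "q \<in> reeb_map (TT full) c ` critical_points eqn XX fst"
      using q(2) by blast
  qed
qed

section \<open>The two digraphs and the compactification\<close>

lemma pre_digraph_fst:
  "pre_digraph real_line (reeb_space (top_of_set XX) fst)
     (reeb_map (top_of_set XX) fst ` critical_points eqn XX fst) (reeb_fun fst)"
proof -
  interpret star_labelling "TT False" fst "2 * k" False \<sigma> rad lab en
    by (rule labelling_fst)
  interpret marked_star "reeb_space (TT False) fst" "2 * k" False "\<lambda>j r. reeb_map (TT False) fst (\<sigma> j r)"
    "reeb_fun rad" en zz "reeb_map (TT False) fst ` critical_points eqn XX fst"
    by unfold_locales
      (use zz_strict_mono zz_0 zz zz_lim critical_classes[OF labelling_fst] in auto)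
  have "continuous_map (TT False) euclideanreal fst"
    unfolding TT_False by (simp add: continuous_on_fst continuous_on_id)
  then have "continuous_map (reeb_space (TT False) fst) (target_top real_line) (reeb_fun fst)"
    using continuous_reeb_fun by (simp add: real_line_def)
  moreover have "inj_on (\<lambda>r. reeb_fun fst (reeb_map (TT False) fst (\<sigma> j r))) {0<..<1}" if j: "j < 2 * k" for j
  proof (rule inj_onI)
    fix a b :: real assume ab: "a \<in> {0<..<1}" "b \<in> {0<..<1}"
      and eq: "reeb_fun fst (reeb_map (TT False) fst (\<sigma> j a)) = reeb_fun fst (reeb_map (TT False) fst (\<sigma> j b))"
    have in_top: "\<sigma> j r \<in> topspace (TT False)" "rad (\<sigma> j r) = r" if "r \<in> {0<..<1}" for r
      using \<sigma>_in[OF j, of r] \<rho>_\<sigma>[OF j, of r] that by (simp_all add: arm_dom_def)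
    have "fst (\<sigma> j a) = fst (\<sigma> j b)"
      using eq reeb_fun_reeb_map[OF in_top(1)[OF ab(1)], of fst] reeb_fun_reeb_map[OF in_top(1)[OF ab(2)], of fst] by simp
    then have "rad (\<sigma> j a) = rad (\<sigma> j b)"
      using c_\<rho> in_top(1) ab by blast
    then show "a = b"
      using in_top(2) ab by simp
  qed
  ultimately show ?thesis
    using pre_digraph_star unfolding TT_False by blast
qed

text \<open>Outside the chosen neighbourhoods \<open>\<bar>mu\<bar>\<close> is bounded away from 0,
  because of the one at \<open>infp\<close>, and from 1, because of those at the finitely many ends.
  Such a region is compact by \<open>compact_mu_ge\<close>, and \<open>pt\<close> is continuous on
  it.\<close>

lemma compact_TT: "compact_space (TT True)"
  unfolding TT_def
proof (rule ext.compact_ext)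
  show "finite (new_points True)"
    by (simp add: new_points_def)
  fix a :: "real \<times> (real ^ 'm) \<Rightarrow> real" assume a: "\<And>p. p \<in> new_points True \<Longrightarrow> a p > 0"
  define b where "b = Min ((\<lambda>j. a (endp (en j))) ` {..<2 * k})"
  have fin: "finite ((\<lambda>j. a (endp (en j))) ` {..<2 * k})" "(\<lambda>j. a (endp (en j))) ` {..<2 * k} \<noteq> {}"
    using k by (auto simp: lessThan_empty_iff)
  have "b > 0"
    unfolding b_def Min_gr_iff[OF fin] using a by (auto simp: new_points_def)
  have b_le: "b \<le> a (endp (en j))" if "j < 2 * k" for j
    unfolding b_def using fin that by (intro Min_le) auto
  have ainf: "a infp > 0"
    using a by (simp add: new_points_def)
  let ?C = "{w. a infp \<le> \<bar>mu w\<bar>} \<inter> {w. \<bar>mu w\<bar> \<le> 1 - b}"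
  let ?D = "topspace (top_of_set XX) - (\<Union>p\<in>new_points True. NB p (a p))"
  have "closed {w. \<bar>mu w\<bar> \<le> 1 - b}"
    by (intro closed_Collect_le continuous_intros continuous_on_mu)
  then have C: "compact ?C"
    by (intro compact_Int_closed compact_mu_ge ainf)
  have sub: "?C \<subseteq> {w. \<bar>mu w\<bar> < 1}"
    using \<open>b > 0\<close> by auto
  have "compactin (top_of_set XX) (pt ` ?C)"
    using compact_continuous_image[OF continuous_on_pt[OF sub] C] pt_in sub
    by (auto simp: compactin_subtopology)
  moreover have "closedin (top_of_set XX) ?D"
    using ext.N_open by (intro closedin_diff closedin_topspace openin_Union) auto
  moreover have "?D \<subseteq> pt ` ?C"
  proof
    fix p assume p: "p \<in> ?D"
    then have pX: "p \<in> XX" "p \<notin> NB infp (a infp)" "\<And>j. j < 2 * k \<Longrightarrow> p \<notin> NB (endp (en j)) (a (endp (en j)))"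
      by (auto simp: new_points_def)
    then have lo: "a infp \<le> \<bar>mu (snd p)\<bar>"
      by (auto simp: NB_inf)
    then have "NN (snd p) \<noteq> 0"
      using ainf mu_eq_0_iff[of "snd p"] by auto
    then have "\<bar>mu (snd p)\<bar> \<le> 1 - a (endp (en (lobe (snd p))))"
      using pX(1) pX(3)[of "lobe (snd p)"] lobe[of "snd p"] by (auto simp: NB_end)
    then have "snd p \<in> ?C"
      using lo b_le[of "lobe (snd p)"] lobe[OF \<open>NN (snd p) \<noteq> 0\<close>] by simp
    moreover have "p = pt (snd p)"
      using pX(1) XX_iff by blast
    ultimately show "p \<in> pt ` ?C"
      by (rule image_eqI[rotated])
  qed
  ultimately show "compactin (top_of_set XX) ?D"
    using closed_compactin by blast
qed

lemma compactification_XX: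
  "compactification (top_of_set XX) (target_top real_line) fst (TT True) (target_top circle) id phi cc"
  unfolding compactification_def
proof (intro conjI ballI)
  interpret star_labelling "TT True" cc "2 * k" True \<sigma> rad lab en
    by (rule labelling_cc)
  show "compact_space (TT True)"
    by (rule compact_TT)
  show "connected_space (TT True)"
    by (rule connected_total)
  have "connected (sphere (0::complex) 1)"
    by (rule connected_sphere) simp
  then show "connected_space (target_top circle)"
    by (simp add: circle_def connected_space_subtopology flip: connectedin_iff_connected)
  show "embedding_map (top_of_set XX) (TT True) id"
    unfolding TT_def by (rule ext.embedding_ext)
  show "TT True closure_of (id ` topspace (top_of_set XX)) = topspace (TT True)"
  proof -
    have "TT True closure_of topspace (top_of_set XX) = topspace (TT True)"
      unfolding TT_def by (rule ext.closure_ext) (rule NB_nonempty)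
    then show ?thesis
      by simp
  qed
  show "embedding_map (target_top real_line) (target_top circle) phi"
    using embedding_phi by (simp add: real_line_def circle_def)
  show "target_top circle closure_of (phi ` topspace (target_top real_line)) = topspace (target_top circle)"
    using dense_phi by (simp add: real_line_def circle_def)
  show "continuous_map (TT True) (target_top circle) cc"
    using continuous_cc by (simp add: circle_def)
  show "cc (id p) = phi (fst p)" if "p \<in> topspace (top_of_set XX)" for p
    using that cc_XX by simp
qed

text \<open>The point \<open>infp\<close> has radius 0 and label 0, so it belongs to the central
  class, which is critical already since \<open>zz 0 = 0\<close>. Only the ends contribute further
  vertices.\<close>

lemma vertices_eq:
  "reeb_dc_vertices (top_of_set XX) (critical_points eqn XX fst) (TT True) id cc =
     {reeb_map (TT True) cc (\<sigma> j (zz i)) | i j. j < 2 * k} \<union> {reeb_map (TT True) cc (\<sigma> j 1) | j. True \<and> j < 2 * k}"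
proof -
  interpret star_labelling "TT True" cc "2 * k" True \<sigma> rad lab en
    by (rule labelling_cc)
  have new: "topspace (TT True) - id ` topspace (top_of_set XX) = new_points True"
    using ext.P_disj[of True] unfolding topspace_TT by auto
  have inf: "reeb_map (TT True) cc infp = reeb_map (TT True) cc (\<sigma> 0 (zz 0))"
  proof -
    have "infp \<in> topspace (TT True)"
      by (simp add: topspace_TT new_points_def)
    then show ?thesis
      using n_pos by (subst reeb_map_eq_iff) (auto simp: zz_0 \<sigma>_in \<rho>_\<sigma> lab_\<sigma> arm_dom_def)
  qed
  have ends: "reeb_map (TT True) cc ` endp ` en ` {..<2 * k} = {reeb_map (TT True) cc (\<sigma> j 1) | j. True \<and> j < 2 * k}"
    by (auto simp: \<sigma>_def)
  have "reeb_dc_vertices (top_of_set XX) (critical_points eqn XX fst) (TT True) id cc =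
      reeb_map (TT True) cc ` critical_points eqn XX fst \<union> reeb_map (TT True) cc ` new_points True"
    unfolding reeb_dc_vertices_def new by (simp add: image_Un)
  also have "reeb_map (TT True) cc ` new_points True =
      insert (reeb_map (TT True) cc (\<sigma> 0 (zz 0))) {reeb_map (TT True) cc (\<sigma> j 1) | j. True \<and> j < 2 * k}"
    unfolding new_points_def using inf ends by simp
  finally show ?thesis
    unfolding critical_classes[OF labelling_cc] using n_pos by blast
qed

text \<open>The two label ranges overlap in the \<open>nc\<close> labels from \<open>nd\<close> to
  \<open>nd + nc\<close>, which become loops; labels below belong to ascending arms only, labels
  above to descending arms only.\<close>

lemma reeb_dc_XX:
  assumes up: "en ` {j. j < 2 * k \<and> sgnj j = 1} = {..<nd + nc}"
    and down: "en ` {j. j < 2 * k \<and> sgnj j = -1} = {nd..<nd + nc + ne}"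
  shows "reeb_dc_with_diagram nd ne nc (top_of_set XX) (critical_points eqn XX fst) real_line fst
    (TT True) circle id phi cc"
proof -
  let ?S = "reeb_dc_vertices (top_of_set XX) (critical_points eqn XX fst) (TT True) id cc"
  interpret star_labelling "TT True" cc "2 * k" True \<sigma> rad lab en
    by (rule labelling_cc)
  interpret circle_star "reeb_space (TT True) cc" "2 * k" "\<lambda>j r. reeb_map (TT True) cc (\<sigma> j r)"
    "reeb_fun rad" en zz ?S "reeb_fun cc" sgnj thet
  proof (unfold_locales, goal_cases)
    case 1 show ?case by (rule zz_strict_mono)
  next
    case 2 show ?case by (rule zz_0)
  next
    case (3 i) show ?case by (rule zz)
  next
    case 4 show ?case by (rule zz_lim)
  next
    case 5 show ?case by (rule vertices_eq)
  next
    case 6 show ?case by (rule continuous_reeb_fun[OF continuous_cc])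
  next
    case (7 j r)
    then have r: "r \<in> arm_dom True" by (simp add: arm_dom_def)
    have "reeb_fun cc (reeb_map (TT True) cc (\<sigma> j r)) = cc (\<sigma> j r)"
      by (rule reeb_fun_reeb_map[OF \<sigma>_in[OF 7(1) r]])
    also have "\<dots> = cis (sgnj (lab (\<sigma> j r)) * thet r)"
      using cc_eq[OF \<sigma>_in[OF 7(1) r]] \<rho>_\<sigma>[OF 7(1) r] by simp
    \<comment> \<open>For \<open>r = 0\<close> and \<open>r = 1\<close> the label need not be
      \<open>j\<close>, but the angles 0 and \<open>pi\<close> give the same value for either
      sign.\<close>
    also have "\<dots> = cis (sgnj j * thet r)"
      using lab_\<sigma>[OF 7(1) r] 7 sgnj[of "en j"] sgnj[of j] thet_0 thet_1 by auto
    finally show ?case .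
  next
    case (8 j) show ?case by (rule sgnj)
  next
    case 9 show ?case by (rule thet_0)
  next
    case 10 show ?case by (rule thet_1)
  next
    case 11 show ?case by (rule thet_strict_mono)
  next
    case (12 d) then show ?case by (rule thet_lim)
  qed
  have sign: "has_sign x 1 \<longleftrightarrow> x \<in> {..<nd + nc}" "has_sign x (-1) \<longleftrightarrow> x \<in> {nd..<nd + nc + ne}" for x
    unfolding has_sign_def up[symmetric] down[symmetric] by auto
  have "en ` {..<2 * k} = en ` {j. j < 2 * k \<and> sgnj j = 1} \<union> en ` {j. j < 2 * k \<and> sgnj j = -1}"
    using sgnj by auto
  then have img: "en ` {..<2 * k} = {..<nd + nc + ne}"
    unfolding up down by auto
  have "{x \<in> en ` {..<2 * k}. has_sign x 1 \<and> \<not> has_sign x (-1)} = {..<nd}"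
    "{x \<in> en ` {..<2 * k}. \<not> has_sign x 1 \<and> has_sign x (-1)} = {nd + nc..<nd + nc + ne}"
    "{x \<in> en ` {..<2 * k}. has_sign x 1 \<and> has_sign x (-1)} = {nd..<nd + nc}"
    unfolding sign img by auto
  then have "one_vertex_diagram nd ne nc circle (reeb_space (TT True) cc) ?S (reeb_fun cc)"
    by (intro one_vertex_circle_star) simp_all
  then show ?thesis
    unfolding reeb_dc_with_diagram_def reeb_dc_def
    using pre_digraph_fst compactification_XX pre_digraph_circle normal_circle_star by blast
qed

end

section \<open>The case without edges\<close>

lemma image_eq_singletonI: "(\<And>x. x \<in> A \<Longrightarrow> f x = b) \<Longrightarrow> A \<noteq> {} \<Longrightarrow> f ` A = {b}"
  by auto

lemma reeb_map_const:
  assumes "connected_space Z" "\<And>x. x \<in> topspace Z \<Longrightarrow> c x = y" "x \<in> topspace Z"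
  shows "reeb_map Z c x = topspace Z"
proof -
  have "subtopology Z {z. c z = c x} = Z"
    using assms by (intro subtopology_superset) auto
  then show ?thesis
    unfolding reeb_map_def using assms(1,3) by (simp add: connected_space_connected_component_set)
qed

text \<open>There are no 1-cells, and the point is a finite graph without edges, so
  \<open>NF\<close> is empty and one vertex remains.\<close>

lemma one_point_graph:
  assumes G: "topspace G = {g}" and c: "c g \<in> topspace (target_top Y)"
  shows "pre_digraph Y G {g} c" "normal_diagram Y G {g} c" "one_vertex_diagram 0 0 0 Y G {g} c"
proof -
  have haus: "Hausdorff_space G"
    using G by (auto simp: Hausdorff_space_def)
  have conn: "connectedin G {g}"
    by (simp add: G connectedin_sing)
  then have "connected_space G"
    using G connectedin_topspace[of G] by simp
  moreover have "continuous_map G (target_top Y) c"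
  proof -
    have "{x \<in> topspace G. c x \<in> U} = {} \<or> {x \<in> topspace G. c x \<in> U} = topspace G" for U
      using G by auto
    then show ?thesis
      unfolding continuous_map_def using G c by (metis (no_types, lifting) Pi_I openin_empty openin_topspace singletonD)
  qed
  moreover have "closedin G {g}"
    using G closedin_topspace[of G] by simp
  moreover have "one_cells G {g} = {}"
    unfolding one_cells_def by (simp add: G connected_components_of_def)
  ultimately show "pre_digraph Y G {g} c"
    using haus by (simp add: pre_digraph_def)
  have "finite_graph (subtopology G {g})"
    unfolding finite_graph_def
    by (intro conjI exI[of _ "{g}"] exI[of _ "{}"]) (auto simp: haus Hausdorff_space_subtopology G disjoint_family_on_def)
  moreover have "openin G {g}"
    using G openin_topspace[of G] by simp
  ultimately have "\<exists>N U. openin G U \<and> g \<in> U \<and> U \<subseteq> N \<and> connectedin G N \<and> finite_graph (subtopology G N) \<and> N \<inter> {g} \<subseteq> {g}"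
    using conn by (intro exI[of _ "{g}"]) simp
  then have NF: "NF G {g} = {}"
    unfolding NF_def G by blast
  have comp: "nf_components G {g} = {{g}}"
    unfolding nf_components_def NF
    by (rule connected_components_of_open_partition)
       (auto simp: G connectedin_subtopology conn openin_subtopology_self subtopology_superset \<open>openin G {g}\<close>)
  show "normal_diagram Y G {g} c"
    unfolding normal_diagram_def diagram_vertices_single[OF comp] by simp
  show "one_vertex_diagram 0 0 0 Y G {g} c"
    by (rule one_vertex_diagramI[OF diagram_vertices_single[OF comp]]) (simp_all add: NF)
qed

text \<open>On the hyperplane \<open>fst\<close> is constant, so all points are critical and the
  Reeb space is a single 0-cell. The added point has the whole space as its only neighbourhood,
  which makes compactness immediate, and the target stays the line.\<close>

lemma no_edges:
  fixes X0 :: "(real \<times> (real ^ 'm::finite)) set"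
  defines "X0 \<equiv> {p. fst p = 0}"
  shows "real_analytic_manifold fst X0"
    and "reeb_dc_with_diagram 0 0 0 (top_of_set X0) (critical_points fst X0 fst) real_line fst
      (ext_top (top_of_set X0) {(1, 0)} (\<lambda>_ _. X0)) real_line id id (\<lambda>_. 0)"
proof -
  have D: "frechet_derivative fst (at p) = (fst :: real \<times> (real ^ 'm) \<Rightarrow> real)" for p
    by (rule frechet_derivative_at[OF bounded_linear_imp_has_derivative[OF bounded_linear_fst], symmetric])
  have *: "(1, 0) \<in> (Basis :: (real \<times> (real ^ 'm)) set)"
    by (auto simp: Basis_prod_def)
  have "real_analytic_on (fst :: real \<times> (real ^ 'm) \<Rightarrow> real) UNIV"
    using real_analytic_on_inner[OF *] by (simp add: inner_prod_def)
  then show "real_analytic_manifold fst X0"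
    unfolding real_analytic_manifold_def
  proof (intro conjI ballI)
    show "\<exists>\<K>\<subseteq>components {p :: real \<times> (real ^ 'm). fst p = 0}. X0 = \<Union>\<K>"
      unfolding X0_def by (intro exI[of _ "components {p. fst p = 0}"] conjI order_refl Union_components[symmetric])
    show "surj (frechet_derivative fst (at p))" for p :: "real \<times> (real ^ 'm)"
      unfolding D by (rule surjI[of fst "\<lambda>x. (x, 0)"]) simp
  qed
  have crit: "critical_points fst X0 fst = X0"
  proof -
    have "1 \<notin> fst ` {v :: real \<times> (real ^ 'm). fst v = 0}"
      by auto
    then have "fst ` {v :: real \<times> (real ^ 'm). fst v = 0} \<noteq> UNIV"
      by (metis UNIV_I)
    then show ?thesis
      unfolding critical_points_def tangent_space_def D by simp
  qed
  let ?X = "top_of_set X0"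
  let ?Z = "ext_top ?X {(1, 0)} (\<lambda>_ _. X0)"
  have X0: "X0 = {0} \<times> UNIV"
    by (auto simp: X0_def)
  interpret extension ?X "{(1, 0)}" "\<lambda>_ _. X0"
    by unfold_locales (auto simp: X0_def)
  have "connected X0"
    unfolding X0 by (intro connected_Times) auto
  then have conX: "connected_space ?X"
    by (simp add: connected_space_subtopology flip: connectedin_iff_connected)
  have dense: "?Z closure_of X0 = topspace ?Z"
    using closure_ext X0 by simp
  have "connectedin ?Z X0"
    using connectedin_ext[of X0] conX connectedin_topspace[of ?X] by simp
  then have conZ: "connected_space ?Z"
    using connectedin_closure_of[of ?Z X0] dense connectedin_topspace by metis
  have comp: "compactification ?X (target_top real_line) fst ?Z (target_top real_line) id id (\<lambda>_. 0)"
    unfolding compactification_def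
  proof (intro conjI ballI)
    show "compact_space ?Z"
      by (rule compact_ext) auto
    show "?Z closure_of (id ` topspace ?X) = topspace ?Z"
      using dense by simp
    show "embedding_map (target_top real_line) (target_top real_line) id"
      by (simp add: real_line_def embedding_map_def)
    have "connectedin euclideanreal UNIV"
      by (simp add: connectedin_iff_connected)
    then show "connected_space (target_top real_line)"
      using connectedin_topspace[of euclideanreal] by (simp add: real_line_def)
  qed (use conZ embedding_ext in \<open>auto simp: real_line_def X0_def\<close>)
  have ne: "topspace ?X \<noteq> {}" "topspace ?Z \<noteq> {}"
    unfolding topspace_ext by (auto simp: X0)
  have rX: "reeb_map ?X fst x = topspace ?X" if "x \<in> topspace ?X" for x
    by (rule reeb_map_const[OF conX _ that, of _ 0]) (simp add: X0_def)
  have rZ: "reeb_map ?Z (\<lambda>_. 0::real) x = topspace ?Z" if "x \<in> topspace ?Z" for x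
    by (rule reeb_map_const[OF conZ refl that])
  have tX: "topspace (reeb_space ?X fst) = {topspace ?X}"
    unfolding topspace_reeb_space by (rule image_eq_singletonI[OF rX ne(1)])
  have tZ: "topspace (reeb_space ?Z (\<lambda>_. 0::real)) = {topspace ?Z}"
    unfolding topspace_reeb_space by (rule image_eq_singletonI[OF rZ ne(2)])
  have SX: "reeb_map ?X fst ` critical_points fst X0 fst = {topspace ?X}"
    unfolding crit using image_eq_singletonI[OF rX ne(1)] by simp
  have "id ` X0 \<union> (topspace ?Z - id ` topspace ?X) = topspace ?Z"
    unfolding topspace_ext by auto
  then have SZ: "reeb_dc_vertices ?X (critical_points fst X0 fst) ?Z id (\<lambda>_. 0::real) = {topspace ?Z}"
    unfolding reeb_dc_vertices_def crit using image_eq_singletonI[OF rZ ne(2)] by (simp only:)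
  have "UNIV = topspace (target_top real_line)"
    by (simp add: real_line_def)
  then show "reeb_dc_with_diagram 0 0 0 ?X (critical_points fst X0 fst) real_line fst ?Z real_line id id (\<lambda>_. 0)"
    unfolding reeb_dc_with_diagram_def reeb_dc_def SX SZ
    using one_point_graph[OF tX, of "reeb_fun fst" real_line] one_point_graph[OF tZ, of "reeb_fun (\<lambda>_. 0)" real_line] comp
    by blast
qed

section \<open>Distribution of the ends\<close>

text \<open>Arms of the same sign are distributed over the ends of that sign, the last end taking all surplus arms.\<close>

lemma distribute_ends:
  fixes nd ne nc :: nat
  assumes "0 < nd + ne + nc"
  obtains k s en where "2 \<le> k" "s = 0 \<or> s = 1 \<or> s = (-1::real)"
    "en ` {j. j < 2 * k \<and> (if s = 0 then (-1) ^ j else s) = 1} = {..<nd + nc}"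
    "en ` {j. j < 2 * k \<and> (if s = 0 then (-1) ^ j else s) = -1} = {nd..<nd + nc + ne}"
proof -
  \<comment> \<open>\<open>k\<close> arms of each sign suffice for all ends of that sign; the
    summand 2 ensures \<open>2 \<le> k\<close>.\<close>
  define k where "k = nd + ne + nc + 2"
  have surj: "(\<lambda>j. min j (p - 1)) ` {..<l} = {..<p}" if "0 < p" "p \<le> l" for p l :: nat
  proof -
    have "x \<in> (\<lambda>j. min j (p - 1)) ` {..<l}" if "x < p" for x
      using that \<open>p \<le> l\<close> by (intro image_eqI[of _ _ x]) auto
    then show ?thesis
      using that by auto
  qed
  have k: "2 \<le> k" "nd + nc \<le> k" "ne + nc \<le> k"
    by (simp_all add: k_def)
  consider "0 < nd + nc" "0 < ne + nc" | "ne + nc = 0" | "nd + nc = 0"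
    by linarith
  then show thesis
  proof cases
    case 1
    \<comment> \<open>Even arms ascend and fill the labels below \<open>nd + nc\<close>, odd arms
      descend and fill those from \<open>nd\<close> on.\<close>
    define en where "en j = (if even j then min (j div 2) (nd + nc - 1) else nd + min (j div 2) (ne + nc - 1))" for j
    have ev: "{j. j < 2 * k \<and> (-1) ^ j = (1::real)} = (\<lambda>i. 2 * i) ` {..<k}"
    proof (intro equalityI subsetI)
      fix j assume j: "j \<in> {j. j < 2 * k \<and> (-1) ^ j = (1::real)}"
      then have "even j" by (cases "even j") auto
      then show "j \<in> (\<lambda>i. 2 * i) ` {..<k}"
        using j by (auto elim!: evenE)
    qed auto
    have od: "{j. j < 2 * k \<and> (-1) ^ j = (-1::real)} = (\<lambda>i. 2 * i + 1) ` {..<k}"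
    proof (intro equalityI subsetI)
      fix j assume j: "j \<in> {j. j < 2 * k \<and> (-1) ^ j = (-1::real)}"
      then have "odd j" by (cases "even j") auto
      then show "j \<in> (\<lambda>i. 2 * i + 1) ` {..<k}"
        using j by (auto elim!: oddE)
    qed auto
    have "en ` (\<lambda>i. 2 * i) ` {..<k} = (\<lambda>i. min i (nd + nc - 1)) ` {..<k}"
      unfolding image_image by (intro image_cong) (auto simp: en_def)
    also have "\<dots> = {..<nd + nc}"
      by (rule surj[OF 1(1) k(2)])
    finally have A: "en ` (\<lambda>i. 2 * i) ` {..<k} = {..<nd + nc}" .
    have "en ` (\<lambda>i. 2 * i + 1) ` {..<k} = (+) nd ` (\<lambda>i. min i (ne + nc - 1)) ` {..<k}"
      unfolding image_image by (intro image_cong) (auto simp: en_def)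
    also have "\<dots> = (+) nd ` {..<ne + nc}"
      by (simp only: surj[OF 1(2) k(3)])
    also have "\<dots> = {nd..<nd + nc + ne}"
      by (simp add: lessThan_atLeast0 add.commute add.left_commute)
    finally have B: "en ` (\<lambda>i. 2 * i + 1) ` {..<k} = {nd..<nd + nc + ne}" .
    show thesis
      by (rule that[of k 0 en]) (use k A B ev od in simp_all)
  next
    case 2
    \<comment> \<open>No descending arms are wanted: with \<open>s = 1\<close> all
      \<open>2 * k\<close> arms ascend.\<close>
    then have "(\<lambda>j. min j (nd + nc - 1)) ` {..<2 * k} = {..<nd + nc}"
      using assms k by (intro surj) auto
    then show thesis
      using 2 k by (intro that[of k 1 "\<lambda>j. min j (nd + nc - 1)"]) (auto simp: lessThan_def)
  next
    case 3
    then have "(\<lambda>j. min j (ne + nc - 1)) ` {..<2 * k} = {..<ne + nc}"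
      using assms k by (intro surj) auto
    then show thesis
      using 3 k by (intro that[of k "-1" "\<lambda>j. min j (ne + nc - 1)"]) (auto simp: lessThan_def)
  qed
qed

theorem theorem1:
  fixes n\<^sub>d n\<^sub>e n\<^sub>c :: nat
  assumes "CARD('m::finite) > 1"
  shows "\<exists>(e :: real \<times> (real ^ 'm) \<Rightarrow> real) X.
    real_analytic_manifold e X \<and>
    ((\<exists>(X0 :: (real \<times> (real ^ 'm)) topology) \<phi>X \<phi>Y c0.
        reeb_dc (top_of_set X) (critical_points e X fst) real_line fst X0 real_line \<phi>X \<phi>Y c0) \<or>
     (\<exists>(X0 :: (real \<times> (real ^ 'm)) topology) \<phi>X \<phi>Y c0.
        reeb_dc (top_of_set X) (critical_points e X fst) real_line fst X0 circle \<phi>X \<phi>Y c0)) \<and>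
    ((\<exists>(X0 :: (real \<times> (real ^ 'm)) topology) \<phi>X \<phi>Y c0.
        reeb_dc_with_diagram n\<^sub>d n\<^sub>e n\<^sub>c
          (top_of_set X) (critical_points e X fst) real_line fst X0 real_line \<phi>X \<phi>Y c0) \<or>
     (\<exists>(X0 :: (real \<times> (real ^ 'm)) topology) \<phi>X \<phi>Y c0.
        reeb_dc_with_diagram n\<^sub>d n\<^sub>e n\<^sub>c
          (top_of_set X) (critical_points e X fst) real_line fst X0 circle \<phi>X \<phi>Y c0))"
proof (cases "0 < n\<^sub>d + n\<^sub>e + n\<^sub>c")
  case True
  \<comment> \<open>Two distinct indices are needed for the complex coordinate of the branched
    cover.\<close>
  have "\<not> is_singleton (UNIV :: 'm set)"
    using assms by (auto simp: is_singleton_altdef)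
  then obtain i0 i1 :: 'm where i: "i0 \<noteq> i1"
    by (metis UNIV_I is_singletonI' empty_iff)
  obtain k s en where en: "2 \<le> k" "s = 0 \<or> s = 1 \<or> s = (-1::real)"
    "en ` {j. j < 2 * k \<and> (if s = 0 then (-1) ^ j else s) = 1} = {..<n\<^sub>d + n\<^sub>c}"
    "en ` {j. j < 2 * k \<and> (if s = 0 then (-1) ^ j else s) = -1} = {n\<^sub>d..<n\<^sub>d + n\<^sub>c + n\<^sub>e}"
    using distribute_ends[OF True] .
  interpret compactified i0 i1 k s en
    by unfold_locales (use i en in auto)
  have "reeb_dc_with_diagram n\<^sub>d n\<^sub>e n\<^sub>c (top_of_set XX) (critical_points eqn XX fst) real_line fst
      (TT True) circle id phi cc"
    by (rule reeb_dc_XX) (unfold sgnj_def, fact en(3), fact en(4))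
  then show ?thesis
    using manifold unfolding reeb_dc_with_diagram_def by blast
next
  case False
  then show ?thesis
    using no_edges unfolding reeb_dc_with_diagram_def by (simp, blast)
qed

end
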